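(* Let $(m(n))_{n\ge1}$ be a sequence of positive integers such that $m(n)/n$ is bounded away from both zero and infinity, and let $g_n:\{0,1\}^E\to\{0,1\}$ be the indicator function of the event $\mathcal{C}(\Lambda_{n,m(n)})$ that there is a horizontal crossing of present edges in the rectangle $\Lambda_{n,m(n)}=[0,n]\times[0,m(n)]$ of the square lattice. Let $r\in(\tfrac12,1]$. Then for $\mathbb{P}_r$-almost every $\psi\in\{0,1\}^E$, for every $\varepsilon\in(0,1)$, $$ \lim_{n\to\infty}\Big(\mathbb{E}_{1/(2r)}\big[g_n(\psi\cdot\xi)\,g_n(\psi\cdot\xi^\varepsilon)\,\big|\,\psi\big]-\mathbb{E}_{1/(2r)}\big[g_n(\psi\cdot\xi)\,\big|\,\psi\big]^2\Big)=0 . $$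
   Context: $E$ is the set of nearest-neighbour edges of the square lattice $\mathbb{Z}^2$. An element $\omega\in\{0,1\}^E$ is a configuration of edges; $e$ is present if $\omega_e=1$ and absent otherwise. The event $\mathcal{C}(\Lambda_{n,m})$ of a horizontal crossing means there is a path of present edges contained in $[0,n]\times[0,m]$ connecting the left side $\{0\}\times[0,m]$ to the right side $\{n\}\times[0,m]$. For $q\in[0,1]$, $\mathbb{P}_q$ is the product measure on $\{0,1\}^E$ under which each coordinate equals $1$ with probability $q$, and $\mathbb{E}_q$ is the corresponding expectation. Here $\psi\sim\mathbb{P}_r$, $\xi\sim\mathbb{P}_{1/(2r)}$ is independent of $\psi$, and $\xi^\varepsilon$ is obtained from $\xi$ by re-sampling each coordinate independently with probability $\varepsilon$, again according to $\mathbb{P}_{1/(2r)}$ (independently of $\psi$). The symbol $\cdot$ denotes coordinate-wise multiplication, and $\mathbb{E}_{1/(2r)}[\,\cdot\,|\,\psi]$ denotes averaging over $(\xi,\xi^\varepsilon)$ with $\psi$ fixed. *)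

theory Defs
  imports "HOL-Probability.Probability"
begin

type_synonym vertex = "int \<times> int"

type_synonym edge = "vertex set"

(* Configurations are bool-valued, True for a present edge (value 1), False for an absent one. *)
type_synonym configuration = "edge \<Rightarrow> bool"

definition lattice_edges :: "edge set" where
  "lattice_edges = {{x, y} | x y :: vertex. \<bar>fst x - fst y\<bar> + \<bar>snd x - snd y\<bar> = 1}"

definition configurations :: "configuration set" where
  "configurations = lattice_edges \<rightarrow>\<^sub>E UNIV"

definition percolation :: "real \<Rightarrow> configuration measure" where
  "percolation q = PiM lattice_edges (\<lambda>_. measure_pmf (bernoulli_pmf q))"

(* On {0,1}-valued coordinates, encoded as bool, multiplication is conjunction. *)
definition config_mult :: "configuration \<Rightarrow> configuration \<Rightarrow> configuration" (infixl "\<odot>" 70) where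
  "\<psi> \<odot> \<xi> = (\<lambda>e\<in>lattice_edges. \<psi> e \<and> \<xi> e)"

(* eta marks the coordinates to be re-sampled, xi' supplies the fresh values. *)
definition resample :: "configuration \<Rightarrow> configuration \<Rightarrow> configuration \<Rightarrow> configuration" where
  "resample \<eta> \<xi>' \<xi> = (\<lambda>e\<in>lattice_edges. if \<eta> e then \<xi>' e else \<xi> e)"

(* The law of independent xi, eta, xi', where xi and xi' have parameter p and eta has
   parameter \<epsilon>; then (xi, resample eta xi' xi) is a configuration together with its
   \<epsilon>-noised version. *)
definition noise_space ::
    "real \<Rightarrow> real \<Rightarrow> (configuration \<times> configuration \<times> configuration) measure" where
  "noise_space p \<epsilon> = percolation p \<Otimes>\<^sub>M (percolation \<epsilon> \<Otimes>\<^sub>M percolation p)"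

definition open_path :: "configuration \<Rightarrow> vertex list \<Rightarrow> bool" where
  "open_path \<omega> \<gamma> \<longleftrightarrow> \<gamma> \<noteq> [] \<and> distinct \<gamma> \<and>
     successively (\<lambda>x y. {x, y} \<in> lattice_edges \<and> \<omega> {x, y}) \<gamma>"

definition horizontal_crossing :: "nat \<Rightarrow> nat \<Rightarrow> configuration set" where
  "horizontal_crossing n m = {\<omega> \<in> configurations. \<exists>\<gamma>. open_path \<omega> \<gamma> \<and>
     set \<gamma> \<subseteq> {0..int n} \<times> {0..int m} \<and>
     hd \<gamma> \<in> {0} \<times> {0..int m} \<and> last \<gamma> \<in> {int n} \<times> {0..int m}}"

definition crossing_indicator :: "nat \<Rightarrow> nat \<Rightarrow> configuration \<Rightarrow> real" where
  "crossing_indicator n m = indicator (horizontal_crossing n m)"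

end

theory Submission
  imports Defs
begin

text \<open>
  Percolation on \<open>\<psi> \<cdot> \<xi>\<close> is critical when \<open>\<psi>\<close> is averaged out, so the Russo--Seymour--Welsh theorem
  applies to the annealed model. The annealed crossing events of annuli are revealed by exploring
  the clusters of a random concentric circle, which queries a given edge only if there is a long arm or
  the circle is close; by the Schramm--Steif inequality they are noise sensitive. Now
  \<open>(\<psi> \<cdot> \<xi>, \<psi> \<cdot> \<xi>')\<close> with independent \<open>\<xi>, \<xi>'\<close> is a pair of critical configurations with correlation
  \<open>1/r - 1 < 1\<close>, so noise sensitivity says that the quenched annulus crossing probabilities concentrate around
  their mean, which is bounded away from \<open>1\<close>. Hence their high moments are small, and multiplying over
  disjoint annuli the quenched one-arm probability exceeds a fixed \<open>\<theta>\<close> with a probability smaller than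
  any prescribed power of the length. A union bound over the vertices of the rectangle and the Borel--Cantelli lemma
  give uniformly small quenched arms, and the Schramm--Steif inequality, now applied for fixed \<open>\<psi>\<close> to the
  exploration of the clusters of a random vertical line, gives the claim.
\<close>

section \<open>Product measures on the subsets of a finite set\<close>

text \<open>For a fixed \<psi> the model has neither lattice symmetry nor self-duality, so RSW
  cannot be applied to it: quenched estimates must be transferred from the averaged model. A
  first-moment bound would not survive a union over about n^2 vertices, since RSW gives arm decay
  only with some small exponent. Hence high moments: a variable in [0, 1] that concentrates below 1
  - c has an arbitrarily small k-th moment, and multiplying over scales beats any prescribed power.
  No quenched decay rate is needed, since \<theta> is sent to 0 only at the very end. The
  correlation: with p = 1/(2r), an edge is present in one replica with probability rp = 1/2 and in
  both with probability rp^2 = p/2, so covariance over variance is (p/2 - 1/4) / (1/4) = 2p - 1. The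
  RSW argument must condition on a vertical crossing without revealing too much. Instead of a
  leftmost path, the dual clusters of the left side are explored, so that one notion, the stopping
  set, serves both RSW and the Schramm-Steif inequality. All probability is done by finite sums; the
  infinite product measure enters only at the end.\<close>

definition subset_weight :: "real \<Rightarrow> 'a set \<Rightarrow> 'a set \<Rightarrow> real" where
  "subset_weight p E \<omega> = (\<Prod>e\<in>E. if e \<in> \<omega> then p else 1 - p)"

definition pexp :: "real \<Rightarrow> 'a set \<Rightarrow> ('a set \<Rightarrow> real) \<Rightarrow> real" where
  "pexp p E F = (\<Sum>\<omega>\<in>Pow E. subset_weight p E \<omega> * F \<omega>)"

lemma subset_weight_nonneg: "0 \<le> p \<Longrightarrow> p \<le> 1 \<Longrightarrow> 0 \<le> subset_weight p E \<omega>"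
  unfolding subset_weight_def by (intro prod_nonneg) auto

lemma pexp_cong: "E = E' \<Longrightarrow> (\<And>\<omega>. \<omega> \<subseteq> E' \<Longrightarrow> F \<omega> = G \<omega>) \<Longrightarrow> pexp p E F = pexp p E' G"
  unfolding pexp_def by (intro sum.cong) auto

lemma pexp_empty [simp]: "pexp p {} F = F {}"
  by (simp add: pexp_def subset_weight_def)

lemma pexp_insert:
  assumes "finite E" "e \<notin> E"
  shows "pexp p (insert e E) F = p * pexp p E (\<lambda>\<omega>. F (insert e \<omega>)) + (1 - p) * pexp p E F"
proof -
  have w1: "subset_weight p (insert e E) (insert e \<omega>) = p * subset_weight p E \<omega>" if "\<omega> \<subseteq> E" for \<omega>
  proof -
    have "(\<Prod>x\<in>E. if x \<in> insert e \<omega> then p else 1 - p) = (\<Prod>x\<in>E. if x \<in> \<omega> then p else 1 - p)"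
      using assms by (intro prod.cong) auto
    then show ?thesis using assms by (simp add: subset_weight_def)
  qed
  have w2: "subset_weight p (insert e E) \<omega> = (1 - p) * subset_weight p E \<omega>" if "\<omega> \<subseteq> E" for \<omega>
    using assms that by (auto simp: subset_weight_def)
  have inj: "inj_on (insert e) (Pow E)" using assms(2) by (auto simp: inj_on_def)
  have "pexp p (insert e E) F = (\<Sum>\<omega>\<in>Pow E. subset_weight p (insert e E) \<omega> * F \<omega>)
     + (\<Sum>\<omega>\<in>insert e ` Pow E. subset_weight p (insert e E) \<omega> * F \<omega>)"
    unfolding pexp_def Pow_insert using assms by (intro sum.union_disjoint) auto
  also have "(\<Sum>\<omega>\<in>insert e ` Pow E. subset_weight p (insert e E) \<omega> * F \<omega>)
     = (\<Sum>\<omega>\<in>Pow E. p * (subset_weight p E \<omega> * F (insert e \<omega>)))"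
    unfolding sum.reindex[OF inj] o_def by (intro sum.cong) (auto simp: w1)
  also have "(\<Sum>\<omega>\<in>Pow E. subset_weight p (insert e E) \<omega> * F \<omega>)
     = (\<Sum>\<omega>\<in>Pow E. (1 - p) * (subset_weight p E \<omega> * F \<omega>))"
    by (intro sum.cong) (auto simp: w2)
  finally show ?thesis by (simp add: pexp_def sum_distrib_left)
qed

lemma pexp_const [simp]: "finite E \<Longrightarrow> pexp p E (\<lambda>_. c) = c"
  by (induction E rule: finite_induct) (auto simp: pexp_insert algebra_simps)

lemma pexp_add: "pexp p E (\<lambda>\<omega>. F \<omega> + G \<omega>) = pexp p E F + pexp p E G"
  by (simp add: pexp_def algebra_simps sum.distrib)

lemma pexp_diff: "pexp p E (\<lambda>\<omega>. F \<omega> - G \<omega>) = pexp p E F - pexp p E G"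
  by (simp add: pexp_def algebra_simps sum_subtractf)

lemma pexp_uminus: "pexp p E (\<lambda>\<omega>. - F \<omega>) = - pexp p E F"
  by (simp add: pexp_def sum_negf)

lemma pexp_cmult: "pexp p E (\<lambda>\<omega>. c * F \<omega>) = c * pexp p E F"
  unfolding pexp_def sum_distrib_left by (intro sum.cong) auto

lemma pexp_cmult_right: "pexp p E (\<lambda>\<omega>. F \<omega> * c) = pexp p E F * c"
  unfolding pexp_def sum_distrib_right by (intro sum.cong) auto

lemma pexp_sum: "pexp p E (\<lambda>\<omega>. \<Sum>i\<in>I. F i \<omega>) = (\<Sum>i\<in>I. pexp p E (F i))"
  unfolding pexp_def sum_distrib_left by (rule sum.swap)

lemma pexp_mono:
  assumes "0 \<le> p" "p \<le> 1" "\<And>\<omega>. \<omega> \<subseteq> E \<Longrightarrow> F \<omega> \<le> G \<omega>"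
  shows "pexp p E F \<le> pexp p E G"
  unfolding pexp_def using assms by (intro sum_mono mult_left_mono subset_weight_nonneg) auto

lemma pexp_nonneg:
  assumes "0 \<le> p" "p \<le> 1" "\<And>\<omega>. \<omega> \<subseteq> E \<Longrightarrow> 0 \<le> F \<omega>"
  shows "0 \<le> pexp p E F"
  unfolding pexp_def using assms by (intro sum_nonneg mult_nonneg_nonneg subset_weight_nonneg) auto

lemma pexp_le_const:
  assumes "finite E" "0 \<le> p" "p \<le> 1" "\<And>\<omega>. \<omega> \<subseteq> E \<Longrightarrow> F \<omega> \<le> c"
  shows "pexp p E F \<le> c"
  using pexp_mono[OF assms(2,3), of E F "\<lambda>_. c"] assms(1,4) by simp

lemma pexp_union:
  assumes "finite A" "finite B" "A \<inter> B = {}"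
  shows "pexp p (A \<union> B) F = pexp p A (\<lambda>a. pexp p B (\<lambda>b. F (a \<union> b)))"
  using assms
proof (induction A arbitrary: F rule: finite_induct)
  case (insert e A)
  then have "pexp p (insert e (A \<union> B)) F
    = p * pexp p A (\<lambda>a. pexp p B (\<lambda>b. F (insert e (a \<union> b)))) + (1 - p) * pexp p A (\<lambda>a. pexp p B (\<lambda>b. F (a \<union> b)))"
    by (subst pexp_insert) auto
  then show ?case using insert by (simp add: pexp_insert)
qed simp

lemma pexp_restrict:
  assumes "finite E'" "E \<subseteq> E'" "\<And>\<omega>. \<omega> \<subseteq> E' \<Longrightarrow> F \<omega> = F (\<omega> \<inter> E)"
  shows "pexp p E' F = pexp p E F"
proof -
  have fin: "finite E" "finite (E' - E)" using assms finite_subset by auto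
  have "pexp p (E \<union> (E' - E)) F = pexp p E (\<lambda>a. pexp p (E' - E) (\<lambda>b. F (a \<union> b)))"
    using fin by (intro pexp_union) auto
  also have "\<dots> = pexp p E (\<lambda>a. pexp p (E' - E) (\<lambda>b. F a))"
  proof (intro pexp_cong refl)
    fix a b assume ab: "a \<subseteq> E" "b \<subseteq> E' - E"
    have "F (a \<union> b) = F ((a \<union> b) \<inter> E)" using ab assms(2) by (intro assms(3)) auto
    also have "(a \<union> b) \<inter> E = a" using ab by auto
    finally show "F (a \<union> b) = F a" .
  qed
  also have "E \<union> (E' - E) = E'" using assms by auto
  finally show ?thesis using fin by simp
qed

lemma pexp_indep:
  assumes "finite E" "A \<subseteq> E" "B \<subseteq> E" "A \<inter> B = {}"
    and "\<And>\<omega>. \<omega> \<subseteq> E \<Longrightarrow> F \<omega> = F (\<omega> \<inter> A)" "\<And>\<omega>. \<omega> \<subseteq> E \<Longrightarrow> G \<omega> = G (\<omega> \<inter> B)"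
  shows "pexp p E (\<lambda>\<omega>. F \<omega> * G \<omega>) = pexp p E F * pexp p E G"
proof -
  have fin: "finite A" "finite B"
    using finite_subset[OF assms(2,1)] finite_subset[OF assms(3,1)] by auto
  have "pexp p E (\<lambda>\<omega>. F \<omega> * G \<omega>) = pexp p (A \<union> B) (\<lambda>\<omega>. F \<omega> * G \<omega>)"
  proof (intro pexp_restrict assms)
    fix \<omega> assume w: "\<omega> \<subseteq> E"
    have e: "\<omega> \<inter> (A \<union> B) \<inter> A = \<omega> \<inter> A" "\<omega> \<inter> (A \<union> B) \<inter> B = \<omega> \<inter> B" by auto
    have s: "\<omega> \<inter> (A \<union> B) \<subseteq> E" using w by auto
    show "F \<omega> * G \<omega> = F (\<omega> \<inter> (A \<union> B)) * G (\<omega> \<inter> (A \<union> B))"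
      using assms(5)[OF w] assms(6)[OF w] assms(5)[OF s] assms(6)[OF s] unfolding e by simp
  qed (use assms in auto)
  also have "\<dots> = pexp p A (\<lambda>a. pexp p B (\<lambda>b. F (a \<union> b) * G (a \<union> b)))"
    using fin assms by (intro pexp_union) auto
  also have "\<dots> = pexp p A (\<lambda>a. pexp p B (\<lambda>b. F a * G b))"
  proof (intro pexp_cong refl)
    fix a b assume ab: "a \<subseteq> A" "b \<subseteq> B"
    then have s: "a \<union> b \<subseteq> E" and e: "(a \<union> b) \<inter> A = a" "(a \<union> b) \<inter> B = b" using assms by auto
    show "F (a \<union> b) * G (a \<union> b) = F a * G b"
      using assms(5)[OF s] assms(6)[OF s] unfolding e by simp
  qed
  also have "\<dots> = pexp p A F * pexp p B G" by (simp add: pexp_cmult pexp_cmult_right)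
  also have "pexp p A F = pexp p E F" by (rule pexp_restrict[symmetric]) (use assms in auto)
  also have "pexp p B G = pexp p E G" by (rule pexp_restrict[symmetric]) (use assms in auto)
  finally show ?thesis .
qed

lemma pexp_indep_prod:
  assumes "finite E" "finite I" "\<And>i. i \<in> I \<Longrightarrow> A i \<subseteq> E" "disjoint_family_on A I"
    and "\<And>i \<omega>. i \<in> I \<Longrightarrow> \<omega> \<subseteq> E \<Longrightarrow> F i \<omega> = F i (\<omega> \<inter> A i)"
  shows "pexp p E (\<lambda>\<omega>. \<Prod>i\<in>I. F i \<omega>) = (\<Prod>i\<in>I. pexp p E (F i))"
  using assms(2-)
proof (induction I rule: finite_induct)
  case empty then show ?case using assms(1) by simp
next
  case (insert i I)
  have dis: "disjoint_family_on A I" using insert.prems(2) by (auto simp: disjoint_family_on_def)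
  have disj: "A i \<inter> (\<Union>j\<in>I. A j) = {}"
    using insert.prems(2) insert.hyps by (auto simp: disjoint_family_on_def)
  have "pexp p E (\<lambda>\<omega>. F i \<omega> * (\<Prod>j\<in>I. F j \<omega>)) = pexp p E (F i) * pexp p E (\<lambda>\<omega>. \<Prod>j\<in>I. F j \<omega>)"
  proof (rule pexp_indep[OF assms(1), of "A i" "\<Union>j\<in>I. A j"])
    fix \<omega> assume w: "\<omega> \<subseteq> E"
    show "(\<Prod>j\<in>I. F j \<omega>) = (\<Prod>j\<in>I. F j (\<omega> \<inter> (\<Union>j\<in>I. A j)))"
    proof (intro prod.cong refl)
      fix j assume j: "j \<in> I"
      then have "\<omega> \<inter> (\<Union>j\<in>I. A j) \<inter> A j = \<omega> \<inter> A j" by auto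
      then show "F j \<omega> = F j (\<omega> \<inter> (\<Union>j\<in>I. A j))"
        using insert.prems(3)[of j \<omega>] insert.prems(3)[of j "\<omega> \<inter> (\<Union>j\<in>I. A j)"] w j
        by (metis Int_lower1 insertCI subset_trans)
    qed
  qed (use insert disj in auto)
  then show ?case using insert dis by simp
qed

lemma pexp_image:
  assumes "inj_on T E"
  shows "pexp p (T ` E) F = pexp p E (\<lambda>\<omega>. F (T ` \<omega>))"
proof -
  have "subset_weight p (T ` E) (T ` \<omega>) = subset_weight p E \<omega>" if "\<omega> \<subseteq> E" for \<omega>
    using assms that unfolding subset_weight_def
    by (subst prod.reindex) (auto intro!: prod.cong simp: inj_on_image_mem_iff)
  moreover have "inj_on ((`) T) (Pow E)" using assms by (simp add: inj_on_image_Pow)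
  ultimately show ?thesis
    unfolding pexp_def image_Pow_surj[OF refl, symmetric]
    by (subst sum.reindex) (auto intro!: sum.cong)
qed

text \<open>Absent edges have the same law as present ones at bias 1/2; duality for probabilities
  rests on this.\<close>

lemma pexp_half_compl:
  "pexp (1/2) E (\<lambda>\<omega>. F (E - \<omega>)) = pexp (1/2) E F"
proof -
  have "subset_weight (1/2) E (E - \<omega>) = subset_weight (1/2) E \<omega>" for \<omega>
    unfolding subset_weight_def by (intro prod.cong) auto
  then show ?thesis
    unfolding pexp_def
    by (intro sum.reindex_bij_witness[of _ "\<lambda>\<omega>. E - \<omega>" "\<lambda>\<omega>. E - \<omega>"]) (auto simp: double_diff)
qed

text \<open>Used with \<open>r * p = 1/2\<close>: the mean over \<psi> of a quenched probability is
  a critical probability.\<close>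

lemma pexp_thin:
  assumes "finite E"
  shows "pexp r E (\<lambda>\<psi>. pexp p E (\<lambda>\<xi>. F (\<psi> \<inter> \<xi>))) = pexp (r * p) E F"
  using assms
proof (induction E arbitrary: F rule: finite_induct)
  case (insert e E)
  have [simp]: "pexp r E (\<lambda>\<psi>. pexp p E (\<lambda>\<xi>. F (insert e \<psi> \<inter> \<xi>))) = pexp r E (\<lambda>\<psi>. pexp p E (\<lambda>\<xi>. F (\<psi> \<inter> \<xi>)))"
       "pexp r E (\<lambda>\<psi>. pexp p E (\<lambda>\<xi>. F (\<psi> \<inter> insert e \<xi>))) = pexp r E (\<lambda>\<psi>. pexp p E (\<lambda>\<xi>. F (\<psi> \<inter> \<xi>)))"
    using insert(2) by (auto intro!: pexp_cong arg_cong[of _ _ F])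
  have [simp]: "insert e \<psi> \<inter> insert e \<xi> = insert e (\<psi> \<inter> \<xi>)" for \<psi> \<xi> by auto
  show ?case using insert
    by (simp add: pexp_insert pexp_add pexp_cmult insert.IH[of "\<lambda>\<omega>. F (insert e \<omega>)"] insert.IH[of F])
       (simp add: algebra_simps)
qed simp

lemma pexp_prod:
  assumes "finite E"
  shows "pexp p E (\<lambda>\<omega>. \<Prod>e\<in>E. h e (e \<in> \<omega>)) = (\<Prod>e\<in>E. p * h e True + (1 - p) * h e False)"
  using assms
proof (induction E rule: finite_induct)
  case (insert e E)
  have "pexp p E (\<lambda>\<omega>. \<Prod>x\<in>insert e E. h x (x \<in> insert e \<omega>)) = pexp p E (\<lambda>\<omega>. h e True * (\<Prod>x\<in>E. h x (x \<in> \<omega>)))"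
  proof (intro pexp_cong refl)
    fix \<omega>
    have "(\<Prod>x\<in>E. h x (x \<in> insert e \<omega>)) = (\<Prod>x\<in>E. h x (x \<in> \<omega>))"
      using insert(2) by (auto intro!: prod.cong arg_cong[of _ _ "h _"])
    then show "(\<Prod>x\<in>insert e E. h x (x \<in> insert e \<omega>)) = h e True * (\<Prod>x\<in>E. h x (x \<in> \<omega>))"
      using insert by simp
  qed
  moreover have "pexp p E (\<lambda>\<omega>. \<Prod>x\<in>insert e E. h x (x \<in> \<omega>)) = pexp p E (\<lambda>\<omega>. h e False * (\<Prod>x\<in>E. h x (x \<in> \<omega>)))"
    using insert(1,2) by (intro pexp_cong refl) (simp add: subset_iff, metis)
  ultimately show ?case using insert(1,2,3) by (simp add: pexp_insert pexp_cmult distrib_right)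
qed simp

lemma pexp_Cauchy_Schwarz:
  assumes "0 \<le> p" "p \<le> 1"
  shows "(pexp p E (\<lambda>\<omega>. F \<omega> * G \<omega>))\<^sup>2 \<le> pexp p E (\<lambda>\<omega>. (F \<omega>)\<^sup>2) * pexp p E (\<lambda>\<omega>. (G \<omega>)\<^sup>2)"
proof -
  let ?w = "\<lambda>\<omega>. sqrt (subset_weight p E \<omega>)"
  have w: "?w \<omega> * ?w \<omega> = subset_weight p E \<omega>" for \<omega>
    using subset_weight_nonneg[OF assms, of E \<omega>] by simp
  have "pexp p E (\<lambda>\<omega>. F \<omega> * G \<omega>) = (\<Sum>\<omega>\<in>Pow E. (?w \<omega> * F \<omega>) * (?w \<omega> * G \<omega>))"
    unfolding pexp_def by (intro sum.cong refl) (use w in \<open>metis mult.assoc mult.left_commute\<close>)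
  moreover have "pexp p E (\<lambda>\<omega>. (H \<omega>)\<^sup>2) = (\<Sum>\<omega>\<in>Pow E. (?w \<omega> * H \<omega>)\<^sup>2)" for H
    unfolding pexp_def power_mult_distrib by (intro sum.cong refl) (simp add: subset_weight_nonneg[OF assms])
  ultimately show ?thesis
    using Cauchy_Schwarz_ineq_sum[of "\<lambda>\<omega>. ?w \<omega> * F \<omega>" "\<lambda>\<omega>. ?w \<omega> * G \<omega>" "Pow E"] by simp
qed

text \<open>Induction on the edges. Conditioning on \<open>e\<close> splits the covariance into the
  two conditional covariances and p (1 - p) times the product of the increments of the two
  conditional means, both of which are nonnegative by monotonicity.\<close>

lemma Harris:
  assumes "finite E" "0 \<le> p" "p \<le> 1"
    and "\<And>\<omega> \<omega>'. \<omega> \<subseteq> \<omega>' \<Longrightarrow> \<omega>' \<subseteq> E \<Longrightarrow> F \<omega> \<le> F \<omega>'"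
    and "\<And>\<omega> \<omega>'. \<omega> \<subseteq> \<omega>' \<Longrightarrow> \<omega>' \<subseteq> E \<Longrightarrow> G \<omega> \<le> G \<omega>'"
  shows "pexp p E F * pexp p E G \<le> pexp p E (\<lambda>\<omega>. F \<omega> * G \<omega>)"
  using assms(1,4,5)
proof (induction E arbitrary: F G rule: finite_induct)
  case (insert e E)
  let ?F1 = "\<lambda>\<omega>. F (insert e \<omega>)" and ?G1 = "\<lambda>\<omega>. G (insert e \<omega>)"
  have a: "pexp p E F * pexp p E G \<le> pexp p E (\<lambda>\<omega>. F \<omega> * G \<omega>)"
    by (rule insert.IH; rule insert.prems; blast)
  have b: "pexp p E ?F1 * pexp p E ?G1 \<le> pexp p E (\<lambda>\<omega>. ?F1 \<omega> * ?G1 \<omega>)"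
    by (rule insert.IH; rule insert.prems; blast)
  have c: "pexp p E F \<le> pexp p E ?F1" "pexp p E G \<le> pexp p E ?G1"
    by (rule pexp_mono[OF assms(2,3)]; rule insert.prems; blast)+
  have "(p * pexp p E ?F1 + (1 - p) * pexp p E F) * (p * pexp p E ?G1 + (1 - p) * pexp p E G)
    = p * (pexp p E ?F1 * pexp p E ?G1) + (1 - p) * (pexp p E F * pexp p E G)
      - p * (1 - p) * ((pexp p E ?F1 - pexp p E F) * (pexp p E ?G1 - pexp p E G))"
    by (simp add: algebra_simps)
  also have "\<dots> \<le> p * (pexp p E ?F1 * pexp p E ?G1) + (1 - p) * (pexp p E F * pexp p E G)"
    using c assms(2,3) by simp
  also have "\<dots> \<le> p * pexp p E (\<lambda>\<omega>. ?F1 \<omega> * ?G1 \<omega>) + (1 - p) * pexp p E (\<lambda>\<omega>. F \<omega> * G \<omega>)"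
    using a b assms(2,3) by (intro add_mono mult_left_mono) auto
  finally show ?case using insert by (simp add: pexp_insert)
qed simp

lemma Harris_antimono:
  assumes "finite E" "0 \<le> p" "p \<le> 1"
    and "\<And>\<omega> \<omega>'. \<omega> \<subseteq> \<omega>' \<Longrightarrow> \<omega>' \<subseteq> E \<Longrightarrow> F \<omega>' \<le> F \<omega>"
    and "\<And>\<omega> \<omega>'. \<omega> \<subseteq> \<omega>' \<Longrightarrow> \<omega>' \<subseteq> E \<Longrightarrow> G \<omega>' \<le> G \<omega>"
  shows "pexp p E F * pexp p E G \<le> pexp p E (\<lambda>\<omega>. F \<omega> * G \<omega>)"
  using Harris[OF assms(1-3), of "\<lambda>\<omega>. - F \<omega>" "\<lambda>\<omega>. - G \<omega>"] assms(4,5) by (simp add: pexp_uminus)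

section \<open>Stopping sets\<close>

text \<open>\<open>J \<omega>\<close> is the set of coordinates an exploration of \<open>\<omega>\<close> queries.\<close>

definition stopping_set :: "'a set \<Rightarrow> ('a set \<Rightarrow> 'a set) \<Rightarrow> bool" where
  "stopping_set E J \<longleftrightarrow>
     (\<forall>\<omega> \<tau>. \<omega> \<subseteq> E \<longrightarrow> \<tau> \<subseteq> E \<longrightarrow> \<omega> \<inter> J \<omega> = \<tau> \<inter> J \<omega> \<longrightarrow> J \<tau> = J \<omega>)"

lemma subset_weight_exchange:
  assumes "finite E"
  shows "subset_weight p E ((\<omega> \<inter> j) \<union> (\<tau> - j)) * subset_weight p E ((\<tau> \<inter> j) \<union> (\<omega> - j))
       = subset_weight p E \<omega> * subset_weight p E \<tau>"
  unfolding subset_weight_def prod.distrib[symmetric] by (intro prod.cong) auto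

text \<open>Exchanging the queried part of \<open>\<omega>\<close> with that of an independent copy \<open>\<tau>\<close> is a
  measure-preserving involution.\<close>

lemma pexp_stopping_set:
  assumes "finite E" "stopping_set E J"
  shows "pexp p E (\<lambda>\<omega>. pexp p E (\<lambda>\<tau>. H ((\<omega> \<inter> J \<omega>) \<union> (\<tau> - J \<omega>)))) = pexp p E H"
proof -
  define s where "s = (\<lambda>(\<omega>, \<tau>). ((\<omega> \<inter> J \<omega>) \<union> (\<tau> - J \<omega>), (\<tau> \<inter> J \<omega>) \<union> (\<omega> - J \<omega>)))"
  \<comment> \<open>The mixed configuration agrees with \<omega> on \<open>J \<omega>\<close>, so
    the exploration makes the same queries there. This is why \<open>s\<close> undoes
    itself.\<close>
  have J: "J ((\<omega> \<inter> J \<omega>) \<union> (\<tau> - J \<omega>)) = J \<omega>" if "\<omega> \<subseteq> E" "\<tau> \<subseteq> E" for \<omega> \<tau>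
  proof -
    have "(\<omega> \<inter> J \<omega>) \<union> (\<tau> - J \<omega>) \<subseteq> E" "\<omega> \<inter> J \<omega> = ((\<omega> \<inter> J \<omega>) \<union> (\<tau> - J \<omega>)) \<inter> J \<omega>" using that by auto
    then show ?thesis using assms(2) that(1) unfolding stopping_set_def by metis
  qed
  have ss: "s (s x) = x" if "x \<in> Pow E \<times> Pow E" for x
  proof -
    obtain \<omega> \<tau> where x: "x = (\<omega>, \<tau>)" by (cases x)
    have "J ((\<omega> \<inter> J \<omega>) \<union> (\<tau> - J \<omega>)) = J \<omega>" using that x J by auto
    then show ?thesis unfolding x s_def by auto
  qed
  have "pexp p E (\<lambda>\<omega>. pexp p E (\<lambda>\<tau>. H ((\<omega> \<inter> J \<omega>) \<union> (\<tau> - J \<omega>))))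
     = (\<Sum>x\<in>Pow E \<times> Pow E. subset_weight p E (fst x) * subset_weight p E (snd x) * H (fst (s x)))"
    unfolding pexp_def sum_distrib_left sum.cartesian_product s_def
    by (intro sum.cong) (auto simp: algebra_simps)
  also have "\<dots> = (\<Sum>x\<in>Pow E \<times> Pow E. subset_weight p E (fst x) * subset_weight p E (snd x) * H (fst x))"
  proof (rule sum.reindex_bij_witness[of _ s s])
    fix x assume x: "x \<in> Pow E \<times> Pow E"
    show s1: "s (s x) = x" by (rule ss[OF x])
    show "s (s x) = x" by (rule ss[OF x])
    show "s x \<in> Pow E \<times> Pow E" using x unfolding s_def by auto
    then show "s x \<in> Pow E \<times> Pow E" .
    show "subset_weight p E (fst (s x)) * subset_weight p E (snd (s x)) * H (fst (s x)) =
      subset_weight p E (fst x) * subset_weight p E (snd x) * H (fst (s x))"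
      using subset_weight_exchange[OF assms(1), of p "fst x" "J (fst x)" "snd x"]
      unfolding s_def by (auto simp: case_prod_beta)
  qed
  also have "\<dots> = pexp p E (\<lambda>\<omega>. pexp p E (\<lambda>\<tau>. H \<omega>))"
    unfolding pexp_def sum_distrib_left sum.cartesian_product
    by (intro sum.cong) (auto simp: algebra_simps)
  finally show ?thesis using assms(1) by simp
qed

section \<open>Biased Fourier analysis and the Schramm--Steif inequality\<close>

text \<open>The centred function of variance one of a single p-biased bit, unique up to
  sign.\<close>

definition chi1 :: "real \<Rightarrow> bool \<Rightarrow> real" where
  "chi1 p b = (if b then sqrt ((1 - p) / p) else - sqrt (p / (1 - p)))"

definition chi :: "real \<Rightarrow> 'a set \<Rightarrow> 'a set \<Rightarrow> real" where
  "chi p S \<omega> = (\<Prod>e\<in>S. chi1 p (e \<in> \<omega>))"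

definition fourier :: "real \<Rightarrow> 'a set \<Rightarrow> ('a set \<Rightarrow> real) \<Rightarrow> 'a set \<Rightarrow> real" where
  "fourier p E F S = pexp p E (\<lambda>\<omega>. F \<omega> * chi p S \<omega>)"

definition level_weight :: "real \<Rightarrow> 'a set \<Rightarrow> ('a set \<Rightarrow> real) \<Rightarrow> nat \<Rightarrow> real" where
  "level_weight p E F k = (\<Sum>S\<in>{S. S \<subseteq> E \<and> card S = k}. (fourier p E F S)\<^sup>2)"

lemma chi_empty [simp]: "chi p {} \<omega> = 1"
  by (simp add: chi_def)

lemma fourier_empty: "fourier p E F {} = pexp p E F"
  by (simp add: fourier_def)

text \<open>Besides mean and variance, the last three identities give the reproducing kernel of one
  bit: \<open>1 + chi1 p x * chi1 p y\<close> is 0 if the bits differ and the inverse weight of the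
  bit if they agree.\<close>

lemma chi1_moments:
  assumes "0 < p" "p < 1"
  shows "p * chi1 p True + (1 - p) * chi1 p False = 0"
    and "p * (chi1 p True)\<^sup>2 + (1 - p) * (chi1 p False)\<^sup>2 = 1"
    and "1 + (chi1 p True)\<^sup>2 = 1 / p" "1 + (chi1 p False)\<^sup>2 = 1 / (1 - p)"
    and "1 + chi1 p True * chi1 p False = 0"
proof -
  define a b where "a = sqrt p" and "b = sqrt (1 - p)"
  have ab: "a > 0" "b > 0" "p = a\<^sup>2" "1 - p = b\<^sup>2" using assms by (auto simp: a_def b_def)
  have sum: "a\<^sup>2 + b\<^sup>2 = 1" using ab(3,4) by simp
  have T: "chi1 p True = b / a" and F: "chi1 p False = - (a / b)"
    by (simp_all add: chi1_def a_def b_def real_sqrt_divide)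
  show "p * chi1 p True + (1 - p) * chi1 p False = 0"
    unfolding T F ab(4) unfolding ab(3) using ab(1,2) by (simp add: field_simps power2_eq_square)
  show "p * (chi1 p True)\<^sup>2 + (1 - p) * (chi1 p False)\<^sup>2 = 1"
    unfolding T F ab(4) unfolding ab(3) using ab(1,2) sum by (simp add: power_divide add.commute)
  have "1 + (chi1 p True)\<^sup>2 = (a\<^sup>2 + b\<^sup>2) / a\<^sup>2"
    unfolding T using ab(1) by (simp add: power_divide add_divide_distrib)
  then show "1 + (chi1 p True)\<^sup>2 = 1 / p" unfolding sum ab(3) .
  have "1 + (chi1 p False)\<^sup>2 = (a\<^sup>2 + b\<^sup>2) / b\<^sup>2"
    unfolding F using ab(2) by (simp add: power_divide add_divide_distrib)
  then show "1 + (chi1 p False)\<^sup>2 = 1 / (1 - p)" unfolding sum ab(4) .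
  show "1 + chi1 p True * chi1 p False = 0" unfolding T F using ab(1,2) by simp
qed

lemma chi_as_prod:
  "finite E \<Longrightarrow> S \<subseteq> E \<Longrightarrow> chi p S \<omega> = (\<Prod>e\<in>E. if e \<in> S then chi1 p (e \<in> \<omega>) else 1)"
  by (simp add: chi_def prod.If_cases Int_absorb1)

lemma chi_cong: "S \<inter> \<omega> = S \<inter> \<omega>' \<Longrightarrow> chi p S \<omega> = chi p S \<omega>'"
  unfolding chi_def by (intro prod.cong refl arg_cong[of _ _ "chi1 p"]) blast

lemma chi_disjoint_union:
  "finite S \<Longrightarrow> finite T \<Longrightarrow> S \<inter> T = {} \<Longrightarrow> chi p (S \<union> T) \<omega> = chi p S \<omega> * chi p T \<omega>"
  unfolding chi_def by (rule prod.union_disjoint)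

lemma chi_orthonormal:
  assumes p: "0 < p" "p < 1" and "finite E" "S \<subseteq> E" "T \<subseteq> E"
  shows "pexp p E (\<lambda>\<omega>. chi p S \<omega> * chi p T \<omega>) = of_bool (S = T)"
proof -
  let ?h = "\<lambda>e b. (if e \<in> S then chi1 p b else 1) * (if e \<in> T then chi1 p b else 1)"
  have "pexp p E (\<lambda>\<omega>. chi p S \<omega> * chi p T \<omega>) = pexp p E (\<lambda>\<omega>. \<Prod>e\<in>E. ?h e (e \<in> \<omega>))"
    using assms by (simp add: chi_as_prod prod.distrib)
  also have "\<dots> = (\<Prod>e\<in>E. p * ?h e True + (1 - p) * ?h e False)"
    by (rule pexp_prod) fact
  also have "\<dots> = (\<Prod>e\<in>E. of_bool (e \<in> S \<longleftrightarrow> e \<in> T))"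
    using chi1_moments[OF p] by (intro prod.cong) (auto simp: power2_eq_square)
  also have "\<dots> = of_bool (S = T)"
    using assms by (auto simp: of_bool_def prod_zero_iff)
  finally show ?thesis .
qed

text \<open>Completeness of the characters, obtained without counting dimensions: the sum over
  \<open>S\<close> factors edge by edge into the one-bit kernels \<open>1 + chi1 * chi1\<close>,
  which cancel the weight or vanish.\<close>

lemma chi_kernel:
  assumes p: "0 < p" "p < 1" and "finite E" "\<omega> \<subseteq> E" "\<tau> \<subseteq> E"
  shows "subset_weight p E \<omega> * (\<Sum>S\<in>Pow E. chi p S \<omega> * chi p S \<tau>) = of_bool (\<omega> = \<tau>)"
proof -
  have "(\<Sum>S\<in>Pow E. chi p S \<omega> * chi p S \<tau>)
     = (\<Sum>S\<in>Pow E. (\<Prod>e\<in>S. chi1 p (e \<in> \<omega>) * chi1 p (e \<in> \<tau>)) * (\<Prod>e\<in>E - S. 1))"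
    by (simp add: chi_def prod.distrib)
  also have "\<dots> = (\<Prod>e\<in>E. chi1 p (e \<in> \<omega>) * chi1 p (e \<in> \<tau>) + 1)"
    by (rule prod_add[symmetric]) fact
  finally have "subset_weight p E \<omega> * (\<Sum>S\<in>Pow E. chi p S \<omega> * chi p S \<tau>)
     = (\<Prod>e\<in>E. (if e \<in> \<omega> then p else 1 - p) * (chi1 p (e \<in> \<omega>) * chi1 p (e \<in> \<tau>) + 1))"
    by (simp add: subset_weight_def prod.distrib)
  also have "\<dots> = (\<Prod>e\<in>E. of_bool (e \<in> \<omega> \<longleftrightarrow> e \<in> \<tau>))"
  proof (intro prod.cong refl)
    fix e
    show "(if e \<in> \<omega> then p else 1 - p) * (chi1 p (e \<in> \<omega>) * chi1 p (e \<in> \<tau>) + 1) = of_bool (e \<in> \<omega> \<longleftrightarrow> e \<in> \<tau>)"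
      using chi1_moments(3-5)[OF p] p
      by (cases "e \<in> \<omega>"; cases "e \<in> \<tau>") (auto simp: power2_eq_square add.commute mult.commute)
  qed
  also have "\<dots> = of_bool (\<omega> = \<tau>)"
    using assms by (auto simp: of_bool_def prod_zero_iff)
  finally show ?thesis .
qed

lemma fourier_expansion:
  assumes p: "0 < p" "p < 1" and "finite E" "\<omega> \<subseteq> E"
  shows "F \<omega> = (\<Sum>S\<in>Pow E. fourier p E F S * chi p S \<omega>)"
proof -
  have "(\<Sum>S\<in>Pow E. fourier p E F S * chi p S \<omega>)
     = (\<Sum>S\<in>Pow E. \<Sum>\<tau>\<in>Pow E. F \<tau> * (subset_weight p E \<tau> * (chi p S \<tau> * chi p S \<omega>)))"
    unfolding fourier_def pexp_def sum_distrib_right by (simp add: mult_ac)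
  also have "\<dots> = (\<Sum>\<tau>\<in>Pow E. F \<tau> * (subset_weight p E \<tau> * (\<Sum>S\<in>Pow E. chi p S \<tau> * chi p S \<omega>)))"
    by (subst sum.swap) (simp add: sum_distrib_left)
  also have "\<dots> = (\<Sum>\<tau>\<in>Pow E. F \<tau> * of_bool (\<tau> = \<omega>))"
    using assms by (intro sum.cong refl) (subst chi_kernel, auto)
  also have "\<dots> = F \<omega>" using assms by (simp add: of_bool_def if_distrib cong: if_cong)
  finally show ?thesis by simp
qed

text \<open>\<open>B\<close> stands for an expectation over a correlated pair that is diagonal on the characters.\<close>

lemma diagonal_form:
  fixes E :: "'a set"
  assumes p: "0 < p" "p < 1" and fin: "finite E"
    and add: "\<And>(I :: 'a set set) f. B (\<lambda>\<omega> \<omega>'. \<Sum>S\<in>I. f S \<omega> \<omega>') = (\<Sum>S\<in>I. B (f S))"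
    and mult: "\<And>c f. B (\<lambda>\<omega> \<omega>'. c * f \<omega> \<omega>') = c * B f"
    and cong: "\<And>f g. (\<And>\<omega> \<omega>'. \<omega> \<subseteq> E \<Longrightarrow> \<omega>' \<subseteq> E \<Longrightarrow> f \<omega> \<omega>' = g \<omega> \<omega>') \<Longrightarrow> B f = B g"
    and diag: "\<And>S T. S \<subseteq> E \<Longrightarrow> T \<subseteq> E \<Longrightarrow> B (\<lambda>\<omega> \<omega>'. chi p S \<omega> * chi p T \<omega>') = of_bool (S = T) * \<rho> ^ card S"
  shows "B (\<lambda>\<omega> \<omega>'. F \<omega> * F \<omega>') = (\<Sum>S\<in>Pow E. \<rho> ^ card S * (fourier p E F S)\<^sup>2)"
proof -
  have "B (\<lambda>\<omega> \<omega>'. F \<omega> * F \<omega>') = B (\<lambda>\<omega> \<omega>'. \<Sum>S\<in>Pow E. \<Sum>T\<in>Pow E.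
      (fourier p E F S * fourier p E F T) * (chi p S \<omega> * chi p T \<omega>'))"
  proof (rule cong)
    fix \<omega> \<omega>' assume w: "\<omega> \<subseteq> E" "\<omega>' \<subseteq> E"
    have "F \<omega> * F \<omega>' = (\<Sum>S\<in>Pow E. fourier p E F S * chi p S \<omega>) * (\<Sum>S\<in>Pow E. fourier p E F S * chi p S \<omega>')"
      using fourier_expansion[OF p fin w(1), of F] fourier_expansion[OF p fin w(2), of F] by (rule arg_cong2)
    then show "F \<omega> * F \<omega>' = (\<Sum>S\<in>Pow E. \<Sum>T\<in>Pow E.
      (fourier p E F S * fourier p E F T) * (chi p S \<omega> * chi p T \<omega>'))"
      unfolding sum_product by (simp only: mult_ac)
  qed
  also have "\<dots> = (\<Sum>S\<in>Pow E. \<Sum>T\<in>Pow E.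
      (fourier p E F S * fourier p E F T) * B (\<lambda>\<omega> \<omega>'. chi p S \<omega> * chi p T \<omega>'))"
    unfolding add mult ..
  also have "\<dots> = (\<Sum>S\<in>Pow E. \<Sum>T\<in>Pow E.
      if S = T then \<rho> ^ card S * (fourier p E F S)\<^sup>2 else 0)"
    by (intro sum.cong refl) (auto simp: diag power2_eq_square)
  also have "\<dots> = (\<Sum>S\<in>Pow E. \<rho> ^ card S * (fourier p E F S)\<^sup>2)"
    using fin by simp
  finally show ?thesis .
qed

lemma Parseval:
  assumes p: "0 < p" "p < 1" and fin: "finite E"
  shows "pexp p E (\<lambda>\<omega>. (F \<omega>)\<^sup>2) = (\<Sum>S\<in>Pow E. (fourier p E F S)\<^sup>2)"
proof -
  \<comment> \<open>The fully correlated pair, in which both configurations coincide, is diagonal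
    with \<rho> = 1.\<close>
  have "pexp p E (\<lambda>\<omega>. F \<omega> * F \<omega>) = (\<Sum>S\<in>Pow E. 1 ^ card S * (fourier p E F S)\<^sup>2)"
    by (rule diagonal_form[OF p fin, where B = "\<lambda>f. pexp p E (\<lambda>\<omega>. f \<omega> \<omega>)"])
       (use assms in \<open>simp_all add: pexp_sum pexp_cmult chi_orthonormal cong: pexp_cong\<close>)
  then show ?thesis by (simp add: power2_eq_square)
qed

lemma Bessel:
  assumes p: "0 < p" "p < 1" and fin: "finite E" and "\<S> \<subseteq> Pow E"
  shows "(\<Sum>S\<in>\<S>. (fourier p E F S)\<^sup>2) \<le> pexp p E (\<lambda>\<omega>. (F \<omega>)\<^sup>2)"
  unfolding Parseval[OF p fin] using assms by (intro sum_mono2) auto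

section \<open>Low revealment makes the Fourier levels small\<close>

lemma fourier_sum_chi:
  assumes p: "0 < p" "p < 1" and fin: "finite E" and "\<S> \<subseteq> Pow E" "T \<subseteq> E"
  shows "fourier p E (\<lambda>\<omega>. \<Sum>S\<in>\<S>. a S * chi p S \<omega>) T = (if T \<in> \<S> then a T else 0)"
proof -
  have finS: "finite \<S>" using finite_subset[OF assms(4)] fin by simp
  have "fourier p E (\<lambda>\<omega>. \<Sum>S\<in>\<S>. a S * chi p S \<omega>) T = (\<Sum>S\<in>\<S>. a S * pexp p E (\<lambda>\<omega>. chi p S \<omega> * chi p T \<omega>))"
    unfolding fourier_def sum_distrib_right mult.assoc pexp_sum pexp_cmult ..
  also have "\<dots> = (\<Sum>S\<in>\<S>. if S = T then a T else 0)"
    using assms by (intro sum.cong refl) (subst chi_orthonormal, auto)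
  finally show ?thesis using finS by simp
qed

text \<open>Let \<open>g\<close> be the level-k part of \<open>F\<close> and \<open>gb\<close> its
  conditional expectation given the queried edges. The level weight is E[F g] = E[F gb] because
  \<open>F\<close> is determined by the queried edges, so Cauchy-Schwarz bounds its square by
  E[gb^2]. Every coefficient whose set \<open>S\<close> is not touched by the exploration survives
  the conditioning at level k and is lost to \<open>gb\<close>; only the touched sets remain in the
  bound.\<close>

lemma level_revealment_square:
  assumes p: "0 < p" "p < 1" and fin: "finite E"
    and J: "stopping_set E J"
    and det: "\<And>\<omega> \<tau>. \<omega> \<subseteq> E \<Longrightarrow> \<tau> \<subseteq> E \<Longrightarrow> \<omega> \<inter> J \<omega> = \<tau> \<inter> J \<omega> \<Longrightarrow> F \<tau> = F \<omega>"
    and F1: "\<And>\<omega>. \<omega> \<subseteq> E \<Longrightarrow> \<bar>F \<omega>\<bar> \<le> 1" and k: "k \<ge> 1"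
  shows "(level_weight p E F k)\<^sup>2 \<le> (\<Sum>S\<in>{S. S \<subseteq> E \<and> card S = k}.
    (fourier p E F S)\<^sup>2 * pexp p E (\<lambda>\<omega>. of_bool (S \<inter> J \<omega> \<noteq> {})))"
proof -
  let ?\<S> = "{S. S \<subseteq> E \<and> card S = k}"
  let ?W = "level_weight p E F k"
  let ?a = "fourier p E F"
  \<comment> \<open>\<open>mix\<close> keeps the queried edges of \<omega> and re-samples all others
    from \<tau>, so averaging over \<tau> is conditioning on the exploration.\<close>
  define mix where "mix = (\<lambda>\<omega> \<tau>. (\<omega> \<inter> J \<omega>) \<union> (\<tau> - J \<omega>))"
  define g where "g = (\<lambda>\<omega>. \<Sum>S\<in>?\<S>. ?a S * chi p S \<omega>)"
  define gb where "gb = (\<lambda>\<omega>. pexp p E (\<lambda>\<tau>. g (mix \<omega> \<tau>)))"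
  have p': "0 \<le> p" "p \<le> 1" using p by auto
  have finS: "finite ?\<S>" using fin by simp
  have mixE: "mix \<omega> \<tau> \<subseteq> E" "\<omega> \<inter> J \<omega> = mix \<omega> \<tau> \<inter> J \<omega>" if "\<omega> \<subseteq> E" "\<tau> \<subseteq> E" for \<omega> \<tau>
    using that by (auto simp: mix_def)
  have Fmix: "F (mix \<omega> \<tau>) = F \<omega>" if "\<omega> \<subseteq> E" "\<tau> \<subseteq> E" for \<omega> \<tau>
    using mixE[OF that] that by (intro det) auto
  have "pexp p E (\<lambda>\<omega>. F \<omega> * g \<omega>) = (\<Sum>S\<in>?\<S>. ?a S * ?a S)"
    unfolding g_def sum_distrib_left pexp_sum by (simp add: fourier_def pexp_cmult[symmetric] mult_ac)
  then have W: "pexp p E (\<lambda>\<omega>. F \<omega> * g \<omega>) = ?W" by (simp add: level_weight_def power2_eq_square)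
  have fg: "fourier p E g T = (if T \<in> ?\<S> then ?a T else 0)" if "T \<subseteq> E" for T
    unfolding g_def by (rule fourier_sum_chi[OF p fin _ that]) auto
  have g2: "pexp p E (\<lambda>\<omega>. (g \<omega>)\<^sup>2) = ?W"
  proof -
    have "pexp p E (\<lambda>\<omega>. (g \<omega>)\<^sup>2) = (\<Sum>S\<in>Pow E. if S \<in> ?\<S> then (?a S)\<^sup>2 else 0)"
      unfolding Parseval[OF p fin] by (intro sum.cong refl) (simp add: fg)
    also have "\<dots> = (\<Sum>S\<in>Pow E \<inter> ?\<S>. (?a S)\<^sup>2)" using fin by (simp add: sum.inter_restrict)
    also have "Pow E \<inter> ?\<S> = ?\<S>" by auto
    finally show ?thesis by (simp add: level_weight_def)
  qed
  have "?W = pexp p E (\<lambda>\<omega>. pexp p E (\<lambda>\<tau>. F (mix \<omega> \<tau>) * g (mix \<omega> \<tau>)))"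
    unfolding W[symmetric] mix_def by (rule pexp_stopping_set[OF fin J, symmetric])
  also have "\<dots> = pexp p E (\<lambda>\<omega>. F \<omega> * gb \<omega>)"
    unfolding gb_def pexp_cmult[symmetric] by (intro pexp_cong refl) (simp add: Fmix)
  finally have "?W\<^sup>2 \<le> pexp p E (\<lambda>\<omega>. (F \<omega>)\<^sup>2) * pexp p E (\<lambda>\<omega>. (gb \<omega>)\<^sup>2)"
    using pexp_Cauchy_Schwarz[OF p'] by simp
  also have "\<dots> \<le> 1 * pexp p E (\<lambda>\<omega>. (gb \<omega>)\<^sup>2)"
    using F1 by (intro mult_right_mono pexp_le_const[OF fin p'] pexp_nonneg[OF p']) (auto simp: abs_square_le_1)
  finally have 1: "?W\<^sup>2 \<le> pexp p E (\<lambda>\<omega>. (gb \<omega>)\<^sup>2)" by simp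
  have 2: "(gb \<omega>)\<^sup>2 + (\<Sum>S\<in>?\<S>. (?a S)\<^sup>2 * of_bool (S \<inter> J \<omega> = {})) \<le> pexp p E (\<lambda>\<tau>. (g (mix \<omega> \<tau>))\<^sup>2)"
    if w: "\<omega> \<subseteq> E" for \<omega>
  proof -
    define G where "G = (\<lambda>\<tau>. g (mix \<omega> \<tau>))"
    define \<T> where "\<T> = {S \<in> ?\<S>. S \<inter> J \<omega> = {}}"
    have finT: "finite \<T>" by (rule finite_subset[OF _ finS]) (auto simp: \<T>_def)
    have chim: "chi p S (mix \<omega> \<tau>) = chi p (S \<inter> J \<omega>) \<omega> * chi p (S - J \<omega>) \<tau>" if "S \<subseteq> E" for S \<tau>
    proof -
      have f: "finite S" using that fin finite_subset by auto
      have "chi p S (mix \<omega> \<tau>) = chi p ((S \<inter> J \<omega>) \<union> (S - J \<omega>)) (mix \<omega> \<tau>)"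
        by (rule arg_cong[of _ _ "\<lambda>s. chi p s _"]) auto
      also have "\<dots> = chi p (S \<inter> J \<omega>) (mix \<omega> \<tau>) * chi p (S - J \<omega>) (mix \<omega> \<tau>)"
        using f by (intro chi_disjoint_union) auto
      also have "chi p (S \<inter> J \<omega>) (mix \<omega> \<tau>) = chi p (S \<inter> J \<omega>) \<omega>" by (rule chi_cong) (auto simp: mix_def)
      also have "chi p (S - J \<omega>) (mix \<omega> \<tau>) = chi p (S - J \<omega>) \<tau>" by (rule chi_cong) (auto simp: mix_def)
      finally show ?thesis .
    qed
    have fG: "fourier p E G U = ?a U" if U: "U \<in> \<T>" for U
    proof -
      have UE: "U \<subseteq> E" "card U = k" "U \<inter> J \<omega> = {}" using U by (auto simp: \<T>_def)
      have "fourier p E G U = (\<Sum>S\<in>?\<S>. ?a S * (chi p (S \<inter> J \<omega>) \<omega> * pexp p E (\<lambda>\<tau>. chi p (S - J \<omega>) \<tau> * chi p U \<tau>)))"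
        unfolding fourier_def G_def g_def sum_distrib_right pexp_sum pexp_cmult[symmetric]
        by (intro sum.cong refl pexp_cong) (simp add: chim mult_ac)
      also have "\<dots> = (\<Sum>S\<in>?\<S>. if S = U then ?a U else 0)"
      proof (intro sum.cong refl)
        fix S assume S: "S \<in> ?\<S>"
        then have fS: "finite S" using fin finite_subset by auto
        have "pexp p E (\<lambda>\<tau>. chi p (S - J \<omega>) \<tau> * chi p U \<tau>) = of_bool (S - J \<omega> = U)"
          using S UE by (intro chi_orthonormal[OF p fin]) auto
        \<comment> \<open>Removing queried edges can only shrink \<open>S\<close>, while
          \<open>S\<close> and \<open>U\<close> both have k elements.\<close>
        moreover have "S - J \<omega> = U \<longleftrightarrow> S = U"
        proof
          assume eq: "S - J \<omega> = U"
          then have "U \<subseteq> S" by auto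
          then show "S = U" using S UE(2) fS card_subset_eq[of S U] by simp
        qed (use UE in auto)
        moreover have "U \<inter> J \<omega> = {}" by (fact UE(3))
        ultimately show "?a S * (chi p (S \<inter> J \<omega>) \<omega> * pexp p E (\<lambda>\<tau>. chi p (S - J \<omega>) \<tau> * chi p U \<tau>)) = (if S = U then ?a U else 0)"
          by auto
      qed
      also have "\<dots> = ?a U" using finS UE by simp
      finally show ?thesis .
    qed
    \<comment> \<open>Here k \<ge> 1 matters: the constant coefficient of \<open>G\<close>, which is
      \<open>gb \<omega>\<close>, is counted in addition to level k.\<close>
    have "{} \<notin> \<T>" using k by (auto simp: \<T>_def)
    then have "(\<Sum>S\<in>insert {} \<T>. (fourier p E G S)\<^sup>2) = (fourier p E G {})\<^sup>2 + (\<Sum>S\<in>\<T>. (?a S)\<^sup>2)"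
      using finT fG by simp
    also have "(\<Sum>S\<in>\<T>. (?a S)\<^sup>2) = (\<Sum>S\<in>?\<S>. (?a S)\<^sup>2 * of_bool (S \<inter> J \<omega> = {}))"
      unfolding \<T>_def using finS by (intro sum.mono_neutral_cong_left) auto
    finally have "(gb \<omega>)\<^sup>2 + (\<Sum>S\<in>?\<S>. (?a S)\<^sup>2 * of_bool (S \<inter> J \<omega> = {})) = (\<Sum>S\<in>insert {} \<T>. (fourier p E G S)\<^sup>2)"
      by (simp add: fourier_empty gb_def G_def)
    also have "\<dots> \<le> pexp p E (\<lambda>\<tau>. (G \<tau>)\<^sup>2)"
      by (rule Bessel[OF p fin]) (auto simp: \<T>_def)
    finally show ?thesis by (simp add: G_def)
  qed
  \<comment> \<open>Averaged over \<omega>, the right-hand side of the Bessel bound becomes the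
    squared norm of \<open>g\<close> by the exchange of unqueried edges, and this norm is the level
    weight itself.\<close>
  have "pexp p E (\<lambda>\<omega>. (gb \<omega>)\<^sup>2) + (\<Sum>S\<in>?\<S>. (?a S)\<^sup>2 * pexp p E (\<lambda>\<omega>. of_bool (S \<inter> J \<omega> = {})))
    = pexp p E (\<lambda>\<omega>. (gb \<omega>)\<^sup>2 + (\<Sum>S\<in>?\<S>. (?a S)\<^sup>2 * of_bool (S \<inter> J \<omega> = {})))"
    by (simp add: pexp_add pexp_sum pexp_cmult)
  also have "\<dots> \<le> pexp p E (\<lambda>\<omega>. pexp p E (\<lambda>\<tau>. (g (mix \<omega> \<tau>))\<^sup>2))"
    by (rule pexp_mono[OF p' 2])
  also have "\<dots> = ?W" unfolding g2[symmetric] mix_def by (rule pexp_stopping_set[OF fin J])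
  finally have 3: "pexp p E (\<lambda>\<omega>. (gb \<omega>)\<^sup>2) + (\<Sum>S\<in>?\<S>. (?a S)\<^sup>2 * pexp p E (\<lambda>\<omega>. of_bool (S \<inter> J \<omega> = {}))) \<le> ?W" .
  have ob: "of_bool P + of_bool (\<not> P) = (1 :: real)" for P by simp
  have "?W = (\<Sum>S\<in>?\<S>. (?a S)\<^sup>2 * pexp p E (\<lambda>\<omega>. of_bool (S \<inter> J \<omega> = {}) + of_bool (S \<inter> J \<omega> \<noteq> {})))"
    unfolding level_weight_def
    using fin by (simp add: ob)
  also have "\<dots> = (\<Sum>S\<in>?\<S>. (?a S)\<^sup>2 * pexp p E (\<lambda>\<omega>. of_bool (S \<inter> J \<omega> = {})))
     + (\<Sum>S\<in>?\<S>. (?a S)\<^sup>2 * pexp p E (\<lambda>\<omega>. of_bool (S \<inter> J \<omega> \<noteq> {})))"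
    by (simp add: pexp_add distrib_left sum.distrib)
  finally show ?thesis using 1 3 by simp
qed

text \<open>The algorithm may be chosen at random, here uniformly among the \<open>J i\<close>.\<close>

lemma Schramm_Steif:
  fixes \<delta> :: real
  assumes p: "0 < p" "p < 1" and fin: "finite E" and I: "finite I" "I \<noteq> {}"
    and J: "\<And>i. i \<in> I \<Longrightarrow> stopping_set E (J i)"
    and det: "\<And>i \<omega> \<tau>. i \<in> I \<Longrightarrow> \<omega> \<subseteq> E \<Longrightarrow> \<tau> \<subseteq> E \<Longrightarrow> \<omega> \<inter> J i \<omega> = \<tau> \<inter> J i \<omega> \<Longrightarrow> F \<tau> = F \<omega>"
    and F1: "\<And>\<omega>. \<omega> \<subseteq> E \<Longrightarrow> \<bar>F \<omega>\<bar> \<le> 1"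
    and rev: "\<And>e. e \<in> E \<Longrightarrow> (\<Sum>i\<in>I. pexp p E (\<lambda>\<omega>. of_bool (e \<in> J i \<omega>))) \<le> \<delta> * card I"
    and \<delta>: "0 \<le> \<delta>" and k: "k \<ge> 1"
  shows "level_weight p E F k \<le> k * \<delta>"
proof -
  let ?\<S> = "{S. S \<subseteq> E \<and> card S = k}"
  let ?W = "level_weight p E F k"
  let ?a = "fourier p E F"
  have p': "0 \<le> p" "p \<le> 1" using p by auto
  have hit: "(\<Sum>i\<in>I. pexp p E (\<lambda>\<omega>. of_bool (S \<inter> J i \<omega> \<noteq> {}))) \<le> k * (\<delta> * card I)" if S: "S \<in> ?\<S>" for S
  proof -
    have fS: "finite S" using S fin finite_subset by auto
    have "(\<Sum>i\<in>I. pexp p E (\<lambda>\<omega>. of_bool (S \<inter> J i \<omega> \<noteq> {})))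
      \<le> (\<Sum>i\<in>I. pexp p E (\<lambda>\<omega>. \<Sum>e\<in>S. of_bool (e \<in> J i \<omega>)))"
    proof (intro sum_mono pexp_mono[OF p'])
      fix i \<omega>
      show "of_bool (S \<inter> J i \<omega> \<noteq> {}) \<le> (\<Sum>e\<in>S. of_bool (e \<in> J i \<omega>) :: real)"
      proof (cases "S \<inter> J i \<omega> = {}")
        case False
        then obtain e where "e \<in> S" "e \<in> J i \<omega>" by auto
        then show ?thesis using fS member_le_sum[of e S "\<lambda>e. of_bool (e \<in> J i \<omega>) :: real"] by auto
      qed (auto intro: sum_nonneg)
    qed
    also have "\<dots> = (\<Sum>e\<in>S. \<Sum>i\<in>I. pexp p E (\<lambda>\<omega>. of_bool (e \<in> J i \<omega>)))"
      unfolding pexp_sum by (rule sum.swap)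
    also have "\<dots> \<le> (\<Sum>e\<in>S. \<delta> * real (card I))" using S by (intro sum_mono rev) auto
    finally show ?thesis using S by simp
  qed
  have "card I * ?W\<^sup>2 = (\<Sum>i\<in>I. ?W\<^sup>2)" by simp
  also have "\<dots> \<le> (\<Sum>i\<in>I. \<Sum>S\<in>?\<S>. (?a S)\<^sup>2 * pexp p E (\<lambda>\<omega>. of_bool (S \<inter> J i \<omega> \<noteq> {})))"
    by (rule sum_mono, rule level_revealment_square[OF p fin J det F1 k]) auto
  also have "\<dots> = (\<Sum>S\<in>?\<S>. (?a S)\<^sup>2 * (\<Sum>i\<in>I. pexp p E (\<lambda>\<omega>. of_bool (S \<inter> J i \<omega> \<noteq> {}))))"
    by (subst sum.swap) (simp add: sum_distrib_left)
  also have "\<dots> \<le> (\<Sum>S\<in>?\<S>. (?a S)\<^sup>2 * (k * (\<delta> * card I)))"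
    by (intro sum_mono mult_left_mono hit) auto
  also have "\<dots> = card I * (?W * (k * \<delta>))" by (simp add: level_weight_def sum_distrib_left sum_distrib_right mult_ac)
  \<comment> \<open>One factor of the level weight cancels, which turns the quadratic bound into a
    linear one.\<close>
  finally have "?W * ?W \<le> ?W * (k * \<delta>)"
    using I by (simp add: power2_eq_square card_gt_0_iff)
  moreover have "0 \<le> ?W" unfolding level_weight_def by (intro sum_nonneg) auto
  ultimately show ?thesis using \<delta> by (cases "?W = 0") auto
qed

section \<open>Noise and replicas\<close>

text \<open>Finite counterpart of the integral over \<open>noise_space\<close>, with \<eta> the set
  of re-sampled edges.\<close>

definition noise_pair :: "real \<Rightarrow> real \<Rightarrow> 'a set \<Rightarrow> ('a set \<Rightarrow> 'a set \<Rightarrow> real) \<Rightarrow> real" where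
  "noise_pair p \<epsilon> E f =
     pexp p E (\<lambda>\<xi>. pexp \<epsilon> E (\<lambda>\<eta>. pexp p E (\<lambda>\<xi>'. f \<xi> ((\<xi> - \<eta>) \<union> (\<xi>' \<inter> \<eta>)))))"

text \<open>Two copies share \<psi> and have independent \<xi>. On a product
  \<open>F \<omega> * F \<omega>'\<close> this is the second moment over \<psi> of the quenched
  expectation of \<open>F\<close>.\<close>

definition replica_pair :: "real \<Rightarrow> real \<Rightarrow> 'a set \<Rightarrow> ('a set \<Rightarrow> 'a set \<Rightarrow> real) \<Rightarrow> real" where
  "replica_pair r p E f = pexp r E (\<lambda>\<psi>. pexp p E (\<lambda>\<xi>. pexp p E (\<lambda>\<xi>'. f (\<psi> \<inter> \<xi>) (\<psi> \<inter> \<xi>'))))"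

section \<open>Both correlated pairs are diagonal on the characters\<close>

lemma prod_diagonal:
  fixes \<rho> :: real
  assumes "finite E" "S \<subseteq> E" "T \<subseteq> E"
  shows "(\<Prod>e\<in>E. if (e \<in> S) \<noteq> (e \<in> T) then 0 else if e \<in> S then \<rho> else 1) = of_bool (S = T) * \<rho> ^ card S"
proof (cases "S = T")
  case True
  then show ?thesis using assms by (simp add: prod.If_cases Int_absorb1)
next
  case False
  then obtain e where "e \<in> E" "(e \<in> S) \<noteq> (e \<in> T)" using assms by blast
  then show ?thesis using assms(1) False by (auto simp: prod_zero_iff)
qed

lemma noise_pair_chi:
  fixes E :: "'a set"
  assumes p: "0 < p" "p < 1" and "finite E" "S \<subseteq> E" "T \<subseteq> E"
  shows "noise_pair p \<epsilon> E (\<lambda>\<omega> \<omega>'. chi p S \<omega> * chi p T \<omega>') = of_bool (S = T) * (1 - \<epsilon>) ^ card S"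
proof -
  define f where "f = (\<lambda>e x y z. (if e \<in> S then chi1 p x else 1) * (if e \<in> T then chi1 p (if y then z else x) else 1))"
  have c: "chi p S \<xi> * chi p T ((\<xi> - \<eta>) \<union> (\<xi>' \<inter> \<eta>)) = (\<Prod>e\<in>E. f e (e \<in> \<xi>) (e \<in> \<eta>) (e \<in> \<xi>'))" for \<xi> \<eta> \<xi>'
    unfolding f_def chi_as_prod[OF assms(3,4)] chi_as_prod[OF assms(3,5)] prod.distrib[symmetric]
    by (intro prod.cong refl) (simp add: if_distrib)
  have "noise_pair p \<epsilon> E (\<lambda>\<omega> \<omega>'. chi p S \<omega> * chi p T \<omega>') =
    (\<Prod>e\<in>E. p * (\<epsilon> * (p * f e True True True + (1 - p) * f e True True False)
               + (1 - \<epsilon>) * (p * f e True False True + (1 - p) * f e True False False))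
       + (1 - p) * (\<epsilon> * (p * f e False True True + (1 - p) * f e False True False)
               + (1 - \<epsilon>) * (p * f e False False True + (1 - p) * f e False False False)))"
  proof -
    have 1: "pexp p E (\<lambda>\<xi>'. \<Prod>e\<in>E. f e (e \<in> \<xi>) (e \<in> \<eta>) (e \<in> \<xi>'))
        = (\<Prod>e\<in>E. p * f e (e \<in> \<xi>) (e \<in> \<eta>) True + (1 - p) * f e (e \<in> \<xi>) (e \<in> \<eta>) False)" for \<xi> \<eta>
      by (rule pexp_prod[OF assms(3), of p "\<lambda>e. f e (e \<in> \<xi>) (e \<in> \<eta>)"])
    have 2: "pexp \<epsilon> E (\<lambda>\<eta>. \<Prod>e\<in>E. p * f e (e \<in> \<xi>) (e \<in> \<eta>) True + (1 - p) * f e (e \<in> \<xi>) (e \<in> \<eta>) False)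
        = (\<Prod>e\<in>E. \<epsilon> * (p * f e (e \<in> \<xi>) True True + (1 - p) * f e (e \<in> \<xi>) True False)
             + (1 - \<epsilon>) * (p * f e (e \<in> \<xi>) False True + (1 - p) * f e (e \<in> \<xi>) False False))" for \<xi>
      by (rule pexp_prod[OF assms(3), of \<epsilon> "\<lambda>e y. p * f e (e \<in> \<xi>) y True + (1 - p) * f e (e \<in> \<xi>) y False"])
    show ?thesis
      unfolding noise_pair_def c 1 2
      by (rule pexp_prod[OF assms(3), of p "\<lambda>e x. \<epsilon> * (p * f e x True True + (1 - p) * f e x True False)
               + (1 - \<epsilon>) * (p * f e x False True + (1 - p) * f e x False False)"])
  qed
  also have "\<dots> = (\<Prod>e\<in>E. if (e \<in> S) \<noteq> (e \<in> T) then 0 else if e \<in> S then 1 - \<epsilon> else 1)"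
  proof (intro prod.cong refl)
    fix e :: 'a
    define a b where "a = (\<lambda>S. if e \<in> S then chi1 p True else 1)" and "b = (\<lambda>S. if e \<in> S then chi1 p False else 1)"
    have f: "f e x y z = (if x then a S else b S) * (if (if y then z else x) then a T else b T)" for x y z
      by (simp add: f_def a_def b_def)
    have m: "p * a S + (1 - p) * b S = of_bool (e \<notin> S)" "p * a T + (1 - p) * b T = of_bool (e \<notin> T)"
      "p * (a S * a T) + (1 - p) * (b S * b T) = of_bool (e \<in> S \<longleftrightarrow> e \<in> T)"
      using chi1_moments(1,2)[OF p] by (auto simp: a_def b_def power2_eq_square)
    show "p * (\<epsilon> * (p * f e True True True + (1 - p) * f e True True False)
               + (1 - \<epsilon>) * (p * f e True False True + (1 - p) * f e True False False))
       + (1 - p) * (\<epsilon> * (p * f e False True True + (1 - p) * f e False True False)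
               + (1 - \<epsilon>) * (p * f e False False True + (1 - p) * f e False False False))
       = (if (e \<in> S) \<noteq> (e \<in> T) then 0 else if e \<in> S then 1 - \<epsilon> else 1)"
      (is "?l = ?r")
    proof -
      \<comment> \<open>With probability \<epsilon> the second bit is fresh and the two factors are
        independent; otherwise both factors read the same bit.\<close>
      have "?l = \<epsilon> * ((p * a S + (1 - p) * b S) * (p * a T + (1 - p) * b T))
          + (1 - \<epsilon>) * (p * (a S * a T) + (1 - p) * (b S * b T))"
        unfolding f by (simp add: algebra_simps)
      also have "\<dots> = ?r" unfolding m by simp
      finally show ?thesis .
    qed
  qed
  also have "\<dots> = of_bool (S = T) * (1 - \<epsilon>) ^ card S"
    using assms by (intro prod_diagonal)
  finally show ?thesis .
qed

text \<open>Each replica is a critical configuration because \<open>r * p = 1/2\<close>, so the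
  characters are those of bias 1/2. Edge by edge the correlation is (r p^2 - 1/4) / (1/4) = 2p - 1,
  which is below 1 exactly when p < 1.\<close>

lemma replica_pair_chi:
  fixes E :: "'a set"
  assumes "r * p = 1/2" and "finite E" "S \<subseteq> E" "T \<subseteq> E"
  shows "replica_pair r p E (\<lambda>\<omega> \<omega>'. chi (1/2) S \<omega> * chi (1/2) T \<omega>') = of_bool (S = T) * (2 * p - 1) ^ card S"
proof -
  define f where "f = (\<lambda>e x y z. (if e \<in> S then chi1 (1/2) (x \<and> y) else 1) * (if e \<in> T then chi1 (1/2) (x \<and> z) else 1))"
  have c: "chi (1/2) S (\<psi> \<inter> \<xi>) * chi (1/2) T (\<psi> \<inter> \<xi>') = (\<Prod>e\<in>E. f e (e \<in> \<psi>) (e \<in> \<xi>) (e \<in> \<xi>'))" for \<psi> \<xi> \<xi>'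
    unfolding f_def chi_as_prod[OF assms(2,3)] chi_as_prod[OF assms(2,4)] prod.distrib[symmetric]
    by (intro prod.cong refl) simp
  have "replica_pair r p E (\<lambda>\<omega> \<omega>'. chi (1/2) S \<omega> * chi (1/2) T \<omega>') =
    (\<Prod>e\<in>E. r * (p * (p * f e True True True + (1 - p) * f e True True False)
               + (1 - p) * (p * f e True False True + (1 - p) * f e True False False))
       + (1 - r) * (p * (p * f e False True True + (1 - p) * f e False True False)
               + (1 - p) * (p * f e False False True + (1 - p) * f e False False False)))"
  proof -
    have 1: "pexp p E (\<lambda>\<xi>'. \<Prod>e\<in>E. f e (e \<in> \<psi>) (e \<in> \<xi>) (e \<in> \<xi>'))
        = (\<Prod>e\<in>E. p * f e (e \<in> \<psi>) (e \<in> \<xi>) True + (1 - p) * f e (e \<in> \<psi>) (e \<in> \<xi>) False)" for \<psi> \<xi>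
      by (rule pexp_prod[OF assms(2), of p "\<lambda>e. f e (e \<in> \<psi>) (e \<in> \<xi>)"])
    have 2: "pexp p E (\<lambda>\<xi>. \<Prod>e\<in>E. p * f e (e \<in> \<psi>) (e \<in> \<xi>) True + (1 - p) * f e (e \<in> \<psi>) (e \<in> \<xi>) False)
        = (\<Prod>e\<in>E. p * (p * f e (e \<in> \<psi>) True True + (1 - p) * f e (e \<in> \<psi>) True False)
             + (1 - p) * (p * f e (e \<in> \<psi>) False True + (1 - p) * f e (e \<in> \<psi>) False False))" for \<psi>
      by (rule pexp_prod[OF assms(2), of p "\<lambda>e y. p * f e (e \<in> \<psi>) y True + (1 - p) * f e (e \<in> \<psi>) y False"])
    show ?thesis
      unfolding replica_pair_def c 1 2
      by (rule pexp_prod[OF assms(2), of r "\<lambda>e x. p * (p * f e x True True + (1 - p) * f e x True False)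
               + (1 - p) * (p * f e x False True + (1 - p) * f e x False False)"])
  qed
  also have "\<dots> = (\<Prod>e\<in>E. if (e \<in> S) \<noteq> (e \<in> T) then 0 else if e \<in> S then 2 * p - 1 else 1)"
  proof (intro prod.cong refl)
    fix e :: 'a
    \<comment> \<open>At bias 1/2 the one-bit character is 1 on present and -1 on absent edges; this
      is why \<open>a\<close> is 1 in both cases.\<close>
    define a b where "a = (\<lambda>S. if e \<in> S then 1 else 1 :: real)" and "b = (\<lambda>S. if e \<in> S then - 1 else 1 :: real)"
    have f: "f e x y z = (if x \<and> y then a S else b S) * (if x \<and> z then a T else b T)" for x y z
      by (simp add: f_def a_def b_def chi1_def)
    show "r * (p * (p * f e True True True + (1 - p) * f e True True False)
               + (1 - p) * (p * f e True False True + (1 - p) * f e True False False))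
       + (1 - r) * (p * (p * f e False True True + (1 - p) * f e False True False)
               + (1 - p) * (p * f e False False True + (1 - p) * f e False False False))
       = (if (e \<in> S) \<noteq> (e \<in> T) then 0 else if e \<in> S then 2 * p - 1 else 1)"
      (is "?l = ?r")
    proof -
      \<comment> \<open>The terms are grouped so that \<open>r\<close> occurs only in the product
        \<open>r * p\<close>, where 1/2 can be substituted.\<close>
      have "?l = r * p * p * (a S * a T - a S * b T - b S * a T + b S * b T)
          + r * p * (a S * b T + b S * a T - 2 * (b S * b T)) + b S * b T"
        unfolding f by (simp add: algebra_simps)
      also have "\<dots> = ?r" unfolding assms(1)
        by (cases "e \<in> S"; cases "e \<in> T") (simp_all add: a_def b_def)
      finally show ?thesis .
    qed
  qed
  also have "\<dots> = of_bool (S = T) * (2 * p - 1) ^ card S"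
    using assms by (intro prod_diagonal)
  finally show ?thesis .
qed

lemma noise_pair_fourier:
  fixes E :: "'a set"
  assumes p: "0 < p" "p < 1" and fin: "finite E"
  shows "noise_pair p \<epsilon> E (\<lambda>\<omega> \<omega>'. F \<omega> * F \<omega>') = (\<Sum>S\<in>Pow E. (1 - \<epsilon>) ^ card S * (fourier p E F S)\<^sup>2)"
proof (rule diagonal_form[OF p fin, where B = "noise_pair p \<epsilon> E"])
  show "noise_pair p \<epsilon> E (\<lambda>\<omega> \<omega>'. \<Sum>S\<in>I. f S \<omega> \<omega>') = (\<Sum>S\<in>I. noise_pair p \<epsilon> E (f S))"
    for I :: "'a set set" and f
    unfolding noise_pair_def pexp_sum ..
  show "noise_pair p \<epsilon> E (\<lambda>\<omega> \<omega>'. c * f \<omega> \<omega>') = c * noise_pair p \<epsilon> E f" for c f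
    unfolding noise_pair_def pexp_cmult ..
  show "noise_pair p \<epsilon> E f = noise_pair p \<epsilon> E g"
    if "\<And>\<omega> \<omega>'. \<omega> \<subseteq> E \<Longrightarrow> \<omega>' \<subseteq> E \<Longrightarrow> f \<omega> \<omega>' = g \<omega> \<omega>'" for f g
    unfolding noise_pair_def by (intro pexp_cong refl that) auto
qed (rule noise_pair_chi[OF p fin])

lemma replica_pair_fourier:
  fixes E :: "'a set"
  assumes "r * p = 1/2" and fin: "finite E"
  shows "replica_pair r p E (\<lambda>\<omega> \<omega>'. F \<omega> * F \<omega>') = (\<Sum>S\<in>Pow E. (2 * p - 1) ^ card S * (fourier (1/2) E F S)\<^sup>2)"
proof (rule diagonal_form[OF _ _ fin, where B = "replica_pair r p E"])
  show "replica_pair r p E (\<lambda>\<omega> \<omega>'. \<Sum>S\<in>I. f S \<omega> \<omega>') = (\<Sum>S\<in>I. replica_pair r p E (f S))"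
    for I :: "'a set set" and f
    unfolding replica_pair_def pexp_sum ..
  show "replica_pair r p E (\<lambda>\<omega> \<omega>'. c * f \<omega> \<omega>') = c * replica_pair r p E f" for c f
    unfolding replica_pair_def pexp_cmult ..
  show "replica_pair r p E f = replica_pair r p E g"
    if "\<And>\<omega> \<omega>'. \<omega> \<subseteq> E \<Longrightarrow> \<omega>' \<subseteq> E \<Longrightarrow> f \<omega> \<omega>' = g \<omega> \<omega>'" for f g
    unfolding replica_pair_def by (intro pexp_cong refl that) auto
qed (simp_all add: replica_pair_chi[OF assms])

lemma summable_k_powers: "0 \<le> \<rho> \<Longrightarrow> \<rho> < 1 \<Longrightarrow> summable (\<lambda>k. real k * \<rho> ^ k)" for \<rho> :: real
proof -
  assume "0 \<le> \<rho>" "\<rho> < 1"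
  then have "summable (\<lambda>k. of_nat (Suc k) * \<rho> ^ k)"
    using geometric_deriv_sums[of \<rho>] by (auto simp: sums_iff)
  then show ?thesis
    by (rule summable_comparison_test'[where N = 0]) (use \<open>0 \<le> \<rho>\<close> in \<open>auto simp: abs_mult intro!: mult_right_mono\<close>)
qed

text \<open>Sorted by cardinality, the empty set contributes the squared mean and level k at most
  \<rho>^k k \<delta>. The resulting covariance bound depends on \<rho> and \<delta> but not on the
  size of \<open>E\<close>.\<close>

lemma fourier_tail_bound:
  fixes \<rho> \<delta> :: real
  assumes fin: "finite E" and \<rho>: "0 \<le> \<rho>" "\<rho> < 1" and \<delta>: "0 \<le> \<delta>"
    and W: "\<And>k. k \<ge> 1 \<Longrightarrow> level_weight p E F k \<le> k * \<delta>"
  shows "(\<Sum>S\<in>Pow E. \<rho> ^ card S * (fourier p E F S)\<^sup>2) - (pexp p E F)\<^sup>2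
     \<in> {0..\<delta> * (\<Sum>k. real k * \<rho> ^ k)}"
proof -
  let ?n = "card E"
  have "(\<Sum>S\<in>Pow E. \<rho> ^ card S * (fourier p E F S)\<^sup>2)
     = (\<Sum>k\<in>{0..?n}. \<Sum>S\<in>{S \<in> Pow E. card S = k}. \<rho> ^ card S * (fourier p E F S)\<^sup>2)"
    using fin by (intro sum.group[symmetric]) (auto intro: card_mono)
  also have "\<dots> = (\<Sum>k\<in>{0..?n}. \<rho> ^ k * level_weight p E F k)"
    unfolding level_weight_def sum_distrib_left by (intro sum.cong) auto
  also have "\<dots> = (pexp p E F)\<^sup>2 + (\<Sum>k\<in>{1..?n}. \<rho> ^ k * level_weight p E F k)"
  proof -
    have "{S. S \<subseteq> E \<and> card S = 0} = {{}}" using fin by (auto dest: finite_subset)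
    then have "level_weight p E F 0 = (pexp p E F)\<^sup>2" by (simp add: level_weight_def fourier_empty)
    then show ?thesis by (subst sum.atLeast_Suc_atMost) simp_all
  qed
  finally have eq: "(\<Sum>S\<in>Pow E. \<rho> ^ card S * (fourier p E F S)\<^sup>2) - (pexp p E F)\<^sup>2
    = (\<Sum>k\<in>{1..?n}. \<rho> ^ k * level_weight p E F k)" by simp
  have "(\<Sum>k\<in>{1..?n}. \<rho> ^ k * level_weight p E F k) \<le> (\<Sum>k\<in>{1..?n}. \<rho> ^ k * (k * \<delta>))"
    using \<rho> W by (intro sum_mono mult_left_mono) auto
  also have "\<dots> = \<delta> * (\<Sum>k\<in>{1..?n}. real k * \<rho> ^ k)" by (simp add: sum_distrib_left mult_ac)
  also have "\<dots> \<le> \<delta> * (\<Sum>k. real k * \<rho> ^ k)"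
    using \<rho> \<delta> by (intro mult_left_mono sum_le_suminf summable_k_powers) auto
  moreover have "0 \<le> (\<Sum>k\<in>{1..?n}. \<rho> ^ k * level_weight p E F k)"
    using \<rho> by (auto intro!: sum_nonneg mult_nonneg_nonneg simp: level_weight_def)
  ultimately show ?thesis unfolding eq by auto
qed

section \<open>Connections in the square lattice\<close>

definition edges_in :: "vertex set \<Rightarrow> edge set" where
  "edges_in \<Lambda> = {e \<in> lattice_edges. e \<subseteq> \<Lambda>}"

definition reach :: "edge set \<Rightarrow> (vertex \<times> vertex) set" where
  "reach \<omega> = {(u, v). {u, v} \<in> \<omega>}\<^sup>*"

definition crossing :: "vertex set \<Rightarrow> vertex set \<Rightarrow> vertex set \<Rightarrow> edge set \<Rightarrow> bool" where
  "crossing \<Lambda> A B \<omega> \<longleftrightarrow> (\<exists>a\<in>A \<inter> \<Lambda>. \<exists>b\<in>B \<inter> \<Lambda>. (a, b) \<in> reach (\<omega> \<inter> edges_in \<Lambda>))"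

definition cluster :: "vertex set \<Rightarrow> vertex set \<Rightarrow> edge set \<Rightarrow> vertex set" where
  "cluster \<Lambda> A \<omega> = {v. \<exists>a\<in>A \<inter> \<Lambda>. (a, v) \<in> reach (\<omega> \<inter> edges_in \<Lambda>)}"

text \<open>The absent edges at the boundary of the clusters are included: they have to be queried
  to know that the clusters end there.\<close>

definition explored :: "vertex set \<Rightarrow> vertex set \<Rightarrow> edge set \<Rightarrow> edge set" where
  "explored \<Lambda> A \<omega> = {e \<in> edges_in \<Lambda>. e \<inter> cluster \<Lambda> A \<omega> \<noteq> {}}"

lemma lattice_edges_iff:
  "{u, v} \<in> lattice_edges \<longleftrightarrow> \<bar>fst u - fst v\<bar> + \<bar>snd u - snd v\<bar> = 1"
proof
  assume "{u, v} \<in> lattice_edges"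
  then show "\<bar>fst u - fst v\<bar> + \<bar>snd u - snd v\<bar> = 1"
    unfolding lattice_edges_def by (auto simp: doubleton_eq_iff abs_minus_commute)
qed (auto simp: lattice_edges_def simp del: split_paired_Ex)

lemma lattice_edgeE:
  assumes "e \<in> lattice_edges"
  obtains u v where "e = {u, v}" "u \<noteq> v" "\<bar>fst u - fst v\<bar> + \<bar>snd u - snd v\<bar> = 1"
  using assms unfolding lattice_edges_def by fastforce

lemma edges_in_iff: "{u, v} \<in> edges_in \<Lambda> \<longleftrightarrow> {u, v} \<in> lattice_edges \<and> u \<in> \<Lambda> \<and> v \<in> \<Lambda>"
  by (auto simp: edges_in_def)

lemma edges_inE:
  assumes "e \<in> edges_in \<Lambda>"
  obtains u v where "e = {u, v}" "u \<in> \<Lambda>" "v \<in> \<Lambda>" "{u, v} \<in> lattice_edges"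
proof -
  have e: "e \<in> lattice_edges" "e \<subseteq> \<Lambda>" using assms by (auto simp: edges_in_def)
  obtain u v where "e = {u, v}" using e(1) by (elim lattice_edgeE)
  then show ?thesis using that e by auto
qed

lemma finite_edges_in [simp]: "finite \<Lambda> \<Longrightarrow> finite (edges_in \<Lambda>)"
  by (rule finite_subset[of _ "Pow \<Lambda>"]) (auto simp: edges_in_def)

lemma edges_in_lattice: "edges_in \<Lambda> \<subseteq> lattice_edges"
  by (auto simp: edges_in_def)

lemma edges_in_mono: "\<Lambda> \<subseteq> \<Lambda>' \<Longrightarrow> edges_in \<Lambda> \<subseteq> edges_in \<Lambda>'"
  by (auto simp: edges_in_def)

lemma edges_in_disjoint: "\<Lambda> \<inter> \<Lambda>' = {} \<Longrightarrow> edges_in \<Lambda> \<inter> edges_in \<Lambda>' = {}"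
  by (auto simp: edges_in_def elim!: lattice_edgeE)

lemma reach_refl [simp]: "(u, u) \<in> reach \<omega>"
  by (simp add: reach_def)

lemma reach_trans: "(u, v) \<in> reach \<omega> \<Longrightarrow> (v, w) \<in> reach \<omega> \<Longrightarrow> (u, w) \<in> reach \<omega>"
  unfolding reach_def by (rule rtrancl_trans)

lemma reach_step: "{u, v} \<in> \<omega> \<Longrightarrow> (u, v) \<in> reach \<omega>"
  unfolding reach_def by auto

lemma reach_sym: "(u, v) \<in> reach \<omega> \<Longrightarrow> (v, u) \<in> reach \<omega>"
  unfolding reach_def by (rule symD[OF sym_rtrancl]) (auto simp: sym_def insert_commute)

lemma reach_mono: "\<omega> \<subseteq> \<omega>' \<Longrightarrow> reach \<omega> \<subseteq> reach \<omega>'"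
  unfolding reach_def by (intro rtrancl_mono) auto

lemma reach_induct [consumes 1, case_names base step]:
  assumes "(u, v) \<in> reach \<omega>" "P u"
    "\<And>x y. (u, x) \<in> reach \<omega> \<Longrightarrow> {x, y} \<in> \<omega> \<Longrightarrow> P x \<Longrightarrow> P y"
  shows "P v"
  using assms(1) unfolding reach_def
  by (induction rule: rtrancl_induct) (use assms(2,3) in \<open>auto simp: reach_def\<close>)

lemma reach_edges_in_closed:
  "(u, v) \<in> reach (\<omega> \<inter> edges_in \<Lambda>) \<Longrightarrow> u \<in> \<Lambda> \<Longrightarrow> v \<in> \<Lambda>"
  by (induction rule: reach_induct) (auto simp: edges_in_iff)

lemma crossing_mono: "\<omega> \<subseteq> \<omega>' \<Longrightarrow> crossing \<Lambda> A B \<omega> \<Longrightarrow> crossing \<Lambda> A B \<omega>'"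
  unfolding crossing_def using reach_mono[of "\<omega> \<inter> edges_in \<Lambda>" "\<omega>' \<inter> edges_in \<Lambda>"] by blast

lemma crossing_restrict: "crossing \<Lambda> A B \<omega> = crossing \<Lambda> A B (\<omega> \<inter> edges_in \<Lambda>)"
  by (simp add: crossing_def Int_assoc)

lemma cluster_subset: "cluster \<Lambda> A \<omega> \<subseteq> \<Lambda>"
  unfolding cluster_def using reach_edges_in_closed by blast

text \<open>A connection started in the cluster can advance only through an edge touching it, where
  \<omega> and \<tau> agree. The explored set is that of \<omega> in both directions, so in the
  second one the induction carries membership in the cluster of \<omega> along.\<close>

lemma reach_explored:
  assumes "\<omega> \<inter> explored \<Lambda> A \<omega> = \<tau> \<inter> explored \<Lambda> A \<omega>" "a \<in> A \<inter> \<Lambda>"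
  shows "(a, v) \<in> reach (\<omega> \<inter> edges_in \<Lambda>) \<longleftrightarrow> (a, v) \<in> reach (\<tau> \<inter> edges_in \<Lambda>)"
proof
  assume "(a, v) \<in> reach (\<omega> \<inter> edges_in \<Lambda>)"
  then show "(a, v) \<in> reach (\<tau> \<inter> edges_in \<Lambda>)"
  proof (induction rule: reach_induct)
    case (step x y)
    then have "{x, y} \<in> \<omega> \<inter> explored \<Lambda> A \<omega>" using assms(2) by (auto simp: explored_def cluster_def)
    then show ?case using step assms(1) by (auto intro: reach_trans reach_step)
  qed simp
next
  assume "(a, v) \<in> reach (\<tau> \<inter> edges_in \<Lambda>)"
  then show "(a, v) \<in> reach (\<omega> \<inter> edges_in \<Lambda>)"
  proof (induction rule: reach_induct)
    case (step x y)
    then have "{x, y} \<in> \<tau> \<inter> explored \<Lambda> A \<omega>" using assms(2) by (auto simp: explored_def cluster_def)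
    then show ?case using step assms(1) by (auto intro: reach_trans reach_step)
  qed simp
qed

lemma cluster_explored:
  assumes "\<omega> \<inter> explored \<Lambda> A \<omega> = \<tau> \<inter> explored \<Lambda> A \<omega>"
  shows "cluster \<Lambda> A \<tau> = cluster \<Lambda> A \<omega>" "explored \<Lambda> A \<tau> = explored \<Lambda> A \<omega>"
proof -
  show "cluster \<Lambda> A \<tau> = cluster \<Lambda> A \<omega>" using reach_explored[OF assms] unfolding cluster_def by blast
  then show "explored \<Lambda> A \<tau> = explored \<Lambda> A \<omega>" unfolding explored_def by simp
qed

text \<open>The queries concern \<xi> alone; \<psi> is known to the algorithm from the
  start.\<close>

lemma stopping_set_explored: "stopping_set E (\<lambda>\<xi>. explored \<Lambda> A (\<psi> \<inter> \<xi>))"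
  unfolding stopping_set_def by (intro allI impI cluster_explored(2)) blast

text \<open>One argument covers the exploration from a vertical line (\<open>fst\<close>) and from a
  concentric square (\<open>sup_norm\<close>): an integer height that changes by at most one per
  edge takes every intermediate value along a connection.\<close>

definition lipschitz1 :: "(vertex \<Rightarrow> int) \<Rightarrow> bool" where
  "lipschitz1 l \<longleftrightarrow> (\<forall>u v. {u, v} \<in> lattice_edges \<longrightarrow> \<bar>l u - l v\<bar> \<le> 1)"

lemma reach_slice:
  assumes "lipschitz1 l" "(u, v) \<in> reach (\<omega> \<inter> edges_in \<Lambda>)" "l u \<le> i" "i \<le> l v"
  obtains s where "l s = i" "(u, s) \<in> reach (\<omega> \<inter> edges_in \<Lambda>)" "(s, v) \<in> reach (\<omega> \<inter> edges_in \<Lambda>)"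
proof -
  let ?R = "reach (\<omega> \<inter> edges_in \<Lambda>)"
  have "i \<le> l v \<longrightarrow> (\<exists>s. l s = i \<and> (u, s) \<in> ?R \<and> (s, v) \<in> ?R)"
    using assms(2)
  proof (induction rule: reach_induct)
    case base
    then show ?case using assms(3) by (intro impI exI[of _ u]) auto
  next
    case (step x y)
    have xy: "(x, y) \<in> ?R" using step by (intro reach_step) auto
    have "\<bar>l x - l y\<bar> \<le> 1" using step(2) assms(1) unfolding lipschitz1_def edges_in_def by blast
    then consider "i \<le> l x" | "l y \<le> i" by linarith
    then show ?case
    proof cases
      case 1
      then show ?thesis using step xy reach_trans by blast
    next
      case 2
      have "(u, y) \<in> ?R" using step(1) xy by (rule reach_trans)
      then show ?thesis using 2 by (intro impI exI[of _ y]) auto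
    qed
  qed
  then show ?thesis using assms(4) that by blast
qed

text \<open>A crossing meets every slice \<open>{l = i}\<close>, so exploring the clusters of one slice reveals it.\<close>

lemma crossing_explored_slice:
  assumes l: "lipschitz1 l" and i: "lo \<le> i" "i \<le> hi"
    and eq: "\<omega> \<inter> explored \<Lambda> {v. l v = i} \<omega> = \<tau> \<inter> explored \<Lambda> {v. l v = i} \<omega>"
    and c: "crossing \<Lambda> {v. l v = lo} {v. l v = hi} \<omega>"
  shows "crossing \<Lambda> {v. l v = lo} {v. l v = hi} \<tau>"
proof -
  obtain a b where ab: "a \<in> \<Lambda>" "b \<in> \<Lambda>" "l a = lo" "l b = hi" "(a, b) \<in> reach (\<omega> \<inter> edges_in \<Lambda>)"
    using c by (auto simp: crossing_def)
  obtain s where s: "l s = i" "(a, s) \<in> reach (\<omega> \<inter> edges_in \<Lambda>)" "(s, b) \<in> reach (\<omega> \<inter> edges_in \<Lambda>)"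
    using reach_slice[OF l ab(5)] i ab by blast
  have sL: "s \<in> {v. l v = i} \<inter> \<Lambda>" using reach_edges_in_closed[OF s(2) ab(1)] s by auto
  have "(s, a) \<in> reach (\<tau> \<inter> edges_in \<Lambda>)" "(s, b) \<in> reach (\<tau> \<inter> edges_in \<Lambda>)"
    using reach_explored[OF eq sL] s reach_sym by blast+
  then show ?thesis using ab unfolding crossing_def using reach_sym reach_trans by blast
qed

text \<open>Distance is measured by the height \<open>l\<close>, because this is what a connection
  to a remote slice provides directly.\<close>

definition far_reaching :: "(vertex \<Rightarrow> int) \<Rightarrow> vertex set \<Rightarrow> nat \<Rightarrow> vertex \<Rightarrow> edge set \<Rightarrow> bool" where
  "far_reaching l \<Lambda> R v \<omega> \<longleftrightarrow> (\<exists>w. (v, w) \<in> reach (\<omega> \<inter> edges_in \<Lambda>) \<and> int R \<le> \<bar>l v - l w\<bar>)"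

text \<open>The explored slice is uniform in \<open>{lo..hi}\<close>. A vertex lies in the clusters
  of slice \<open>i\<close> only if \<open>i\<close> is within \<open>R\<close> of its height, which
  happens for at most 2R + 1 slices, or if it reaches height distance \<open>R\<close>, with
  probability at most \<pi>. The outer factor 2 accounts for the two endpoints of an edge.\<close>

lemma crossing_level_weight:
  assumes p: "0 < p" "p < 1" and fin: "finite \<Lambda>" and l: "lipschitz1 l" and lohi: "lo \<le> hi"
    and arm: "\<And>v. v \<in> \<Lambda> \<Longrightarrow> pexp p (edges_in \<Lambda>) (\<lambda>\<xi>. of_bool (far_reaching l \<Lambda> R v (\<psi> \<inter> \<xi>))) \<le> \<pi>"
    and \<pi>: "0 \<le> \<pi>" and k: "k \<ge> 1"
  shows "level_weight p (edges_in \<Lambda>) (\<lambda>\<xi>. of_bool (crossing \<Lambda> {v. l v = lo} {v. l v = hi} (\<psi> \<inter> \<xi>))) k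
    \<le> k * (2 * ((2 * real R + 1) / real_of_int (hi - lo + 1) + \<pi>))"
proof (rule Schramm_Steif[OF p, where I = "{lo..hi}" and J = "\<lambda>i \<xi>. explored \<Lambda> {v. l v = i} (\<psi> \<inter> \<xi>)"])
  let ?E = "edges_in \<Lambda>"
  let ?J = "\<lambda>i \<xi>. explored \<Lambda> {v. l v = i} (\<psi> \<inter> \<xi>)"
  have p': "0 \<le> p" "p \<le> 1" using p by auto
  show "finite ?E" using fin by simp
  show "{lo..hi} \<noteq> {}" using lohi by simp
  show "stopping_set ?E (?J i)" for i by (rule stopping_set_explored)
  show "of_bool (crossing \<Lambda> {v. l v = lo} {v. l v = hi} (\<psi> \<inter> \<tau>)) =
      (of_bool (crossing \<Lambda> {v. l v = lo} {v. l v = hi} (\<psi> \<inter> \<omega>)) :: real)"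
    if i: "i \<in> {lo..hi}" and eq: "\<omega> \<inter> ?J i \<omega> = \<tau> \<inter> ?J i \<omega>" for i \<omega> \<tau>
  proof -
    have e: "(\<psi> \<inter> \<omega>) \<inter> ?J i \<omega> = (\<psi> \<inter> \<tau>) \<inter> ?J i \<omega>" using eq by blast
    \<comment> \<open>The explored sets of the two configurations coincide, so their roles may be
      exchanged to get the converse implication.\<close>
    have e': "(\<psi> \<inter> \<tau>) \<inter> ?J i \<tau> = (\<psi> \<inter> \<omega>) \<inter> ?J i \<tau>" using e cluster_explored(2)[OF e] by simp
    show ?thesis
      using crossing_explored_slice[OF l _ _ e, of lo hi] crossing_explored_slice[OF l _ _ e', of lo hi] i by auto
  qed
  have v: "(\<Sum>i\<in>{lo..hi}. pexp p ?E (\<lambda>\<xi>. of_bool (v \<in> cluster \<Lambda> {v. l v = i} (\<psi> \<inter> \<xi>))))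
      \<le> (2 * real R + 1) + (hi - lo + 1) * \<pi>" if v: "v \<in> \<Lambda>" for v
  proof -
    have "(\<Sum>i\<in>{lo..hi}. pexp p ?E (\<lambda>\<xi>. of_bool (v \<in> cluster \<Lambda> {v. l v = i} (\<psi> \<inter> \<xi>))))
      \<le> (\<Sum>i\<in>{lo..hi}. of_bool (i \<in> {l v - R..l v + R}) + \<pi>)"
    proof (rule sum_mono)
      fix i
      show "pexp p ?E (\<lambda>\<xi>. of_bool (v \<in> cluster \<Lambda> {v. l v = i} (\<psi> \<inter> \<xi>))) \<le> of_bool (i \<in> {l v - R..l v + R}) + \<pi>"
      proof (cases "i \<in> {l v - R..l v + R}")
        case True
        have "pexp p ?E (\<lambda>\<xi>. of_bool (v \<in> cluster \<Lambda> {v. l v = i} (\<psi> \<inter> \<xi>))) \<le> 1"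
          using fin by (intro pexp_le_const p') auto
        then show ?thesis using True \<pi> by simp
      next
        case False
        have "pexp p ?E (\<lambda>\<xi>. of_bool (v \<in> cluster \<Lambda> {v. l v = i} (\<psi> \<inter> \<xi>)))
          \<le> pexp p ?E (\<lambda>\<xi>. of_bool (far_reaching l \<Lambda> R v (\<psi> \<inter> \<xi>)))"
        proof (intro pexp_mono p')
          fix \<xi>
          show "of_bool (v \<in> cluster \<Lambda> {v. l v = i} (\<psi> \<inter> \<xi>)) \<le> (of_bool (far_reaching l \<Lambda> R v (\<psi> \<inter> \<xi>)) :: real)"
          proof (cases "v \<in> cluster \<Lambda> {v. l v = i} (\<psi> \<inter> \<xi>)")
            case True
            then obtain s where s: "l s = i" "(s, v) \<in> reach (\<psi> \<inter> \<xi> \<inter> ?E)" by (auto simp: cluster_def)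
            have "int R \<le> \<bar>l v - l s\<bar>" using False s by auto
            then have "far_reaching l \<Lambda> R v (\<psi> \<inter> \<xi>)" unfolding far_reaching_def using reach_sym[OF s(2)] by blast
            then show ?thesis by simp
          qed simp
        qed
        also have "\<dots> \<le> \<pi>" by (rule arm[OF v])
        finally show ?thesis using False by simp
      qed
    qed
    also have "\<dots> = card ({lo..hi} \<inter> {l v - R..l v + R}) + (hi - lo + 1) * \<pi>"
      using lohi by (simp add: sum.distrib of_bool_def sum.If_cases del: atLeastAtMost_iff)
    also have "card ({lo..hi} \<inter> {l v - R..l v + R}) \<le> card {l v - R..l v + R}" by (intro card_mono) auto
    finally show ?thesis by simp
  qed
  fix e assume e: "e \<in> ?E"
  then obtain x y where xy: "e = {x, y}" "x \<in> \<Lambda>" "y \<in> \<Lambda>" by (elim edges_inE)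
  have "(\<Sum>i\<in>{lo..hi}. pexp p ?E (\<lambda>\<omega>. of_bool (e \<in> ?J i \<omega>)))
    \<le> (\<Sum>i\<in>{lo..hi}. pexp p ?E (\<lambda>\<xi>. of_bool (x \<in> cluster \<Lambda> {v. l v = i} (\<psi> \<inter> \<xi>)))
        + pexp p ?E (\<lambda>\<xi>. of_bool (y \<in> cluster \<Lambda> {v. l v = i} (\<psi> \<inter> \<xi>))))"
    unfolding pexp_add[symmetric] by (intro sum_mono pexp_mono p') (auto simp: explored_def xy)
  also have "\<dots> \<le> ((2 * real R + 1) + (hi - lo + 1) * \<pi>) + ((2 * real R + 1) + (hi - lo + 1) * \<pi>)"
    unfolding sum.distrib by (intro add_mono v xy)
  also have "\<dots> = (2 * ((2 * real R + 1) / real_of_int (hi - lo + 1) + \<pi>)) * real (card {lo..hi})"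
    using lohi by (simp add: field_simps)
  finally show "(\<Sum>i\<in>{lo..hi}. pexp p ?E (\<lambda>\<omega>. of_bool (e \<in> ?J i \<omega>)))
    \<le> (2 * ((2 * real R + 1) / real_of_int (hi - lo + 1) + \<pi>)) * real (card {lo..hi})" .
qed (use \<pi> lohi k in auto)

section \<open>Lattice symmetries\<close>

definition lattice_aut :: "(vertex \<Rightarrow> vertex) \<Rightarrow> bool" where
  "lattice_aut T \<longleftrightarrow> bij T \<and> (\<forall>u v. {T u, T v} \<in> lattice_edges \<longleftrightarrow> {u, v} \<in> lattice_edges)"

lemma lattice_aut_image_edges_in:
  assumes "lattice_aut T"
  shows "edges_in (T ` \<Lambda>) = (`) T ` edges_in \<Lambda>"
proof (intro set_eqI iffI)
  fix e assume "e \<in> edges_in (T ` \<Lambda>)"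
  then have e: "e \<in> lattice_edges" "e \<subseteq> T ` \<Lambda>" by (auto simp: edges_in_def)
  obtain a b where ab: "e = {a, b}" using e(1) by (elim lattice_edgeE)
  then obtain u v where "a = T u" "b = T v" "u \<in> \<Lambda>" "v \<in> \<Lambda>" using e(2) by auto
  then show "e \<in> (`) T ` edges_in \<Lambda>"
    using ab e(1) assms by (intro image_eqI[of _ _ "{u, v}"]) (auto simp: edges_in_iff lattice_aut_def simp del: split_paired_All)
next
  fix e assume "e \<in> (`) T ` edges_in \<Lambda>"
  then obtain f where f: "f \<in> edges_in \<Lambda>" "e = T ` f" by auto
  then obtain u v where "f = {u, v}" by (auto simp: edges_in_def elim!: lattice_edgeE)
  then show "e \<in> edges_in (T ` \<Lambda>)" using f assms by (auto simp: edges_in_iff lattice_aut_def simp del: split_paired_All)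
qed

lemma reach_image:
  assumes "inj T"
  shows "(T u, T v) \<in> reach ((`) T ` \<omega>) \<longleftrightarrow> (u, v) \<in> reach \<omega>"
proof
  assume "(T u, T v) \<in> reach ((`) T ` \<omega>)"
  then have "\<exists>z. T v = T z \<and> (u, z) \<in> reach \<omega>"
  proof (induction rule: reach_induct)
    case base
    show ?case by (rule exI[of _ u]) simp
  next
    case (step x y)
    then obtain z where z: "x = T z" "(u, z) \<in> reach \<omega>" by auto
    from step(2) obtain e where e: "e \<in> \<omega>" "{x, y} = T ` e" by auto
    then obtain w where w: "y = T w" "w \<in> e" by (metis imageE insertI1 insert_commute)
    have "T ` {z, w} = T ` e" using e z w by simp
    then have "e = {z, w}" using assms by (metis inj_image_eq_iff)
    then have "(u, w) \<in> reach \<omega>" using z e reach_step[of z w \<omega>] by (auto intro: reach_trans)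
    then show ?case using w by blast
  qed
  then show "(u, v) \<in> reach \<omega>" using assms by (metis injD)
next
  assume "(u, v) \<in> reach \<omega>"
  then show "(T u, T v) \<in> reach ((`) T ` \<omega>)"
  proof (induction rule: reach_induct)
    case (step x y)
    then have "{T x, T y} \<in> (`) T ` \<omega>" by (metis image_empty image_eqI image_insert)
    then show ?case using step by (meson reach_step reach_trans)
  qed simp
qed

lemma image_edges_Int:
  assumes "lattice_aut T"
  shows "(`) T ` \<omega> \<inter> edges_in (T ` \<Lambda>) = (`) T ` (\<omega> \<inter> edges_in \<Lambda>)"
proof -
  have "inj T" using assms by (simp add: lattice_aut_def bij_def)
  then show ?thesis
    unfolding lattice_aut_image_edges_in[OF assms]
    by (subst image_Int) (auto simp: inj_def inj_image_eq_iff)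
qed

lemma crossing_image:
  assumes "lattice_aut T"
  shows "crossing (T ` \<Lambda>) (T ` A) (T ` B) ((`) T ` \<omega>) = crossing \<Lambda> A B \<omega>"
proof -
  have inj: "inj T" using assms by (simp add: lattice_aut_def bij_def)
  have "T ` A \<inter> T ` \<Lambda> = T ` (A \<inter> \<Lambda>)" "T ` B \<inter> T ` \<Lambda> = T ` (B \<inter> \<Lambda>)"
    using inj by (simp_all add: image_Int)
  then show ?thesis unfolding crossing_def image_edges_Int[OF assms] by (simp add: reach_image[OF inj])
qed

lemma pexp_lattice_aut:
  assumes "lattice_aut T"
  shows "pexp p (edges_in (T ` \<Lambda>)) F = pexp p (edges_in \<Lambda>) (\<lambda>\<omega>. F ((`) T ` \<omega>))"
  unfolding lattice_aut_image_edges_in[OF assms]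
  by (rule pexp_image) (use assms in \<open>auto simp: inj_on_def lattice_aut_def bij_def inj_image_eq_iff\<close>)

lemma pexp_crossing_image:
  assumes "lattice_aut T"
  shows "pexp p (edges_in (T ` \<Lambda>)) (\<lambda>\<omega>. of_bool (crossing (T ` \<Lambda>) (T ` A) (T ` B) \<omega>))
    = pexp p (edges_in \<Lambda>) (\<lambda>\<omega>. of_bool (crossing \<Lambda> A B \<omega>))"
  unfolding pexp_lattice_aut[OF assms] crossing_image[OF assms] ..

lemma lattice_autI:
  assumes "\<And>v. g (T v) = v" "\<And>v. T (g v) = v"
    "\<And>u v. \<bar>fst (T u) - fst (T v)\<bar> + \<bar>snd (T u) - snd (T v)\<bar> = \<bar>fst u - fst v\<bar> + \<bar>snd u - snd v\<bar>"
  shows "lattice_aut T"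
  unfolding lattice_aut_def lattice_edges_iff assms(3) using assms(1,2) by (auto intro: bij_betw_byWitness[of _ g])

lemma lattice_aut_translate: "lattice_aut (\<lambda>v. (fst v + a, snd v + b))"
  by (rule lattice_autI[of "\<lambda>v. (fst v - a, snd v - b)"]) auto

lemma lattice_aut_transpose: "lattice_aut (\<lambda>v. (snd v, fst v))"
  by (rule lattice_autI[of "\<lambda>v. (snd v, fst v)"]) auto

lemma lattice_aut_reflect_fst: "lattice_aut (\<lambda>v. (a - fst v, snd v))"
  by (rule lattice_autI[of "\<lambda>v. (a - fst v, snd v)"]) (auto simp: abs_minus_commute)

lemma lattice_aut_reflect_snd: "lattice_aut (\<lambda>v. (fst v, a - snd v))"
  by (rule lattice_autI[of "\<lambda>v. (fst v, a - snd v)"]) (auto simp: abs_minus_commute)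

declare split_paired_All [simp del] split_paired_Ex [simp del]

section \<open>Planar topology\<close>

definition switches :: "'a set \<Rightarrow> 'a list \<Rightarrow> nat" where
  "switches A xs = length (filter (\<lambda>(a, b). (a \<in> A) \<noteq> (b \<in> A)) (zip xs (tl xs)))"

lemma even_switches: "xs \<noteq> [] \<Longrightarrow> even (switches A xs) \<longleftrightarrow> (hd xs \<in> A \<longleftrightarrow> last xs \<in> A)"
proof (induction xs)
  case (Cons x xs)
  then show ?case by (cases xs) (auto simp: switches_def)
qed simp

definition walk :: "edge set \<Rightarrow> vertex list \<Rightarrow> bool" where
  "walk \<omega> P \<longleftrightarrow> P \<noteq> [] \<and> successively (\<lambda>a b. {a, b} \<in> \<omega>) P"

lemma walk_zip: "walk \<omega> P \<Longrightarrow> (a, b) \<in> set (zip P (tl P)) \<Longrightarrow> {a, b} \<in> \<omega>"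
proof (induction P)
  case (Cons x P)
  then show ?case by (cases P) (auto simp: walk_def)
qed simp

lemma reach_walk:
  assumes "(u, v) \<in> reach \<omega>"
  obtains P where "walk \<omega> P" "hd P = u" "last P = v" "\<And>z. z \<in> set P \<Longrightarrow> (u, z) \<in> reach \<omega>"
proof -
  have "\<exists>P. walk \<omega> P \<and> hd P = u \<and> last P = v \<and> (\<forall>z\<in>set P. (u, z) \<in> reach \<omega>)"
    using assms
  proof (induction rule: reach_induct)
    case base
    show ?case by (rule exI[of _ "[u]"]) (simp add: walk_def)
  next
    case (step x y)
    then obtain P where P: "walk \<omega> P" "hd P = u" "last P = x" "\<forall>z\<in>set P. (u, z) \<in> reach \<omega>" by auto
    have "(u, y) \<in> reach \<omega>" using step reach_step reach_trans by blast
    then show ?case using P step(2)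
      by (intro exI[of _ "P @ [y]"]) (auto simp: walk_def successively_append_iff)
  qed
  then show ?thesis using that by blast
qed

text \<open>The number of crossings of \<open>P\<close> with the ray that starts half a unit above
  \<open>v\<close> and runs to the right: a discrete form of the parity count in the Jordan curve
  theorem.\<close>

definition right_steps :: "vertex list \<Rightarrow> vertex \<Rightarrow> nat" where
  "right_steps P v = length (filter (\<lambda>(a, b). fst v < fst a \<and> fst v < fst b \<and> {snd a, snd b} = {snd v, snd v + 1}) (zip P (tl P)))"

lemma zip_tl_set: "(a, b) \<in> set (zip P (tl P)) \<Longrightarrow> a \<in> set P \<and> b \<in> set P"
  by (cases P) (auto dest: set_zip_leftD set_zip_rightD)

lemma lattice_step_cases:
  assumes "{a, b} \<in> lattice_edges"
  obtains "b = (fst a + 1, snd a)" | "a = (fst b + 1, snd b)" | "b = (fst a, snd a + 1)" | "a = (fst b, snd b + 1)"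
proof -
  have "\<bar>fst a - fst b\<bar> + \<bar>snd a - snd b\<bar> = 1" using assms by (simp add: lattice_edges_iff)
  then have "fst b = fst a + 1 \<and> snd b = snd a \<or> fst a = fst b + 1 \<and> snd a = snd b \<or>
     fst b = fst a \<and> snd b = snd a + 1 \<or> fst a = fst b \<and> snd a = snd b + 1" by linarith
  then show ?thesis using that by (metis prod.collapse)
qed

text \<open>Moving the start of the ray one unit to the right could lose only the vertical step in
  column x + 1 from height y to y + 1, and this step would visit the excluded vertex.\<close>

lemma right_steps_horizontal:
  assumes P: "walk lattice_edges P" and w: "(x + 1, y) \<notin> set P"
  shows "right_steps P (x, y) = right_steps P (x + 1, y)"
proof -
  have "(x < fst a \<and> x < fst b \<and> {snd a, snd b} = {y, y + 1}) \<longleftrightarrow>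
        (x + 1 < fst a \<and> x + 1 < fst b \<and> {snd a, snd b} = {y, y + 1})"
    if ab: "(a, b) \<in> set (zip P (tl P))" for a b
  proof -
    have adj: "{a, b} \<in> lattice_edges" by (rule walk_zip[OF P ab])
    have "a \<noteq> (x + 1, y)" "b \<noteq> (x + 1, y)" using zip_tl_set[OF ab] w by auto
    then show ?thesis using adj by (elim lattice_step_cases; cases a; cases b) (auto simp: doubleton_eq_iff)
  qed
  then show ?thesis unfolding right_steps_def
    by (intro arg_cong[of _ _ length] filter_cong refl) auto
qed

text \<open>Between the two rays lies the half row \<open>A\<close>. The walk cannot enter or leave
  \<open>A\<close> at its left end, as this needs the excluded vertex, so every switch of
  \<open>A\<close> crosses exactly one of the two rays. Both ends of the walk lie outside
  \<open>A\<close>, hence the total is even.\<close>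

lemma right_steps_vertical:
  assumes P: "walk lattice_edges P" and w: "(x, y + 1) \<notin> set P"
    and "snd (hd P) \<le> y" "y + 1 < snd (last P)"
  shows "even (right_steps P (x, y)) \<longleftrightarrow> even (right_steps P (x, y + 1))"
proof -
  define A where "A = {z :: vertex. snd z = y + 1 \<and> x < fst z}"
  define Q where "Q = (\<lambda>y. \<lambda>(a, b). x < fst a \<and> x < fst b \<and> {snd a, snd b} = {y, y + 1 :: int})"
  let ?Z = "zip P (tl P)"
  have count: "length (filter Q1 zs) = length (filter Q2 zs) + length (filter Q3 zs)"
    if "\<And>z. z \<in> set zs \<Longrightarrow> (Q1 z \<longleftrightarrow> Q2 z \<or> Q3 z) \<and> \<not> (Q2 z \<and> Q3 z)" for zs and Q1 Q2 Q3 :: "'z \<Rightarrow> bool"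
    using that
  proof (induction zs)
    case (Cons z zs)
    have "length (filter Q1 zs) = length (filter Q2 zs) + length (filter Q3 zs)"
      by (rule Cons.IH, rule Cons.prems) simp
    moreover have "(Q1 z \<longleftrightarrow> Q2 z \<or> Q3 z) \<and> \<not> (Q2 z \<and> Q3 z)" by (rule Cons.prems) simp
    ultimately show ?case by auto
  qed simp
  have "switches A P = length (filter (Q y) ?Z) + length (filter (Q (y + 1)) ?Z)"
    unfolding switches_def
  proof (rule count)
    fix z assume z: "z \<in> set ?Z"
    obtain a b where ab: "z = (a, b)" by (cases z)
    have adj: "{a, b} \<in> lattice_edges" using walk_zip[OF P] z by (simp add: ab)
    have "a \<noteq> (x, y + 1)" "b \<noteq> (x, y + 1)" using zip_tl_set[of a b P] z w by (auto simp: ab)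
    then show "((case z of (a, b) \<Rightarrow> (a \<in> A) \<noteq> (b \<in> A)) \<longleftrightarrow> Q y z \<or> Q (y + 1) z) \<and> \<not> (Q y z \<and> Q (y + 1) z)"
      using adj unfolding ab A_def Q_def by (elim lattice_step_cases; cases a; cases b) (auto simp: doubleton_eq_iff)
  qed
  moreover have "right_steps P (x, y) = length (filter (Q y) ?Z)"
      "right_steps P (x, y + 1) = length (filter (Q (y + 1)) ?Z)"
    by (simp_all add: right_steps_def Q_def)
  moreover have "even (switches A P)"
    using even_switches[of P A] P assms(3,4) by (auto simp: walk_def A_def)
  ultimately show ?thesis by simp
qed

text \<open>Nothing of the walk lies to the left of \<open>v\<close> and it avoids \<open>v\<close>,
  so each passage between the heights \<open>snd v\<close> and \<open>snd v + 1\<close> crosses the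
  ray. The ends lie on different sides of that level.\<close>

lemma right_steps_left_end:
  assumes P: "walk lattice_edges P" and v: "v \<notin> set P" "\<forall>a\<in>set P. fst v \<le> fst a"
    and "snd (hd P) \<le> snd v" "snd v < snd (last P)"
  shows "odd (right_steps P v)"
proof -
  define A where "A = {z :: vertex. snd v < snd z}"
  have "switches A P = right_steps P v"
    unfolding switches_def right_steps_def
  proof (intro arg_cong[of _ _ length] filter_cong refl)
    fix z assume z: "z \<in> set (zip P (tl P))"
    obtain a b where ab: "z = (a, b)" by (cases z)
    have adj: "{a, b} \<in> lattice_edges" using walk_zip[OF P] z by (simp add: ab)
    have "a \<in> set P" "b \<in> set P" using zip_tl_set[of a b P] z by (auto simp: ab)
    then have "a \<noteq> v" "b \<noteq> v" "fst v \<le> fst a" "fst v \<le> fst b" using v by auto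
    then show "(case z of (a, b) \<Rightarrow> (a \<in> A) \<noteq> (b \<in> A)) =
       (case z of (a, b) \<Rightarrow> fst v < fst a \<and> fst v < fst b \<and> {snd a, snd b} = {snd v, snd v + 1})"
      using adj unfolding ab A_def by (elim lattice_step_cases; cases a; cases b; cases v) (auto simp: doubleton_eq_iff)
  qed
  moreover have "odd (switches A P)"
    using even_switches[of P A] P assms(4,5) by (auto simp: walk_def A_def)
  ultimately show ?thesis by simp
qed

lemma right_steps_right_end:
  assumes "\<forall>a\<in>set P. fst a \<le> fst v"
  shows "right_steps P v = 0"
proof -
  have "\<not> (fst v < fst a)" if "(a, b) \<in> set (zip P (tl P))" for a b
    using assms zip_tl_set[OF that] by force
  then show ?thesis unfolding right_steps_def by (auto simp: filter_empty_conv)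
qed

text \<open>The parity of the number of steps of \<open>P\<close> to the right of \<open>v\<close> does not change along a
  connection avoiding \<open>P\<close>.\<close>

lemma walk_separates:
  assumes P: "walk lattice_edges P" and bot: "snd (hd P) \<le> y0" and top: "h \<le> snd (last P)"
    and uv: "(u, v) \<in> reach (edges_in ({z. y0 \<le> snd z \<and> snd z \<le> h} - set P))"
    and u: "u \<notin> set P" "y0 \<le> snd u" "snd u \<le> h"
    and left: "\<forall>a\<in>set P. fst u \<le> fst a" and right: "\<forall>a\<in>set P. fst a \<le> fst v"
  shows False
proof -
  \<comment> \<open>One more step upwards makes the end strictly higher than the strip, as the
    vertical comparison requires for y + 1 = h; the added vertex is outside the strip and blocks
    nothing.\<close>
  define Q where "Q = P @ [(fst (last P), snd (last P) + 1)]"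
  have Q: "walk lattice_edges Q" "hd Q = hd P" "h < snd (last Q)"
    using P top by (auto simp: Q_def walk_def successively_append_iff lattice_edges_iff)
  have lastP: "last P \<in> set P" using P by (auto simp: walk_def)
  have notin: "z \<notin> set Q" if "z \<notin> set P" "snd z \<le> h" for z
    using that top by (auto simp: Q_def)
  have "even (right_steps Q v) \<longleftrightarrow> even (right_steps Q u)"
    using uv
  proof (induction rule: reach_induct)
    case base then show ?case ..
  next
    case (step a b)
    have ab: "a \<notin> set Q" "b \<notin> set Q" "y0 \<le> snd a" "y0 \<le> snd b" "snd a \<le> h" "snd b \<le> h" "{a, b} \<in> lattice_edges"
      using step(2) notin by (auto simp: edges_in_iff)
    obtain x y x' y' where xy: "a = (x, y)" "b = (x', y')" by (cases a; cases b)
    consider "x' = x + 1" "y' = y" | "x = x' + 1" "y' = y" | "x' = x" "y' = y + 1" | "x' = x" "y = y' + 1"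
      using ab(7) by (fastforce simp: lattice_edges_iff xy)
    then have "even (right_steps Q a) \<longleftrightarrow> even (right_steps Q b)"
    proof cases
      case 1 then show ?thesis using right_steps_horizontal[OF Q(1), of x y] ab xy by simp
    next
      case 2 then show ?thesis using right_steps_horizontal[OF Q(1), of x' y] ab xy by simp
    next
      case 3 then show ?thesis using right_steps_vertical[OF Q(1), of x y] Q ab xy bot by simp
    next
      case 4 then show ?thesis using right_steps_vertical[OF Q(1), of x y'] Q ab xy bot by simp
    qed
    then show ?case using step by simp
  qed
  moreover have "odd (right_steps Q u)"
    by (rule right_steps_left_end[OF Q(1)]) (use notin u left lastP Q bot in \<open>auto simp: Q_def\<close>)
  moreover have "right_steps Q v = 0"
    by (rule right_steps_right_end) (use right lastP in \<open>auto simp: Q_def\<close>)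
  ultimately show False by simp
qed

lemma reach_first_hit:
  assumes "(u, v) \<in> reach \<omega>" "u \<notin> Z"
  shows "(u, v) \<in> reach {e \<in> \<omega>. e \<inter> Z = {}} \<or>
    (\<exists>a b. (u, a) \<in> reach {e \<in> \<omega>. e \<inter> Z = {}} \<and> a \<notin> Z \<and> {a, b} \<in> \<omega> \<and> b \<in> Z)"
proof -
  have "((u, v) \<in> reach {e \<in> \<omega>. e \<inter> Z = {}} \<and> v \<notin> Z) \<or>
    (\<exists>a b. (u, a) \<in> reach {e \<in> \<omega>. e \<inter> Z = {}} \<and> a \<notin> Z \<and> {a, b} \<in> \<omega> \<and> b \<in> Z)"
    using assms(1)
  proof (induction rule: reach_induct)
    case (step x y)
    show ?case
    proof (cases "y \<in> Z")
      case False
      then show ?thesis using step reach_step[of x y "{e \<in> \<omega>. e \<inter> Z = {}}"] by (auto intro: reach_trans)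
    qed (use step in blast)
  qed (use assms(2) in simp)
  then show ?thesis by blast
qed

text \<open>A connection that avoided the walk altogether is impossible by
  \<open>walk_separates\<close>; stopping at the first visited vertex of the walk gives the common
  vertex.\<close>

lemma reach_meets_walk:
  assumes P: "walk lattice_edges P" and bot: "snd (hd P) \<le> y0" and top: "h \<le> snd (last P)"
    and uv: "(u, v) \<in> reach \<omega>" and \<omega>: "\<omega> \<subseteq> edges_in {z. y0 \<le> snd z \<and> snd z \<le> h}"
    and u: "y0 \<le> snd u" "snd u \<le> h"
    and left: "\<forall>a\<in>set P. fst u \<le> fst a" and right: "\<forall>a\<in>set P. fst a \<le> fst v"
  obtains z where "z \<in> set P" "(u, z) \<in> reach \<omega>"
proof (cases "u \<in> set P")
  case True
  then show ?thesis using that[of u] by simp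
next
  case False
  have "(u, v) \<notin> reach {e \<in> \<omega>. e \<inter> set P = {}}"
  proof
    assume "(u, v) \<in> reach {e \<in> \<omega>. e \<inter> set P = {}}"
    moreover have "{e \<in> \<omega>. e \<inter> set P = {}} \<subseteq> edges_in ({z. y0 \<le> snd z \<and> snd z \<le> h} - set P)"
      using \<omega> unfolding edges_in_def by blast
    ultimately show False using walk_separates[OF P bot top _ False u left right] reach_mono by blast
  qed
  then obtain a b where "(u, a) \<in> reach {e \<in> \<omega>. e \<inter> set P = {}}" "{a, b} \<in> \<omega>" "b \<in> set P"
    using reach_first_hit[OF uv False] by blast
  moreover from this have "(u, a) \<in> reach \<omega>" using reach_mono[of "{e \<in> \<omega>. e \<inter> set P = {}}" \<omega>] by blast
  ultimately show ?thesis using that reach_trans reach_step by blast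
qed

section \<open>Planar duality\<close>

text \<open>The dual vertex \<open>f\<close> is the unit square with lower left corner \<open>f\<close>; the dual edge \<open>e\<close>
  crosses the primal edge \<open>star e\<close>.\<close>

definition star :: "edge \<Rightarrow> edge" where
  "star e = {v. \<forall>f\<in>e. fst v - fst f \<in> {0, 1} \<and> snd v - snd f \<in> {0, 1}}"

definition dual_config :: "edge set \<Rightarrow> edge set" where
  "dual_config \<omega> = {e \<in> lattice_edges. star e \<notin> \<omega>}"

text \<open>The midpoint in doubled coordinates. For a lattice edge exactly one coordinate is odd,
  and it determines the edge.\<close>

definition mid :: "vertex \<Rightarrow> vertex \<Rightarrow> vertex" where
  "mid a b = (fst a + fst b, snd a + snd b)"

lemma star_horizontal: "star {(x - 1, y), (x, y)} = {(x, y), (x, y + 1)}"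
  by (auto simp: star_def)

lemma star_vertical: "star {(x, y - 1), (x, y)} = {(x, y), (x + 1, y)}"
  by (auto simp: star_def)

lemma lattice_edge_cases:
  assumes "e \<in> lattice_edges"
  obtains x y where "e = {(x - 1, y), (x, y)}" | x y where "e = {(x, y - 1), (x, y)}"
proof -
  obtain u v where uv: "e = {u, v}" "\<bar>fst u - fst v\<bar> + \<bar>snd u - snd v\<bar> = 1"
    using assms by (elim lattice_edgeE)
  then consider "fst u = fst v - 1 \<and> snd u = snd v" | "fst v = fst u - 1 \<and> snd v = snd u"
    | "snd u = snd v - 1 \<and> fst u = fst v" | "snd v = snd u - 1 \<and> fst v = fst u" by linarith
  then show ?thesis
  proof cases
    case 1
    then have "e = {(fst v - 1, snd v), (fst v, snd v)}" unfolding uv(1) by (metis prod.collapse)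
    then show ?thesis by (rule that(1))
  next
    case 2
    then have "e = {(fst u - 1, snd u), (fst u, snd u)}" unfolding uv(1) by (metis prod.collapse insert_commute)
    then show ?thesis by (rule that(1))
  next
    case 3
    then have "e = {(fst v, snd v - 1), (fst v, snd v)}" unfolding uv(1) by (metis prod.collapse)
    then show ?thesis by (rule that(2))
  next
    case 4
    then have "e = {(fst u, snd u - 1), (fst u, snd u)}" unfolding uv(1) by (metis prod.collapse insert_commute)
    then show ?thesis by (rule that(2))
  qed
qed

text \<open>The bidual lattice is the lattice translated by (1, 1); this gives the injectivity of
  \<open>star\<close>.\<close>

lemma star_star:
  assumes "e \<in> lattice_edges" shows "(\<lambda>v. (fst v - 1, snd v - 1)) ` star (star e) = e"
  using assms
proof (elim lattice_edge_cases)
  fix x y assume e: "e = {(x - 1, y), (x, y)}"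
  have "star (star e) = {(x, y + 1), (x + 1, y + 1)}"
    using star_vertical[of x "y + 1"] unfolding e star_horizontal by simp
  then show ?thesis by (auto simp: e)
next
  fix x y assume e: "e = {(x, y - 1), (x, y)}"
  have "star (star e) = {(x + 1, y), (x + 1, y + 1)}"
    using star_horizontal[of "x + 1" y] unfolding e star_vertical by simp
  then show ?thesis by (auto simp: e)
qed

lemma inj_on_star: "E \<subseteq> lattice_edges \<Longrightarrow> inj_on star E"
  by (rule inj_onI) (metis star_star subsetD)

lemma mid_cases:
  assumes "{a, b} \<in> lattice_edges"
  obtains x y where "{a, b} = {(x - 1, y), (x, y)}" "mid a b = (2 * x - 1, 2 * y)"
    | x y where "{a, b} = {(x, y - 1), (x, y)}" "mid a b = (2 * x, 2 * y - 1)"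
  using assms
proof (elim lattice_edge_cases)
  fix x y assume "{a, b} = {(x - 1, y), (x, y)}"
  then show ?thesis by (intro that(1)) (auto simp: doubleton_eq_iff mid_def)
next
  fix x y assume "{a, b} = {(x, y - 1), (x, y)}"
  then show ?thesis by (intro that(2)) (auto simp: doubleton_eq_iff mid_def)
qed

lemma star_mid:
  assumes "{f, g} \<in> lattice_edges" "{a, b} \<in> lattice_edges" "mid a b = mid f g + (1, 1)"
  shows "star {f, g} = {a, b}"
  using assms(1)
proof (cases rule: mid_cases)
  case (1 x y)
  note fg = 1
  show ?thesis using assms(2)
  proof (cases rule: mid_cases)
    case (1 x' y')
    then show ?thesis using fg assms(3) by simp presburger
  next
    case (2 x' y')
    then have "x' = x" "y' = y + 1" using fg assms(3) by simp_all
    then show ?thesis using 2 fg by (simp add: star_horizontal)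
  qed
next
  case (2 x y)
  note fg = 2
  show ?thesis using assms(2)
  proof (cases rule: mid_cases)
    case (1 x' y')
    then have "x' = x + 1" "y' = y" using fg assms(3) by simp_all
    then show ?thesis using 1 fg by (simp add: star_vertical)
  next
    case (2 x' y')
    then show ?thesis using fg assms(3) by simp presburger
  qed
qed

text \<open>The map \<open>star\<close> only relabels edges, and taking complements preserves the
  measure at bias 1/2, so the dual configuration is again critical percolation.\<close>

lemma pexp_dual:
  assumes "finite E" "finite \<Phi>" "star ` edges_in \<Phi> \<subseteq> E"
    and F: "\<And>\<omega>. F \<omega> = F (\<omega> \<inter> edges_in \<Phi>)"
  shows "pexp (1/2) E (\<lambda>\<omega>. F (dual_config \<omega>)) = pexp (1/2) (edges_in \<Phi>) F"
proof -
  let ?\<Phi> = "edges_in \<Phi>"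
  have inj: "inj_on star ?\<Phi>" by (rule inj_on_star[OF edges_in_lattice])
  have "pexp (1/2) E (\<lambda>\<omega>. F (dual_config \<omega>)) = pexp (1/2) (star ` ?\<Phi>) (\<lambda>\<omega>. F (dual_config \<omega>))"
  proof (rule pexp_restrict[OF assms(1,3)])
    fix \<omega>
    have "dual_config \<omega> \<inter> ?\<Phi> = dual_config (\<omega> \<inter> star ` ?\<Phi>) \<inter> ?\<Phi>" by (auto simp: dual_config_def)
    then show "F (dual_config \<omega>) = F (dual_config (\<omega> \<inter> star ` ?\<Phi>))" using F by metis
  qed
  also have "\<dots> = pexp (1/2) ?\<Phi> (\<lambda>\<omega>. F (dual_config (star ` \<omega>)))" by (rule pexp_image[OF inj])
  also have "\<dots> = pexp (1/2) ?\<Phi> (\<lambda>\<omega>. F (?\<Phi> - \<omega>))"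
  proof (intro pexp_cong refl)
    fix \<omega> assume "\<omega> \<subseteq> ?\<Phi>"
    then have "dual_config (star ` \<omega>) \<inter> ?\<Phi> = ?\<Phi> - \<omega>"
      using edges_in_lattice by (auto simp: dual_config_def dest!: inj_onD[OF inj])
    then show "F (dual_config (star ` \<omega>)) = F (?\<Phi> - \<omega>)" using F by metis
  qed
  also have "\<dots> = pexp (1/2) ?\<Phi> F" by (rule pexp_half_compl)
  finally show ?thesis .
qed

definition dbl :: "vertex \<Rightarrow> vertex" where "dbl v = (2 * fst v, 2 * snd v)"
definition dbl_face :: "vertex \<Rightarrow> vertex" where "dbl_face f = (2 * fst f + 1, 2 * snd f + 1)"

text \<open>Primal and dual connections are compared on the lattice of half the mesh, where the two
  edges \<open>e\<close> and \<open>star e\<close> share their midpoint.\<close>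

definition primal_trace :: "vertex set \<Rightarrow> edge set \<Rightarrow> vertex set" where
  "primal_trace U \<omega> = dbl ` U \<union> {mid a b | a b. {a, b} \<in> \<omega> \<and> a \<in> U \<and> b \<in> U}"

definition dual_trace :: "vertex set \<Rightarrow> edge set \<Rightarrow> vertex set" where
  "dual_trace U \<omega> = dbl_face ` U \<union> {mid f g + (1, 1) | f g. {f, g} \<in> \<omega> \<and> f \<in> U \<and> g \<in> U}"

lemma reach_primal_trace:
  assumes "(u, v) \<in> reach \<omega>" "\<omega> \<subseteq> edges_in U" "u \<in> U"
  shows "(dbl u, dbl v) \<in> reach (edges_in (primal_trace U \<omega>))"
  using assms(1)
proof (induction rule: reach_induct)
  case (step x y)
  have xy: "x \<in> U" "y \<in> U" "\<bar>fst x - fst y\<bar> + \<bar>snd x - snd y\<bar> = 1"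
    using step(2) assms(2) by (auto simp: edges_in_iff lattice_edges_iff)
  have "dbl x \<in> primal_trace U \<omega>" "dbl y \<in> primal_trace U \<omega>" "mid x y \<in> primal_trace U \<omega>"
    using xy step(2) unfolding primal_trace_def by blast+
  moreover have "{dbl x, mid x y} \<in> lattice_edges" "{mid x y, dbl y} \<in> lattice_edges"
    using xy(3) by (auto simp: lattice_edges_iff dbl_def mid_def)
  ultimately have "(dbl x, dbl y) \<in> reach (edges_in (primal_trace U \<omega>))"
    by (meson edges_in_iff reach_step reach_trans)
  then show ?case using step reach_trans by blast
qed simp

lemma reach_dual_trace:
  assumes "(u, v) \<in> reach \<omega>" "\<omega> \<subseteq> edges_in U" "u \<in> U"
  shows "(dbl_face u, dbl_face v) \<in> reach (edges_in (dual_trace U \<omega>))"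
  using assms(1)
proof (induction rule: reach_induct)
  case (step x y)
  have xy: "x \<in> U" "y \<in> U" "\<bar>fst x - fst y\<bar> + \<bar>snd x - snd y\<bar> = 1"
    using step(2) assms(2) by (auto simp: edges_in_iff lattice_edges_iff)
  have "dbl_face x \<in> dual_trace U \<omega>" "dbl_face y \<in> dual_trace U \<omega>" "mid x y + (1, 1) \<in> dual_trace U \<omega>"
    using xy step(2) unfolding dual_trace_def by blast+
  moreover have "{dbl_face x, mid x y + (1, 1)} \<in> lattice_edges" "{mid x y + (1, 1), dbl_face y} \<in> lattice_edges"
    using xy(3) by (auto simp: lattice_edges_iff dbl_face_def mid_def)
  ultimately have "(dbl_face x, dbl_face y) \<in> reach (edges_in (dual_trace U \<omega>))"
    by (meson edges_in_iff reach_step reach_trans)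
  then show ?case using step reach_trans by blast
qed simp

text \<open>Parities of coordinates tell vertices (even, even), faces (odd, odd) and midpoints
  (mixed) apart. Two midpoints coincide only for an edge and its dual, which are never both
  present.\<close>

lemma traces_disjoint:
  assumes "\<omega> \<subseteq> lattice_edges"
  shows "primal_trace U \<omega> \<inter> dual_trace V (dual_config \<omega> \<inter> \<Psi>) = {}"
proof -
  have 1: "dbl u \<noteq> dbl_face f" for u f
    by (auto simp: dbl_def dbl_face_def) presburger
  have 2: "dbl u \<noteq> mid f g + (1, 1)" if "{f, g} \<in> lattice_edges" for u f g
    using that by (auto simp: dbl_def mid_def lattice_edges_iff) presburger
  have 3: "mid a b \<noteq> dbl_face f" if "{a, b} \<in> lattice_edges" for a b f
    using that by (auto simp: dbl_face_def mid_def lattice_edges_iff) presburger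
  have 4: "mid a b \<noteq> mid f g + (1, 1)" if "{a, b} \<in> \<omega>" "{f, g} \<in> dual_config \<omega>" for a b f g
    using that assms star_mid[of f g a b] by (auto simp: dual_config_def)
  have 5: "{f, g} \<in> dual_config \<omega> \<Longrightarrow> {f, g} \<in> lattice_edges" for f g by (simp add: dual_config_def)
  show ?thesis
  proof (intro equals0I)
    fix z assume "z \<in> primal_trace U \<omega> \<inter> dual_trace V (dual_config \<omega> \<inter> \<Psi>)"
    then show False unfolding primal_trace_def dual_trace_def using 1 2 3 4 5 assms by blast
  qed
qed

section \<open>Either a primal vertical or a dual horizontal crossing\<close>

definition rect :: "int \<Rightarrow> int \<Rightarrow> int \<Rightarrow> int \<Rightarrow> vertex set" where
  "rect a b c d = {a..b} \<times> {c..d}"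

lemma mem_rect: "v \<in> rect a b c d \<longleftrightarrow> a \<le> fst v \<and> fst v \<le> b \<and> c \<le> snd v \<and> snd v \<le> d"
  by (cases v) (auto simp: rect_def)

lemma finite_rect [simp]: "finite (rect a b c d)"
  by (simp add: rect_def)

abbreviation "hcross a b c d \<equiv> crossing (rect a b c d) {v. fst v = a} {v. fst v = b}"
abbreviation "vcross a b c d \<equiv> crossing (rect a b c d) {v. snd v = c} {v. snd v = d}"

text \<open>In doubled coordinates the two crossings have disjoint traces. The face columns -1 and w
  stick out on both sides of the rectangle, so the dual connection starts to the left of the primal
  walk and ends to its right, against \<open>walk_separates\<close>.\<close>

lemma primal_dual_exclusive:
  assumes "vcross 0 w 0 h \<omega>" "hcross (-1) w 0 (h - 1) (dual_config \<omega>)"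
  shows False
proof -
  let ?R = "rect 0 w 0 h" and ?\<Phi> = "rect (-1) w 0 (h - 1)"
  let ?\<omega> = "\<omega> \<inter> edges_in ?R"
  obtain a b where ab: "a \<in> ?R" "b \<in> ?R" "snd a = 0" "snd b = h" "(a, b) \<in> reach ?\<omega>"
    using assms(1) by (auto simp: crossing_def)
  have dc: "dual_config \<omega> \<subseteq> dual_config ?\<omega>" by (auto simp: dual_config_def)
  obtain f g where fg: "f \<in> ?\<Phi>" "g \<in> ?\<Phi>" "fst f = -1" "fst g = w" "(f, g) \<in> reach (dual_config ?\<omega> \<inter> edges_in ?\<Phi>)"
    using crossing_mono[OF dc assms(2)] unfolding crossing_def by blast
  let ?X = "primal_trace ?R ?\<omega>" and ?Y = "dual_trace ?\<Phi> (dual_config ?\<omega> \<inter> edges_in ?\<Phi>)"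
  have disj: "?X \<inter> ?Y = {}" using traces_disjoint[of ?\<omega>] edges_in_lattice by blast
  have "(dbl a, dbl b) \<in> reach (edges_in ?X)" using reach_primal_trace[OF ab(5)] ab by simp
  then obtain P where P: "walk (edges_in ?X) P" "hd P = dbl a" "last P = dbl b" "\<And>z. z \<in> set P \<Longrightarrow> (dbl a, z) \<in> reach (edges_in ?X)"
    by (rule reach_walk) blast
  have PX: "z \<in> ?X" if "z \<in> set P" for z
    using P(4)[OF that] reach_edges_in_closed[of "dbl a" z "edges_in ?X" ?X] ab by (auto simp: primal_trace_def)
  have Xr: "0 \<le> fst z \<and> fst z \<le> 2 * w" if "z \<in> ?X" for z
    using that by (auto simp: primal_trace_def dbl_def mid_def mem_rect)
  have Yr: "0 \<le> snd z \<and> snd z \<le> 2 * h" if "z \<in> ?Y" for z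
    using that by (auto simp: dual_trace_def dbl_face_def mid_def mem_rect)
  have fY: "dbl_face f \<in> ?Y" using fg by (auto simp: dual_trace_def)
  have "(dbl_face f, dbl_face g) \<in> reach (edges_in ?Y)" using reach_dual_trace[OF fg(5)] fg by simp
  moreover have "edges_in ?Y \<subseteq> edges_in ({z. 0 \<le> snd z \<and> snd z \<le> 2 * h} - set P)"
  proof (intro edges_in_mono subsetI)
    fix z assume z: "z \<in> ?Y"
    then show "z \<in> {z. 0 \<le> snd z \<and> snd z \<le> 2 * h} - set P" using Yr[OF z] PX disj by blast
  qed
  ultimately have fgr: "(dbl_face f, dbl_face g) \<in> reach (edges_in ({z. 0 \<le> snd z \<and> snd z \<le> 2 * h} - set P))"
    using reach_mono by blast
  have wP: "walk lattice_edges P"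
    using P(1) unfolding walk_def by (auto intro: successively_mono simp: edges_in_def)
  have l: "\<forall>z\<in>set P. fst (dbl_face f) \<le> fst z" "\<forall>z\<in>set P. fst z \<le> fst (dbl_face g)"
  proof (intro ballI)
    fix z assume z: "z \<in> set P"
    show "fst (dbl_face f) \<le> fst z" using Xr[OF PX[OF z]] fg(3) by (simp add: dbl_face_def)
  next
    show "\<forall>z\<in>set P. fst z \<le> fst (dbl_face g)"
    proof
      fix z assume z: "z \<in> set P"
      show "fst z \<le> fst (dbl_face g)" using Xr[OF PX[OF z]] fg(4) by (simp add: dbl_face_def)
    qed
  qed
  show False
  proof (rule walk_separates[OF wP _ _ fgr _ _ _ l])
    show "snd (hd P) \<le> 0" "2 * h \<le> snd (last P)" using ab(3,4) by (simp_all add: dbl_def P(2,3))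
    show "dbl_face f \<notin> set P" using PX[of "dbl_face f"] fY disj by blast
    show "0 \<le> snd (dbl_face f)" "snd (dbl_face f) \<le> 2 * h" using fg(1) by (auto simp: dbl_face_def mem_rect)
  qed
qed

lemma even_telescope:
  fixes d :: "nat \<Rightarrow> bool"
  shows "even (\<Sum>i\<le>n. of_bool (d i \<noteq> d (Suc i)) :: nat) \<longleftrightarrow> d 0 = d (Suc n)"
proof (induction n)
  case 0
  show ?case by (cases "d 0"; cases "d (Suc 0)") (simp_all del: sum_of_bool_eq)
next
  case (Suc n)
  then show ?case by (cases "d 0"; cases "d (Suc n)"; cases "d (Suc (Suc n))") (simp_all del: sum_of_bool_eq)
qed

lemma even_sum_xor:
  assumes "finite I"
  shows "even ((\<Sum>i\<in>I. of_bool (P i)) + (\<Sum>i\<in>I. of_bool (Q i)) :: nat) \<longleftrightarrow> even (\<Sum>i\<in>I. of_bool (P i \<noteq> Q i) :: nat)"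
  using assms
proof (induction I rule: finite_induct)
  case (insert i I)
  then show ?case by (cases "P i"; cases "Q i") (simp_all del: sum_of_bool_eq)
qed simp

text \<open>If the dual cluster \<open>D\<close> of the left side misses the right side, the number of edges between
  consecutive rows that lie on the boundary of \<open>D\<close> and are connected to the bottom is odd in every row.\<close>

lemma primal_dual_exhaustive:
  fixes w h :: nat
  assumes h: "h \<ge> 1" and nc: "\<not> hcross (-1) (int w) 0 (int h - 1) (dual_config \<omega>)"
  shows "vcross 0 (int w) 0 (int h) \<omega>"
proof -
  let ?R = "rect 0 w 0 h" and ?\<Phi> = "rect (-1) w 0 (int h - 1)"
  define D where "D = (\<lambda>x y. (x, y) \<in> cluster ?\<Phi> {v. fst v = -1} (dual_config \<omega>))"
  define C where "C = (\<lambda>x y. \<exists>a\<in>?R. snd a = 0 \<and> (a, (x, y)) \<in> reach (\<omega> \<inter> edges_in ?R))"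
  have Dleft: "D (-1) y" if "0 \<le> y" "y < int h" for y
    unfolding D_def cluster_def using that by (auto simp: mem_rect intro!: bexI[of _ "(-1, y)"])
  have Dright: "\<not> D (int w) y" if "0 \<le> y" "y < int h" for y
  proof
    assume "D (int w) y"
    then obtain a where "a \<in> ?\<Phi>" "fst a = -1" "(a, (int w, y)) \<in> reach (dual_config \<omega> \<inter> edges_in ?\<Phi>)"
      by (auto simp: D_def cluster_def)
    moreover have "(int w, y) \<in> ?\<Phi>" using that by (simp add: mem_rect)
    ultimately show False using nc unfolding crossing_def by fastforce
  qed
  \<comment> \<open>A dual edge leaving \<open>D\<close> cannot be present in the dual
    configuration, so the primal edge it crosses is present. Consequently \<open>C\<close> takes the
    same value at both ends of every boundary edge.\<close>
  have Dstep: "star {f, g} \<in> \<omega>" if "{f, g} \<in> lattice_edges" "f \<in> ?\<Phi>" "g \<in> ?\<Phi>"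
     "D (fst f) (snd f) \<noteq> D (fst g) (snd g)" for f g
  proof (rule ccontr)
    assume "star {f, g} \<notin> \<omega>"
    then have "{f, g} \<in> dual_config \<omega> \<inter> edges_in ?\<Phi>" using that by (auto simp: dual_config_def edges_in_iff)
    then have "(f, g) \<in> reach (dual_config \<omega> \<inter> edges_in ?\<Phi>)" "(g, f) \<in> reach (dual_config \<omega> \<inter> edges_in ?\<Phi>)"
      by (auto intro: reach_step simp: insert_commute)
    then show False using that(4) unfolding D_def cluster_def prod.collapse using reach_trans by blast
  qed
  have Cstep: "C x y \<longleftrightarrow> C x' y'" if "{(x, y), (x', y')} \<in> \<omega> \<inter> edges_in ?R" for x y x' y'
  proof -
    have "((x, y), (x', y')) \<in> reach (\<omega> \<inter> edges_in ?R)" using that by (rule reach_step)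
    moreover from this have "((x', y'), (x, y)) \<in> reach (\<omega> \<inter> edges_in ?R)" by (rule reach_sym)
    ultimately show ?thesis unfolding C_def using reach_trans by blast
  qed
  have bv: "C x y \<longleftrightarrow> C x (y + 1)"
    if "0 \<le> x" "x \<le> int w" "0 \<le> y" "y < int h" "D (x - 1) y \<noteq> D x y" for x y
    using Dstep[of "(x - 1, y)" "(x, y)"] that unfolding star_horizontal
    by (intro Cstep) (auto simp: mem_rect edges_in_iff lattice_edges_iff)
  have bh: "C x y \<longleftrightarrow> C (x + 1) y"
    if "0 \<le> x" "x < int w" "0 < y" "y < int h" "D x (y - 1) \<noteq> D x y" for x y
    using Dstep[of "(x, y - 1)" "(x, y)"] that unfolding star_vertical
    by (intro Cstep) (auto simp: mem_rect edges_in_iff lattice_edges_iff)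
  \<comment> \<open>The vertical edges from height y to y + 1 that separate \<open>D\<close> from
    its complement and belong to clusters touching the bottom.\<close>
  define N where "N = (\<lambda>y. \<Sum>i\<le>w. of_bool (D (int i - 1) y \<noteq> D (int i) y \<and> C (int i) y) :: nat)"
  have N: "odd (N (int j))" if "j < h" for j
    using that
  proof (induction j)
    case 0
    have "C (int i) 0" if "i \<le> w" for i
      using that unfolding C_def by (auto simp: mem_rect intro!: bexI[of _ "(int i, 0)"])
    then have "N 0 = (\<Sum>i\<le>w. of_bool ((\<lambda>i. D (int i - 1) 0) i \<noteq> (\<lambda>i. D (int i - 1) 0) (Suc i)))"
      unfolding N_def by (intro sum.cong refl) auto
    then have "even (N 0) \<longleftrightarrow> D (-1) 0 = D (int w) 0" using even_telescope[of "\<lambda>i. D (int i - 1) 0" w] by simp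
    then show ?case using Dleft[of 0] Dright[of 0] h by simp
  next
    case (Suc j)
    define y where "y = int (Suc j)"
    have y: "0 < y" "y < int h" "y - 1 = int j" using Suc.prems by (auto simp: y_def)
    \<comment> \<open>\<open>\<beta> x\<close> says that the horizontal edge from (x, y) to (x + 1,
      y) is a boundary edge of \<open>D\<close>.\<close>
    define \<beta> where "\<beta> = (\<lambda>x. D x (y - 1) \<noteq> D x y)"
    \<comment> \<open>Column -1 lies inside \<open>D\<close> and column w outside it, so there are
      no such edges at the two ends and the telescoping sum has no boundary terms.\<close>
    have b0: "\<not> \<beta> (-1)" "\<not> \<beta> (int w)" using Dleft[of y] Dleft[of "y - 1"] Dright[of y] Dright[of "y - 1"] y by (auto simp: \<beta>_def)
    define d where "d = (\<lambda>i. \<beta> (int i - 1) \<and> C (int i - 1) y)"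
    define P1 where "P1 = (\<lambda>i. D (int i - 1) (y - 1) \<noteq> D (int i) (y - 1) \<and> C (int i) y)"
    define P2 where "P2 = (\<lambda>i. D (int i - 1) y \<noteq> D (int i) y \<and> C (int i) y)"
    have Ny: "N y = (\<Sum>i\<le>w. of_bool (P2 i))" by (simp add: N_def P2_def del: sum_of_bool_eq)
    have Ny1: "N (y - 1) = (\<Sum>i\<le>w. of_bool (P1 i))"
      unfolding N_def P1_def
    proof (intro sum.cong refl arg_cong[of _ _ of_bool])
      fix i assume i: "i \<in> {..w}"
      have "C (int i) (y - 1) \<longleftrightarrow> C (int i) y" if "D (int i - 1) (y - 1) \<noteq> D (int i) (y - 1)"
        using bv[of "int i" "y - 1", unfolded diff_add_cancel] that i y(1,2) by simp
      then show "(D (int i - 1) (y - 1) \<noteq> D (int i) (y - 1) \<and> C (int i) (y - 1))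
         = (D (int i - 1) (y - 1) \<noteq> D (int i) (y - 1) \<and> C (int i) y)" by blast
    qed
    \<comment> \<open>Going around the vertex (i, y) through its four faces, membership in
      \<open>D\<close> changes an even number of times. \<open>P1\<close> and \<open>P2\<close> are
      the changes below and above it, \<open>d i\<close> and \<open>d (Suc i)\<close> those on its
      left and right.\<close>
    have PP: "(P1 i \<noteq> P2 i) = (d i \<noteq> d (Suc i))" if i: "i \<le> w" for i
    proof -
      have 1: "d i \<longleftrightarrow> \<beta> (int i - 1) \<and> C (int i) y"
      proof (cases i)
        case 0 then show ?thesis using b0 by (simp add: d_def)
      next
        case (Suc i')
        have "C (int i') y \<longleftrightarrow> C (int i' + 1) y" if "\<beta> (int i')"
          using bh[of "int i'" y] that i y(1,2) Suc unfolding \<beta>_def by simp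
        then show ?thesis unfolding d_def Suc by (auto simp: add.commute)
      qed
      have 2: "d (Suc i) \<longleftrightarrow> \<beta> (int i) \<and> C (int i) y" by (simp add: d_def)
      show ?thesis unfolding 1 2 P1_def P2_def \<beta>_def by blast
    qed
    have "even (N (y - 1) + N y) \<longleftrightarrow> even (\<Sum>i\<le>w. of_bool (P1 i \<noteq> P2 i) :: nat)"
      unfolding Ny1 Ny by (rule even_sum_xor) simp
    also have "(\<Sum>i\<le>w. of_bool (P1 i \<noteq> P2 i) :: nat) = (\<Sum>i\<le>w. of_bool (d i \<noteq> d (Suc i)))"
      using PP by (intro sum.cong refl arg_cong[of _ _ of_bool]) auto
    also have "even \<dots> \<longleftrightarrow> d 0 = d (Suc w)" by (rule even_telescope)
    finally have "even (N (y - 1) + N y)" using b0 by (simp add: d_def)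
    then show ?case using Suc y by (simp add: y_def)
  qed
  have "odd (N (int h - 1))" using N[of "h - 1"] h by (simp add: of_nat_diff)
  then have "N (int h - 1) \<noteq> 0" by (metis even_zero)
  then obtain i where i: "i \<le> w" "D (int i - 1) (int h - 1) \<noteq> D (int i) (int h - 1)" "C (int i) (int h - 1)"
    unfolding N_def by (auto simp: sum_eq_0_iff simp del: sum_of_bool_eq)
  then have "C (int i) (int h)" using bv[of "int i" "int h - 1", unfolded diff_add_cancel] h by simp
  then obtain a where a: "a \<in> ?R" "snd a = 0" "(a, (int i, int h)) \<in> reach (\<omega> \<inter> edges_in ?R)"
    unfolding C_def by blast
  have "(int i, int h) \<in> {v. snd v = int h} \<inter> ?R" using i by (simp add: mem_rect)
  then show ?thesis using a unfolding crossing_def by blast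
qed

section \<open>Crossing probabilities and duality\<close>

text \<open>Cut out the piece from a last visit at height \<open>lo\<close> to the next arrival at
  height \<open>hi\<close>; it never leaves the band.\<close>

lemma reach_band:
  assumes l: "lipschitz1 l" and uv: "(u, v) \<in> reach (\<omega> \<inter> edges_in \<Lambda>)" "u \<in> \<Lambda>"
    and le: "l u \<le> lo" "lo \<le> hi" "hi \<le> l v"
  obtains a b where "a \<in> \<Lambda>" "b \<in> \<Lambda>" "l a = lo" "l b = hi"
    "(a, b) \<in> reach (\<omega> \<inter> edges_in (\<Lambda> \<inter> {z. lo \<le> l z \<and> l z \<le> hi}))"
proof -
  let ?\<Lambda> = "\<Lambda> \<inter> {z. lo \<le> l z \<and> l z \<le> hi}"
  let ?R = "reach (\<omega> \<inter> edges_in ?\<Lambda>)"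
  let ?done = "\<exists>a b. a \<in> \<Lambda> \<and> b \<in> \<Lambda> \<and> l a = lo \<and> l b = hi \<and> (a, b) \<in> ?R"
  \<comment> \<open>Invariant along the connection: the piece has been found, or the current vertex
    is below the band, or it is below \<open>hi\<close> and joined inside the band to a vertex of
    height \<open>lo\<close>.\<close>
  have "?done \<or> l v < lo \<or> (\<exists>a. a \<in> \<Lambda> \<and> l a = lo \<and> (a, v) \<in> ?R \<and> lo \<le> l v \<and> l v < hi)"
    using uv(1)
  proof (induction rule: reach_induct)
    case base
    consider "l u < lo" | "l u = lo" "lo = hi" | "l u = lo" "lo < hi" using le by linarith
    then show ?case
    proof cases
      case 2
      then have "u \<in> \<Lambda> \<and> u \<in> \<Lambda> \<and> l u = lo \<and> l u = hi \<and> (u, u) \<in> ?R" using uv(2) by simp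
      then show ?thesis by blast
    next
      case 3
      then have "u \<in> \<Lambda> \<and> l u = lo \<and> (u, u) \<in> ?R \<and> lo \<le> l u \<and> l u < hi" using uv(2) by simp
      then show ?thesis by blast
    qed blast
  next
    case (step x y)
    have xy: "x \<in> \<Lambda>" "y \<in> \<Lambda>" "{x, y} \<in> lattice_edges" "{x, y} \<in> \<omega>" using step(2) by (auto simp: edges_in_iff)
    have d: "\<bar>l x - l y\<bar> \<le> 1" using l xy(3) unfolding lipschitz1_def by blast
    consider ?done | "l x < lo" | a where "a \<in> \<Lambda>" "l a = lo" "(a, x) \<in> ?R" "lo \<le> l x" "l x < hi"
      using step(3) by blast
    then show ?case
    proof cases
      case 1 then show ?thesis by blast
    next
      case 2
      consider "l y < lo" | "l y = lo" "lo < hi" | "l y = lo" "lo = hi" using 2 d le(2) by linarith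
      then show ?thesis
      proof cases
        case 2
        then have "y \<in> \<Lambda> \<and> l y = lo \<and> (y, y) \<in> ?R \<and> lo \<le> l y \<and> l y < hi" using xy by simp
        then show ?thesis by blast
      next
        case 3
        then have "y \<in> \<Lambda> \<and> y \<in> \<Lambda> \<and> l y = lo \<and> l y = hi \<and> (y, y) \<in> ?R" using xy by simp
        then show ?thesis by blast
      qed blast
    next
      case (3 a)
      show ?thesis
      proof (cases "l y < lo")
        case False
        have "l y \<le> hi" using d 3 by linarith
        then have "{x, y} \<in> \<omega> \<inter> edges_in ?\<Lambda>" using xy 3 False by (simp add: edges_in_iff)
        then have ay: "(a, y) \<in> ?R" using 3 reach_step reach_trans by blast
        show ?thesis
        proof (cases "l y = hi")
          case True
          then show ?thesis using 3 ay xy by blast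
        next
          case False
          then have "lo \<le> l y" "l y < hi" using \<open>l y \<le> hi\<close> \<open>\<not> l y < lo\<close> by auto
          then show ?thesis using 3 ay by blast
        qed
      qed blast
    qed
  qed
  moreover have "\<not> l v < lo" "\<not> l v < hi" using le by linarith+
  ultimately show ?thesis using that by blast
qed

lemma lipschitz1_fst: "lipschitz1 fst"
  by (auto simp: lipschitz1_def lattice_edges_iff)

definition hprob :: "int \<Rightarrow> int \<Rightarrow> real" where
  "hprob w h = pexp (1/2) (edges_in (rect 0 w 0 h)) (\<lambda>\<omega>. of_bool (hcross 0 w 0 h \<omega>))"

lemma pexp_half_nonneg: "(\<And>\<omega>. \<omega> \<subseteq> E \<Longrightarrow> 0 \<le> F \<omega>) \<Longrightarrow> 0 \<le> pexp (1/2) E F"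
  by (rule pexp_nonneg) auto

lemma pexp_half_mono: "(\<And>\<omega>. \<omega> \<subseteq> E \<Longrightarrow> F \<omega> \<le> G \<omega>) \<Longrightarrow> pexp (1/2) E F \<le> pexp (1/2) E G"
  by (rule pexp_mono) auto

lemma pexp_crossing_restrict:
  assumes "finite E" "edges_in \<Lambda> \<subseteq> E"
  shows "pexp p E (\<lambda>\<omega>. of_bool (crossing \<Lambda> A B \<omega>)) = pexp p (edges_in \<Lambda>) (\<lambda>\<omega>. of_bool (crossing \<Lambda> A B \<omega>))"
  by (rule pexp_restrict[OF assms]) (subst crossing_restrict, rule refl)

lemma pexp_hcross:
  "pexp (1/2) (edges_in (rect a b c d)) (\<lambda>\<omega>. of_bool (hcross a b c d \<omega>)) = hprob (b - a) (d - c)"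
proof -
  let ?T = "\<lambda>v :: vertex. (fst v + a, snd v + c)"
  have 1: "?T ` rect 0 (b - a) 0 (d - c) = rect a b c d"
  proof (intro set_eqI iffI)
    fix v assume "v \<in> rect a b c d"
    then show "v \<in> ?T ` rect 0 (b - a) 0 (d - c)"
      by (intro image_eqI[of _ _ "(fst v - a, snd v - c)"]) (auto simp: mem_rect)
  qed (auto simp: mem_rect)
  have 2: "?T ` {v. fst v = x} = {v. fst v = x + a}" for x
  proof (intro set_eqI iffI)
    fix v :: vertex assume "v \<in> {v. fst v = x + a}"
    then show "v \<in> ?T ` {v. fst v = x}" by (intro image_eqI[of _ _ "(fst v - a, snd v - c)"]) (auto simp: prod_eq_iff)
  qed auto
  show ?thesis
    using pexp_crossing_image[OF lattice_aut_translate[of a c], of "1/2" "rect 0 (b - a) 0 (d - c)" "{v. fst v = 0}" "{v. fst v = b - a}"]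
    unfolding 1 2 hprob_def by simp
qed

lemma image_transpose: "(\<lambda>v. (snd v, fst v)) ` A = {v. (snd v, fst v) \<in> A}"
proof (intro set_eqI iffI)
  fix v :: "'a \<times> 'b" assume "v \<in> {v. (snd v, fst v) \<in> A}"
  then show "v \<in> (\<lambda>v. (snd v, fst v)) ` A" by (intro image_eqI[of _ _ "(snd v, fst v)"]) auto
qed auto

lemma pexp_vcross:
  "pexp (1/2) (edges_in (rect a b c d)) (\<lambda>\<omega>. of_bool (vcross a b c d \<omega>)) = hprob (d - c) (b - a)"
proof -
  let ?T = "\<lambda>v :: vertex. (snd v, fst v)"
  have 1: "?T ` rect c d a b = rect a b c d"
    unfolding image_transpose by (auto simp: mem_rect)
  have 2: "?T ` {v. fst v = x} = {v. snd v = x}" for x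
    unfolding image_transpose by simp
  show ?thesis
    using pexp_crossing_image[OF lattice_aut_transpose, of "1/2" "rect c d a b" "{v. fst v = c}" "{v. fst v = d}"]
    unfolding 1 2 using pexp_hcross[of c d a b] by simp
qed

text \<open>Exactly one of the primal vertical and the dual horizontal crossing occurs. The faces
  involved form a rectangle one unit wider and one unit lower.\<close>

lemma hprob_dual:
  assumes "0 \<le> w" "1 \<le> h"
  shows "hprob h w + hprob (w + 1) (h - 1) = 1"
proof -
  let ?R = "rect 0 w 0 h" and ?\<Phi> = "rect (-1) w 0 (h - 1)"
  \<comment> \<open>The dual edges in the protruding columns cross primal edges outside the
    rectangle, so the probability space has to contain those as well.\<close>
  let ?E = "edges_in ?R \<union> star ` edges_in ?\<Phi>"
  have fin: "finite ?E" by simp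
  have "pexp (1/2) ?E (\<lambda>\<omega>. of_bool (vcross 0 w 0 h \<omega>) + of_bool (hcross (-1) w 0 (h - 1) (dual_config \<omega>))) = pexp (1/2) ?E (\<lambda>\<omega>. 1)"
  proof (intro pexp_cong refl)
    fix \<omega>
    have "vcross 0 w 0 h \<omega> \<or> hcross (-1) w 0 (h - 1) (dual_config \<omega>)"
      using primal_dual_exhaustive[of "nat h" "nat w" \<omega>] assms by auto
    moreover have "\<not> (vcross 0 w 0 h \<omega> \<and> hcross (-1) w 0 (h - 1) (dual_config \<omega>))"
      using primal_dual_exclusive by blast
    ultimately show "of_bool (vcross 0 w 0 h \<omega>) + of_bool (hcross (-1) w 0 (h - 1) (dual_config \<omega>)) = (1 :: real)" by auto
  qed
  moreover have "pexp (1/2) ?E (\<lambda>\<omega>. of_bool (vcross 0 w 0 h \<omega>)) = hprob h w"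
    using pexp_vcross[of 0 w 0 h] pexp_crossing_restrict[OF fin, of ?R] by simp
  moreover have "pexp (1/2) ?E (\<lambda>\<omega>. of_bool (hcross (-1) w 0 (h - 1) (dual_config \<omega>))) = hprob (w + 1) (h - 1)"
  proof -
    have "pexp (1/2) ?E (\<lambda>\<omega>. (\<lambda>\<omega>'. of_bool (hcross (-1) w 0 (h - 1) \<omega>')) (dual_config \<omega>))
       = pexp (1/2) (edges_in ?\<Phi>) (\<lambda>\<omega>'. of_bool (hcross (-1) w 0 (h - 1) \<omega>'))"
      by (rule pexp_dual[OF fin]) (auto simp flip: crossing_restrict)
    then show ?thesis using pexp_hcross[of "-1" w 0 "h - 1"] by simp
  qed
  ultimately show ?thesis using fin by (simp add: pexp_add)
qed

lemma hcross_shorten: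
  assumes "hcross 0 w' 0 h \<omega>" "0 \<le> w" "w \<le> w'"
  shows "hcross 0 w 0 h \<omega>"
proof -
  obtain u v where uv: "u \<in> rect 0 w' 0 h" "fst u = 0" "fst v = w'" "(u, v) \<in> reach (\<omega> \<inter> edges_in (rect 0 w' 0 h))"
    using assms(1) unfolding crossing_def by blast
  obtain a b where ab: "a \<in> rect 0 w' 0 h" "b \<in> rect 0 w' 0 h" "fst a = 0" "fst b = w"
    "(a, b) \<in> reach (\<omega> \<inter> edges_in (rect 0 w' 0 h \<inter> {z. 0 \<le> fst z \<and> fst z \<le> w}))"
    by (rule reach_band[OF lipschitz1_fst uv(4,1), of 0 w]) (use uv assms in auto)
  have eq: "rect 0 w' 0 h \<inter> {z. 0 \<le> fst z \<and> fst z \<le> w} = rect 0 w 0 h"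
    using assms by (auto simp: mem_rect)
  have "a \<in> {v. fst v = 0} \<inter> rect 0 w 0 h" "b \<in> {v. fst v = w} \<inter> rect 0 w 0 h"
    using ab(1-4) assms(2) by (auto simp: mem_rect)
  then show ?thesis using ab(5) unfolding crossing_def eq by blast
qed

lemma hprob_antimono_width: "0 \<le> w \<Longrightarrow> w \<le> w' \<Longrightarrow> hprob w' h \<le> hprob w h"
proof -
  assume w: "0 \<le> w" "w \<le> w'"
  have sub: "edges_in (rect 0 w 0 h) \<subseteq> edges_in (rect 0 w' 0 h)"
    using w by (intro edges_in_mono) (auto simp: mem_rect)
  have "hprob w' h \<le> pexp (1/2) (edges_in (rect 0 w' 0 h)) (\<lambda>\<omega>. of_bool (hcross 0 w 0 h \<omega>))"
    unfolding hprob_def using hcross_shorten[OF _ w] by (intro pexp_half_mono) auto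
  also have "\<dots> = hprob w h" unfolding hprob_def by (rule pexp_crossing_restrict[OF _ sub]) simp
  finally show ?thesis .
qed

lemma crossing_mono_region: "\<Lambda> \<subseteq> \<Lambda>' \<Longrightarrow> crossing \<Lambda> A B \<omega> \<Longrightarrow> crossing \<Lambda>' A B \<omega>"
proof -
  assume sub: "\<Lambda> \<subseteq> \<Lambda>'" and c: "crossing \<Lambda> A B \<omega>"
  have "\<omega> \<inter> edges_in \<Lambda> \<subseteq> \<omega> \<inter> edges_in \<Lambda>'" using edges_in_mono[OF sub] by blast
  from reach_mono[OF this] show "crossing \<Lambda>' A B \<omega>" using c sub unfolding crossing_def by blast
qed

lemma hprob_mono_height: "h \<le> h' \<Longrightarrow> hprob w h \<le> hprob w h'"
proof -
  assume h: "h \<le> h'"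
  have sub: "rect 0 w 0 h \<subseteq> rect 0 w 0 h'" using h by (auto simp: mem_rect)
  have "hprob w h = pexp (1/2) (edges_in (rect 0 w 0 h')) (\<lambda>\<omega>. of_bool (hcross 0 w 0 h \<omega>))"
    unfolding hprob_def by (rule pexp_crossing_restrict[OF _ edges_in_mono[OF sub], symmetric]) simp
  also have "\<dots> \<le> hprob w h'"
    unfolding hprob_def using crossing_mono_region[OF sub] by (intro pexp_half_mono) auto
  finally show ?thesis .
qed

text \<open>The rectangle of width n + 1 and height n is self-dual, hence crossed with probability
  exactly 1/2; shortening it to a square only helps.\<close>

lemma hprob_square: "0 \<le> n \<Longrightarrow> 1/2 \<le> hprob n n"
  using hprob_dual[of n "n + 1"] hprob_antimono_width[of n "n + 1" n] by simp

section \<open>The Russo--Seymour--Welsh theorem\<close>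

text \<open>A vertical crossing of the square \<open>S\<close> whose cluster extends inside
  \<open>R\<close> to the set \<open>B\<close>. Two bridges to opposite sides are joined by one
  horizontal crossing of \<open>S\<close>.\<close>

definition bridge :: "int \<Rightarrow> vertex set \<Rightarrow> vertex set \<Rightarrow> vertex set \<Rightarrow> edge set \<Rightarrow> bool" where
  "bridge n S R B \<omega> \<longleftrightarrow> (\<exists>s\<in>S. \<exists>t\<in>S. \<exists>u\<in>B \<inter> R. snd s = 0 \<and> snd t = n \<and>
     (s, t) \<in> reach (\<omega> \<inter> edges_in S) \<and> (s, u) \<in> reach (\<omega> \<inter> edges_in R))"

lemma bridge_mono: "\<omega> \<subseteq> \<omega>' \<Longrightarrow> bridge n S R B \<omega> \<Longrightarrow> bridge n S R B \<omega>'"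
proof -
  assume sub: "\<omega> \<subseteq> \<omega>'" and b: "bridge n S R B \<omega>"
  have "\<omega> \<inter> edges_in S \<subseteq> \<omega>' \<inter> edges_in S" "\<omega> \<inter> edges_in R \<subseteq> \<omega>' \<inter> edges_in R" using sub by blast+
  from this[THEN reach_mono] show "bridge n S R B \<omega>'" using b unfolding bridge_def by (meson subsetD)
qed

lemma bridge_restrict: "S \<subseteq> R \<Longrightarrow> bridge n S R B \<omega> = bridge n S R B (\<omega> \<inter> edges_in R)"
proof -
  assume "S \<subseteq> R"
  then have "\<omega> \<inter> edges_in R \<inter> edges_in S = \<omega> \<inter> edges_in S" "\<omega> \<inter> edges_in R \<inter> edges_in R = \<omega> \<inter> edges_in R"
    using edges_in_mono by blast+
  then show ?thesis by (simp add: bridge_def)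
qed

lemma bridge_image:
  assumes T: "lattice_aut T" and snd: "\<And>v. snd (T v) = snd v"
  shows "bridge n (T ` S) (T ` R) (T ` B) ((`) T ` \<omega>) = bridge n S R B \<omega>"
proof -
  have inj: "inj T" using T by (simp add: lattice_aut_def bij_def)
  have "T ` B \<inter> T ` R = T ` (B \<inter> R)" using inj by (simp add: image_Int)
  then show ?thesis unfolding bridge_def image_edges_Int[OF T] by (simp add: reach_image[OF inj] snd)
qed

lemma reach_image_edges:
  assumes "lattice_aut T" "(u, v) \<in> reach \<omega>"
  shows "(T u, T v) \<in> reach ((`) T ` \<omega>)"
  using assms reach_image[of T u v \<omega>] by (simp add: lattice_aut_def bij_def)

lemma mid_eq_edges:
  assumes "{a, b} \<in> lattice_edges" "{c, d} \<in> lattice_edges" "mid a b = mid c d"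
  shows "{a, b} = {c, d}"
  using assms(1)
proof (cases rule: mid_cases)
  case (1 x y)
  note ab = 1
  show ?thesis using assms(2)
  proof (cases rule: mid_cases)
    case (1 x' y')
    then show ?thesis using ab assms(3) by simp
  next
    case (2 x' y')
    then show ?thesis using ab assms(3) by simp presburger
  qed
next
  case (2 x y)
  note ab = 2
  show ?thesis using assms(2)
  proof (cases rule: mid_cases)
    case (1 x' y')
    then show ?thesis using ab assms(3) by simp presburger
  next
    case (2 x' y')
    then show ?thesis using ab assms(3) by simp
  qed
qed

lemma mid_neq_dbl:
  assumes "{a, b} \<in> lattice_edges"
  shows "mid a b \<noteq> dbl v"
  using assms
proof (cases rule: mid_cases)
  case (1 x y)
  then show ?thesis by (simp add: dbl_def) presburger
next
  case (2 x y)
  then show ?thesis by (simp add: dbl_def) presburger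
qed

lemma primal_traces_disjoint:
  assumes "U \<inter> V = {}" "\<omega> \<subseteq> lattice_edges" "\<tau> \<subseteq> lattice_edges"
  shows "primal_trace U \<omega> \<inter> primal_trace V \<tau> = {}"
proof (intro equals0I)
  fix z assume "z \<in> primal_trace U \<omega> \<inter> primal_trace V \<tau>"
  then consider a b where "z = dbl a" "z = dbl b" "a \<in> U" "b \<in> V"
    | a c d where "z = dbl a" "z = mid c d" "{c, d} \<in> lattice_edges"
    | a b c d where "z = mid a b" "z = mid c d" "{a, b} \<in> lattice_edges" "{c, d} \<in> lattice_edges" "a \<in> U" "b \<in> U" "c \<in> V" "d \<in> V"
    using assms(2,3) unfolding primal_trace_def by blast
  then show False
  proof cases
    case 1
    then have "a = b" by (auto simp: dbl_def prod_eq_iff)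
    then show False using 1 assms(1) by blast
  next
    case 2
    then show False using mid_neq_dbl by metis
  next
    case 3
    then have "{a, b} = {c, d}" using mid_eq_edges by metis
    then show False using 3 assms(1) by (auto simp: doubleton_eq_iff)
  qed
qed

lemma hcross_cluster: "hcross a b c d \<omega> \<longleftrightarrow> (\<exists>v\<in>cluster (rect a b c d) {v. fst v = a} \<omega>. fst v = b)"
proof
  assume "hcross a b c d \<omega>"
  then show "\<exists>v\<in>cluster (rect a b c d) {v. fst v = a} \<omega>. fst v = b"
    unfolding crossing_def cluster_def by blast
next
  assume "\<exists>v\<in>cluster (rect a b c d) {v. fst v = a} \<omega>. fst v = b"
  then obtain v where "v \<in> cluster (rect a b c d) {v. fst v = a} \<omega>" "fst v = b" by blast
  moreover from this have "v \<in> rect a b c d" using cluster_subset by blast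
  ultimately show "hcross a b c d \<omega>" unfolding crossing_def cluster_def by blast
qed

text \<open>The edges queried when exploring the dual clusters of the left side of the square \<open>[0, n]\<^sup>2\<close>.\<close>

definition left_explored :: "int \<Rightarrow> edge set \<Rightarrow> edge set \<Rightarrow> edge set" where
  "left_explored n E \<omega> = E \<inter> star ` explored (rect (-1) n 0 (n - 1)) {f. fst f = -1} (dual_config \<omega>)"

text \<open>Outside \<open>E\<close> both configurations have no edges at all, so cutting the
  queried set down to \<open>E\<close> loses no information about the dual configurations.\<close>

lemma left_explored_dual:
  assumes "\<omega> \<subseteq> E" "\<tau> \<subseteq> E" "\<omega> \<inter> left_explored n E \<omega> = \<tau> \<inter> left_explored n E \<omega>"
  shows "dual_config \<omega> \<inter> explored (rect (-1) n 0 (n - 1)) {f. fst f = -1} (dual_config \<omega>)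
       = dual_config \<tau> \<inter> explored (rect (-1) n 0 (n - 1)) {f. fst f = -1} (dual_config \<omega>)"
proof (intro set_eqI)
  fix f
  let ?X = "explored (rect (-1) n 0 (n - 1)) {f. fst f = -1} (dual_config \<omega>)"
  have "star f \<in> \<omega> \<longleftrightarrow> star f \<in> \<tau>" if "f \<in> ?X"
    using assms that unfolding left_explored_def by blast
  then show "f \<in> dual_config \<omega> \<inter> ?X \<longleftrightarrow> f \<in> dual_config \<tau> \<inter> ?X" unfolding dual_config_def by blast
qed

lemma stopping_set_left_explored: "stopping_set E (left_explored n E)"
  unfolding stopping_set_def
proof (intro allI impI)
  fix \<omega> \<tau> assume "\<omega> \<subseteq> E" "\<tau> \<subseteq> E" "\<omega> \<inter> left_explored n E \<omega> = \<tau> \<inter> left_explored n E \<omega>"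
  from cluster_explored(2)[OF left_explored_dual[OF this]]
  show "left_explored n E \<tau> = left_explored n E \<omega>" by (simp add: left_explored_def)
qed

text \<open>Removing all unqueried edges does not change the dual clusters of the left side, so
  there is still no dual horizontal crossing, and duality produces a vertical crossing made of
  queried edges only. This takes the place of a leftmost crossing.\<close>

lemma vcross_left_explored:
  assumes n: "1 \<le> n" and \<omega>: "\<omega> \<subseteq> E" and v: "vcross 0 n 0 n \<omega>"
  shows "vcross 0 n 0 n (\<omega> \<inter> left_explored n E \<omega>)"
proof -
  let ?\<omega>' = "\<omega> \<inter> left_explored n E \<omega>"
  have eq: "cluster (rect (-1) n 0 (n - 1)) {f. fst f = -1} (dual_config ?\<omega>') = cluster (rect (-1) n 0 (n - 1)) {f. fst f = -1} (dual_config \<omega>)"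
    by (rule cluster_explored(1), rule left_explored_dual[OF \<omega>]) (use \<omega> in auto)
  have "\<not> hcross (-1) n 0 (n - 1) (dual_config ?\<omega>')"
    using primal_dual_exclusive[OF v] unfolding hcross_cluster eq by blast
  then show ?thesis using primal_dual_exhaustive[of "nat n" "nat n" ?\<omega>'] n by simp
qed

text \<open>The conditioning in the RSW argument: \<omega> is a fixed outcome whose exploration has
  already found a vertical crossing from \<open>a\<close> to \<open>b\<close> of the square. The
  rectangle is twice as high as the square to leave room for the mirror image.\<close>

locale rsw_step =
  fixes n m :: int and \<omega> :: "edge set" and a b :: vertex
  assumes n: "1 \<le> n" "n \<le> m"
    and \<omega>: "\<omega> \<subseteq> edges_in (rect 0 m 0 (2 * n))"
    and ab: "a \<in> rect 0 n 0 n" "b \<in> rect 0 n 0 n" "snd a = 0" "snd b = n"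
    and conn: "(a, b) \<in> reach (\<omega> \<inter> left_explored n (edges_in (rect 0 m 0 (2 * n))) \<omega> \<inter> edges_in (rect 0 n 0 n))"
begin

abbreviation "R \<equiv> rect 0 m 0 (2 * n)"
abbreviation "S \<equiv> rect 0 n 0 n"
abbreviation "\<Phi> \<equiv> rect (-1) n 0 (n - 1)"
abbreviation "J \<equiv> left_explored n (edges_in R) \<omega>"

definition \<sigma> :: "vertex \<Rightarrow> vertex" where "\<sigma> v = (fst v, 2 * n - snd v)"
definition \<omega>S :: "edge set" where "\<omega>S = \<omega> \<inter> J \<inter> edges_in S"

text \<open>\<open>Z0\<close> carries the vertical crossing found by the exploration, \<open>Z\<close> adds its mirror image in the
  top side of \<open>S\<close>. By symmetry a horizontal crossing of \<open>R\<close>, followed from the right, meets \<open>Z0\<close>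
  before \<open>\<sigma> ` Z0\<close> with at least half its probability.\<close>

definition Z0 :: "vertex set" where "Z0 = {v. (a, v) \<in> reach \<omega>S}"
definition Z :: "vertex set" where "Z = Z0 \<union> \<sigma> ` Z0"
definition \<omega>0 :: "edge set" where "\<omega>0 = {e \<in> \<omega>S. e \<subseteq> Z0}"
definition \<omega>Z :: "edge set" where "\<omega>Z = \<omega>0 \<union> (`) \<sigma> ` \<omega>0"

lemma \<sigma>_aut: "lattice_aut \<sigma>"
  using lattice_aut_reflect_snd[of "2 * n"] by (simp add: \<sigma>_def[abs_def])

lemma \<sigma>_\<sigma> [simp]: "\<sigma> (\<sigma> v) = v"
  by (simp add: \<sigma>_def)

lemma \<sigma>_R: "\<sigma> ` R = R"
proof -
  have "\<sigma> v \<in> R" if "v \<in> R" for v using that by (auto simp: \<sigma>_def mem_rect)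
  then show ?thesis by (metis \<sigma>_\<sigma> image_eqI image_subset_iff subsetI subset_antisym)
qed

lemma \<sigma>_Z: "\<sigma> v \<in> Z \<longleftrightarrow> v \<in> Z"
proof -
  have "\<sigma> x \<in> Z" if "x \<in> Z" for x using that unfolding Z_def by auto
  from this[of v] this[of "\<sigma> v"] show ?thesis by auto
qed

lemma \<omega>0_lattice: "\<omega>0 \<subseteq> edges_in S"
  by (auto simp: \<omega>0_def \<omega>S_def)

lemma \<omega>Z_edges: "\<omega>Z \<subseteq> edges_in Z"
proof -
  have 0: "\<omega>0 \<subseteq> edges_in Z0" using \<omega>0_lattice by (auto simp: \<omega>0_def edges_in_def)
  then have "(`) \<sigma> ` \<omega>0 \<subseteq> edges_in (\<sigma> ` Z0)" unfolding lattice_aut_image_edges_in[OF \<sigma>_aut] by blast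
  then show ?thesis using 0 edges_in_mono[of Z0 Z] edges_in_mono[of "\<sigma> ` Z0" Z] unfolding \<omega>Z_def Z_def by blast
qed

lemma Z0_S: "Z0 \<subseteq> S"
  unfolding Z0_def \<omega>S_def using reach_edges_in_closed[of a _ "\<omega> \<inter> J" S] ab by blast

lemma S_R: "S \<subseteq> R"
  using n by (auto simp: mem_rect)

lemma Z_R: "Z \<subseteq> R"
  using Z0_S S_R \<sigma>_R unfolding Z_def by blast

lemma a_Z: "a \<in> Z0" by (simp add: Z0_def)

lemma reach_\<omega>0: "(a, v) \<in> reach \<omega>S \<Longrightarrow> (a, v) \<in> reach \<omega>0"
proof (induction rule: reach_induct)
  case (step x y)
  then have "x \<in> Z0" "y \<in> Z0" unfolding Z0_def using reach_step reach_trans by blast+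
  then have "{x, y} \<in> \<omega>0" using step(2) by (simp add: \<omega>0_def)
  then show ?case using step(3) reach_step reach_trans by blast
qed simp

text \<open>The upper end \<open>b\<close> lies on the mirror axis, so the crossing and its image
  join there into one connection from the bottom to the top of \<open>R\<close>.\<close>

lemma reach_\<omega>Z: "(a, \<sigma> a) \<in> reach \<omega>Z"
proof -
  have "(a, b) \<in> reach \<omega>0" using conn reach_\<omega>0 by (simp add: \<omega>S_def)
  then have 1: "(a, b) \<in> reach \<omega>Z" and 2: "(\<sigma> a, \<sigma> b) \<in> reach \<omega>Z"
    using reach_mono[of \<omega>0 \<omega>Z] reach_mono[of "(`) \<sigma> ` \<omega>0" \<omega>Z] reach_image_edges[OF \<sigma>_aut, of a b \<omega>0]
    unfolding \<omega>Z_def by blast+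
  have "\<sigma> b = b" using ab(4) by (simp add: \<sigma>_def prod_eq_iff)
  then show ?thesis using 1 reach_sym[OF 2] reach_trans by metis
qed

text \<open>\<open>Z\<close> contains a walk from the bottom to the top of \<open>R\<close>, which
  no connection between the vertical sides can avoid.\<close>

lemma Z_separates:
  assumes "u \<in> R" "v \<in> R" "fst u = m" "fst v = 0" "u \<notin> Z"
  shows "(u, v) \<notin> reach {e \<in> \<tau> \<inter> edges_in R. e \<inter> Z = {}}"
proof
  assume uv: "(u, v) \<in> reach {e \<in> \<tau> \<inter> edges_in R. e \<inter> Z = {}}"
  obtain P where P: "walk \<omega>Z P" "hd P = a" "last P = \<sigma> a" "\<And>z. z \<in> set P \<Longrightarrow> (a, z) \<in> reach \<omega>Z"
    using reach_\<omega>Z by (rule reach_walk) blast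
  have PZ: "set P \<subseteq> Z"
  proof
    fix z assume "z \<in> set P"
    then have "(a, z) \<in> reach (\<omega>Z \<inter> edges_in Z)" using P(4) \<omega>Z_edges by (simp add: Int_absorb2)
    then show "z \<in> Z" by (rule reach_edges_in_closed) (use a_Z in \<open>simp add: Z_def\<close>)
  qed
  have wP: "walk lattice_edges P"
    using P(1) \<omega>Z_edges edges_in_lattice unfolding walk_def by (auto intro: successively_mono)
  have sub: "{e \<in> \<tau> \<inter> edges_in R. e \<inter> Z = {}} \<subseteq> edges_in ({z. 0 \<le> snd z \<and> snd z \<le> 2 * n} - set P)"
  proof
    fix e assume e: "e \<in> {e \<in> \<tau> \<inter> edges_in R. e \<inter> Z = {}}"
    then have "e \<in> lattice_edges" "e \<subseteq> R" "e \<inter> Z = {}" by (auto simp: edges_in_def)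
    have "e \<subseteq> {z. 0 \<le> snd z \<and> snd z \<le> 2 * n} - set P"
    proof
      fix z assume z: "z \<in> e"
      then have "z \<in> R" "z \<notin> set P" using \<open>e \<subseteq> R\<close> \<open>e \<inter> Z = {}\<close> PZ by auto
      then show "z \<in> {z. 0 \<le> snd z \<and> snd z \<le> 2 * n} - set P" by (simp add: mem_rect)
    qed
    then show "e \<in> edges_in ({z. 0 \<le> snd z \<and> snd z \<le> 2 * n} - set P)"
      using \<open>e \<in> lattice_edges\<close> by (simp add: edges_in_def)
  qed
  have vu: "(v, u) \<in> reach (edges_in ({z. 0 \<le> snd z \<and> snd z \<le> 2 * n} - set P))"
    using reach_sym[OF uv] reach_mono[OF sub] by (rule subsetD[rotated])
  have vP: "v \<notin> set P"
  proof -
    have "(u, v) \<in> reach (UNIV \<inter> edges_in ({z. 0 \<le> snd z \<and> snd z \<le> 2 * n} - set P))"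
      using subsetD[OF reach_mono[OF sub] uv] by simp
    then have "v \<in> {z. 0 \<le> snd z \<and> snd z \<le> 2 * n} - set P"
      by (rule reach_edges_in_closed) (use assms PZ in \<open>auto simp: mem_rect\<close>)
    then show ?thesis by simp
  qed
  have PR: "\<forall>z\<in>set P. z \<in> R" using PZ Z_R by auto
  show False
  proof (rule walk_separates[OF wP _ _ vu vP])
    show "snd (hd P) \<le> 0" "2 * n \<le> snd (last P)" using ab by (simp_all add: P \<sigma>_def)
    show "0 \<le> snd v" "snd v \<le> 2 * n" using assms by (auto simp: mem_rect)
    show "\<forall>z\<in>set P. fst v \<le> fst z" "\<forall>z\<in>set P. fst z \<le> fst u"
      using PR assms(3,4) by (auto simp: mem_rect)
  qed
qed

text \<open>A connection from the right side avoiding \<open>Z\<close> stays to the right of \<open>Z\<close>, hence meets no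
  queried edge: such an edge is adjacent to a dual cluster starting on the left.\<close>

lemma fresh_edge:
  assumes u: "u \<in> R" "fst u = m" "u \<notin> Z"
    and uc: "(u, c) \<in> reach {e \<in> \<tau> \<inter> edges_in R. e \<inter> Z = {}}" and cd: "{c, d} \<in> edges_in R"
  shows "{c, d} \<notin> J"
proof
  let ?\<tau> = "{e \<in> \<tau> \<inter> edges_in R. e \<inter> Z = {}}"
  let ?\<Psi> = "dual_config \<omega> \<inter> edges_in \<Phi>"
  assume "{c, d} \<in> J"
  then obtain e where e: "{c, d} = star e" "e \<in> explored \<Phi> {f. fst f = -1} (dual_config \<omega>)"
    by (auto simp: left_explored_def)
  then obtain f where f: "f \<in> e" "f \<in> cluster \<Phi> {f. fst f = -1} (dual_config \<omega>)" and e\<Phi>: "e \<in> edges_in \<Phi>"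
    by (auto simp: explored_def)
  then obtain g where l: "g \<in> \<Phi>" "fst g = -1" "(g, f) \<in> reach ?\<Psi>"
    by (auto simp: cluster_def)
  have \<tau>R: "?\<tau> \<subseteq> edges_in (R - Z)" by (auto simp: edges_in_def)
  have cR: "c \<in> R - Z"
  proof -
    have "(u, c) \<in> reach (?\<tau> \<inter> edges_in (R - Z))" using uc \<tau>R by (simp add: Int_absorb2)
    then show ?thesis by (rule reach_edges_in_closed) (use u in auto)
  qed
  have dR: "d \<in> R" and cdl: "{c, d} \<in> lattice_edges" using cd by (auto simp: edges_in_iff)
  let ?X = "primal_trace Z \<omega>Z"
  let ?W1 = "primal_trace (R - Z) ?\<tau>" and ?W2 = "dual_trace \<Phi> ?\<Psi>"
  \<comment> \<open>If the edge were queried, one could go from the left side through the dual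
    cluster, then through the midpoint of the edge, and on to the right side. \<open>W\<close> is
    this route in doubled coordinates; it would have to cross the trace of \<open>Z\<close>.\<close>
  define W where "W = insert (mid c d) (?W1 \<union> ?W2)"
  have W1: "(dbl u, dbl c) \<in> reach (edges_in W)"
    using reach_primal_trace[OF uc \<tau>R] u reach_mono[OF edges_in_mono[of ?W1 W]] unfolding W_def by blast
  have W2: "(dbl_face g, dbl_face f) \<in> reach (edges_in W)"
    using reach_dual_trace[OF l(3) _ l(1)] reach_mono[OF edges_in_mono[of ?W2 W]] unfolding W_def by blast
  have cW: "dbl c \<in> W" using cR unfolding W_def primal_trace_def by blast
  have f\<Phi>: "f \<in> \<Phi>" using f(1) e\<Phi> by (auto simp: edges_in_def)
  have fW: "dbl_face f \<in> W" using f\<Phi> unfolding W_def dual_trace_def by blast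
  have adj1: "{dbl c, mid c d} \<in> lattice_edges"
    using cdl by (auto simp: lattice_edges_iff dbl_def mid_def)
  \<comment> \<open>The midpoint of {c, d} is where the primal edge meets its dual edge, so it is
    adjacent to the doubled face \<open>f\<close>.\<close>
  have adj2: "{mid c d, dbl_face f} \<in> lattice_edges"
  proof -
    have "c \<in> star e" "d \<in> star e" using e(1) by auto
    then have "fst c - fst f \<in> {0, 1}" "snd c - snd f \<in> {0, 1}" "fst d - fst f \<in> {0, 1}" "snd d - snd f \<in> {0, 1}"
      using f(1) by (auto simp: star_def)
    then show ?thesis using cdl by (auto simp: lattice_edges_iff dbl_face_def mid_def)
  qed
  have "(dbl c, dbl_face f) \<in> reach (edges_in W)"
  proof -
    have "mid c d \<in> W" by (simp add: W_def)
    then have "{dbl c, mid c d} \<in> edges_in W" "{mid c d, dbl_face f} \<in> edges_in W"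
      using adj1 adj2 cW fW by (simp_all add: edges_in_iff)
    then show ?thesis by (meson reach_step reach_trans)
  qed
  then have gu: "(dbl_face g, dbl u) \<in> reach (edges_in W)"
    using W1 W2 reach_trans reach_sym by blast
  have disj: "W \<inter> ?X = {}"
  proof -
    have \<omega>Zl: "\<omega>Z \<subseteq> lattice_edges" using \<omega>Z_edges edges_in_lattice by blast
    have "?W1 \<inter> ?X = {}"
      by (rule primal_traces_disjoint[OF _ _ \<omega>Zl]) (auto simp: edges_in_def)
    \<comment> \<open>The edge {c, d} is not an edge of \<open>\<omega>Z\<close>, since
      \<open>c\<close> is outside \<open>Z\<close>.\<close>
    moreover have "mid c d \<notin> ?X"
    proof
      assume "mid c d \<in> ?X"
      then consider z where "mid c d = dbl z" | p q where "mid c d = mid p q" "{p, q} \<in> \<omega>Z" "p \<in> Z" "q \<in> Z"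
        unfolding primal_trace_def by blast
      then show False
      proof cases
        case 1 then show False using mid_neq_dbl[OF cdl] by blast
      next
        case 2
        then have "{c, d} = {p, q}" using mid_eq_edges[OF cdl] \<omega>Zl by blast
        then show False using 2 cR by (auto simp: doubleton_eq_iff)
      qed
    qed
    \<comment> \<open>The lower half of \<open>Z\<close> consists of present edges of \<omega>, so
      its trace misses the dual trace. The mirrored half has doubled height at least 2n, while the
      dual trace stays strictly below 2n.\<close>
    moreover have "?W2 \<inter> ?X = {}"
    proof (intro equals0I)
      fix z assume z: "z \<in> ?W2 \<inter> ?X"
      have \<omega>l: "\<omega> \<subseteq> lattice_edges" using \<omega> edges_in_lattice by blast
      have no: "z \<notin> primal_trace Z \<omega>" using z traces_disjoint[OF \<omega>l, of Z \<Phi> "edges_in \<Phi>"] by blast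
      have "\<omega>0 \<subseteq> \<omega>" by (auto simp: \<omega>0_def \<omega>S_def)
      then obtain p q where pq: "z = mid p q" "{p, q} \<in> (`) \<sigma> ` \<omega>0"
        using z no unfolding primal_trace_def \<omega>Z_def by blast
      then obtain e' where "e' \<in> \<omega>0" "{p, q} = \<sigma> ` e'" by blast
      then have "e' \<subseteq> S" "{p, q} = \<sigma> ` e'" using \<omega>0_lattice by (auto simp: edges_in_def)
      then have "p \<in> \<sigma> ` S" "q \<in> \<sigma> ` S" by blast+
      then have "n \<le> snd p" "n \<le> snd q" by (auto simp: \<sigma>_def mem_rect)
      then have "2 * n \<le> snd z" using pq by (simp add: mid_def)
      moreover have "snd z < 2 * n" using z by (auto simp: dual_trace_def dbl_face_def mid_def mem_rect)
      ultimately show False by simp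
    qed
    ultimately show ?thesis unfolding W_def by blast
  qed
  have strip: "0 \<le> snd z \<and> snd z \<le> 4 * n" if "z \<in> W" for z
    using that cR dR n unfolding W_def primal_trace_def dual_trace_def
    by (auto simp: dbl_def dbl_face_def mid_def mem_rect)
  have Xr: "0 \<le> fst z \<and> fst z \<le> 2 * m" if "z \<in> ?X" for z
  proof -
    have Zr: "0 \<le> fst v \<and> fst v \<le> m" if "v \<in> Z" for v using that Z_R by (auto simp: mem_rect)
    from \<open>z \<in> ?X\<close> consider p where "z = dbl p" "p \<in> Z" | p q where "z = mid p q" "p \<in> Z" "q \<in> Z"
      unfolding primal_trace_def by blast
    then show ?thesis
    proof cases
      case 1 then show ?thesis using Zr[of p] by (simp add: dbl_def)
    next
      case 2 then show ?thesis using Zr[of p] Zr[of q] by (simp add: mid_def)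
    qed
  qed
  have "(dbl a, dbl (\<sigma> a)) \<in> reach (edges_in ?X)"
    using reach_primal_trace[OF reach_\<omega>Z \<omega>Z_edges] a_Z by (simp add: Z_def)
  then obtain P where P: "walk (edges_in ?X) P" "hd P = dbl a" "last P = dbl (\<sigma> a)" "\<And>z. z \<in> set P \<Longrightarrow> (dbl a, z) \<in> reach (edges_in ?X)"
    by (rule reach_walk) blast
  have PX: "z \<in> ?X" if "z \<in> set P" for z
  proof -
    have "(dbl a, z) \<in> reach (UNIV \<inter> edges_in ?X)" using P(4)[OF that] by simp
    then show ?thesis by (rule reach_edges_in_closed) (use a_Z in \<open>auto simp: primal_trace_def Z_def\<close>)
  qed
  have wP: "walk lattice_edges P"
    using P(1) unfolding walk_def by (auto intro: successively_mono simp: edges_in_def)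
  have sub: "edges_in W \<subseteq> edges_in ({z. 0 \<le> snd z \<and> snd z \<le> 4 * n} - set P)"
  proof (intro edges_in_mono subsetI)
    fix z assume z: "z \<in> W"
    then show "z \<in> {z. 0 \<le> snd z \<and> snd z \<le> 4 * n} - set P" using strip[OF z] PX disj by blast
  qed
  have gu': "(dbl_face g, dbl u) \<in> reach (edges_in ({z. 0 \<le> snd z \<and> snd z \<le> 4 * n} - set P))"
    using gu reach_mono[OF sub] by blast
  have gW: "dbl_face g \<in> W" using l(1) unfolding W_def dual_trace_def by blast
  show False
  proof (rule walk_separates[OF wP _ _ gu'])
    show "snd (hd P) \<le> 0" "4 * n \<le> snd (last P)" using ab(3) by (simp_all add: P(2,3) dbl_def \<sigma>_def)
    show "dbl_face g \<notin> set P" using gW PX disj by blast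
    show "0 \<le> snd (dbl_face g)" "snd (dbl_face g) \<le> 4 * n" using strip[OF gW] by simp_all
    show "\<forall>z\<in>set P. fst (dbl_face g) \<le> fst z"
    proof
      fix z assume z: "z \<in> set P"
      show "fst (dbl_face g) \<le> fst z" using Xr[OF PX[OF z]] l(2) by (simp add: dbl_face_def)
    qed
    show "\<forall>z\<in>set P. fst z \<le> fst (dbl u)"
    proof
      fix z assume z: "z \<in> set P"
      show "fst z \<le> fst (dbl u)" using Xr[OF PX[OF z]] u(2) by (simp add: dbl_def)
    qed
  qed
qed

text \<open>The connection from the right side starts on \<open>Z0\<close>, or the first vertex of
  \<open>Z\<close> that it meets belongs to \<open>Z0\<close> rather than only being approached
  through the mirror image.\<close>

definition Y :: "edge set \<Rightarrow> bool" where
  "Y \<tau> \<longleftrightarrow> (\<exists>u\<in>R. fst u = m \<and> (u \<in> Z0 \<or> u \<notin> Z \<and>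
     (\<exists>c d. (u, c) \<in> reach {e \<in> \<tau> \<inter> edges_in R. e \<inter> Z = {}} \<and> {c, d} \<in> \<tau> \<inter> edges_in R \<and> d \<in> Z0)))"

text \<open>All edges of the connection up to and including the hit are unqueried by
  \<open>fresh_edge\<close>, so they keep their state from \<tau> in the mixed configuration; the
  queried part supplies \<open>Z0\<close> and the vertical crossing.\<close>

lemma Y_bridge:
  assumes "Y \<tau>"
  shows "bridge n S R {v. fst v = m} ((\<omega> \<inter> J) \<union> (\<tau> - J))"
proof -
  let ?\<rho> = "(\<omega> \<inter> J) \<union> (\<tau> - J)"
  obtain u where u: "u \<in> R" "fst u = m" and Yu: "u \<in> Z0 \<or> u \<notin> Z \<and>
     (\<exists>c d. (u, c) \<in> reach {e \<in> \<tau> \<inter> edges_in R. e \<inter> Z = {}} \<and> {c, d} \<in> \<tau> \<inter> edges_in R \<and> d \<in> Z0)"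
    using assms unfolding Y_def by blast
  have sub: "\<omega>S \<subseteq> ?\<rho> \<inter> edges_in S" "?\<rho> \<inter> edges_in S \<subseteq> ?\<rho> \<inter> edges_in R"
    using edges_in_mono[OF S_R] by (auto simp: \<omega>S_def)
  have abS: "(a, b) \<in> reach (?\<rho> \<inter> edges_in S)"
    using conn reach_mono[OF sub(1)] unfolding \<omega>S_def by blast
  have aZ: "(a, z) \<in> reach (?\<rho> \<inter> edges_in R)" if "z \<in> Z0" for z
    using that reach_mono[OF sub(1)] reach_mono[OF sub(2)] unfolding Z0_def by blast
  have "(a, u) \<in> reach (?\<rho> \<inter> edges_in R)"
    using Yu
  proof
    assume "u \<notin> Z \<and> (\<exists>c d. (u, c) \<in> reach {e \<in> \<tau> \<inter> edges_in R. e \<inter> Z = {}} \<and> {c, d} \<in> \<tau> \<inter> edges_in R \<and> d \<in> Z0)"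
    then obtain c d where uZ: "u \<notin> Z" and uc: "(u, c) \<in> reach {e \<in> \<tau> \<inter> edges_in R. e \<inter> Z = {}}"
      and cd: "{c, d} \<in> \<tau> \<inter> edges_in R" "d \<in> Z0" by blast
    note fresh = fresh_edge[OF u uZ]
    have "(u, c) \<in> reach (?\<rho> \<inter> edges_in R)"
      using uc
    proof (induction rule: reach_induct)
      case (step x y)
      have xy: "{x, y} \<in> \<tau>" "{x, y} \<in> edges_in R" using step(2) by auto
      then have "{x, y} \<in> ?\<rho> \<inter> edges_in R" using fresh[OF step(1) xy(2)] by simp
      from reach_trans[OF step(3) reach_step[OF this]] show ?case .
    qed simp
    moreover have "{c, d} \<in> ?\<rho> \<inter> edges_in R" using fresh[OF uc, of d] cd(1) by simp
    ultimately have ud: "(u, d) \<in> reach (?\<rho> \<inter> edges_in R)" by (rule reach_trans[OF _ reach_step])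
    show ?thesis by (rule reach_trans[OF aZ[OF cd(2)] reach_sym[OF ud]])
  qed (rule aZ)
  then show ?thesis unfolding bridge_def using ab abS u by blast
qed

text \<open>The first vertex of \<open>Z\<close> met from the right lies in \<open>Z0\<close> or in
  its mirror image; in the second case the whole picture is reflected.\<close>

lemma hcross_Y:
  assumes "hcross 0 m 0 (2 * n) \<tau>"
  shows "Y \<tau> \<or> Y ((`) \<sigma> ` \<tau>)"
proof -
  obtain u v where u: "u \<in> R" "fst u = m" and v: "v \<in> R" "fst v = 0" and uv: "(v, u) \<in> reach (\<tau> \<inter> edges_in R)"
    using assms unfolding crossing_def by blast
  have \<sigma>u: "\<sigma> u \<in> R" "fst (\<sigma> u) = m" using u \<sigma>_R by (auto simp: \<sigma>_def)
  show ?thesis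
  proof (cases "u \<in> Z")
    case True
    then show ?thesis
    proof (cases "u \<in> Z0")
      case True
      then show ?thesis using u unfolding Y_def by blast
    next
      case False
      then have "\<sigma> u \<in> Z0" using True by (auto simp: Z_def)
      then show ?thesis using \<sigma>u unfolding Y_def by blast
    qed
  next
    case False
    then obtain c d where uc: "(u, c) \<in> reach {e \<in> \<tau> \<inter> edges_in R. e \<inter> Z = {}}" and cd: "{c, d} \<in> \<tau> \<inter> edges_in R" "d \<in> Z"
      using reach_first_hit[OF reach_sym[OF uv] False] Z_separates[OF u(1) v(1) u(2) v(2) False] by blast
    show ?thesis
    proof (cases "d \<in> Z0")
      case True
      then show ?thesis using u False uc cd unfolding Y_def by blast
    next
      case False
      then have d: "\<sigma> d \<in> Z0" using cd(2) by (auto simp: Z_def)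
      have R\<sigma>: "(`) \<sigma> ` (\<tau> \<inter> edges_in R) = (`) \<sigma> ` \<tau> \<inter> edges_in R"
        using image_edges_Int[OF \<sigma>_aut, of \<tau> R] by (simp add: \<sigma>_R)
      have sub: "(`) \<sigma> ` {e \<in> \<tau> \<inter> edges_in R. e \<inter> Z = {}} \<subseteq> {e \<in> (`) \<sigma> ` \<tau> \<inter> edges_in R. e \<inter> Z = {}}"
      proof
        fix e assume "e \<in> (`) \<sigma> ` {e \<in> \<tau> \<inter> edges_in R. e \<inter> Z = {}}"
        then obtain e' where e': "e' \<in> \<tau> \<inter> edges_in R" "e' \<inter> Z = {}" "e = \<sigma> ` e'" by blast
        then have "e \<in> (`) \<sigma> ` \<tau> \<inter> edges_in R" using R\<sigma> by blast
        moreover have "e \<inter> Z = {}" using e'(2,3) \<sigma>_Z by blast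
        ultimately show "e \<in> {e \<in> (`) \<sigma> ` \<tau> \<inter> edges_in R. e \<inter> Z = {}}" by blast
      qed
      have "(\<sigma> u, \<sigma> c) \<in> reach {e \<in> (`) \<sigma> ` \<tau> \<inter> edges_in R. e \<inter> Z = {}}"
        using reach_image_edges[OF \<sigma>_aut uc] reach_mono[OF sub] by blast
      moreover have "{\<sigma> c, \<sigma> d} \<in> (`) \<sigma> ` \<tau> \<inter> edges_in R"
      proof -
        have "\<sigma> ` {c, d} \<in> (`) \<sigma> ` (\<tau> \<inter> edges_in R)" using cd(1) by (rule imageI)
        then show ?thesis unfolding R\<sigma> by simp
      qed
      moreover have "\<sigma> u \<notin> Z" using \<open>u \<notin> Z\<close> \<sigma>_Z by blast
      ultimately show ?thesis using \<sigma>u d unfolding Y_def by blast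
    qed
  qed
qed

text \<open>The reflection preserves the law of \<tau>, so \<open>Y\<close> has at least half the
  probability of a horizontal crossing.\<close>

lemma bridge_conditional:
  "hprob m (2 * n) / 2 \<le> pexp (1/2) (edges_in R) (\<lambda>\<tau>. of_bool (bridge n S R {v. fst v = m} ((\<omega> \<inter> J) \<union> (\<tau> - J))))"
proof -
  have "hprob m (2 * n) \<le> pexp (1/2) (edges_in R) (\<lambda>\<tau>. of_bool (Y \<tau>) + of_bool (Y ((`) \<sigma> ` \<tau>)))"
    unfolding hprob_def using hcross_Y by (intro pexp_half_mono) auto
  also have "\<dots> = 2 * pexp (1/2) (edges_in R) (\<lambda>\<tau>. of_bool (Y \<tau>))"
    using pexp_lattice_aut[OF \<sigma>_aut, of "1/2" R "\<lambda>\<tau>. of_bool (Y \<tau>)"] by (simp add: pexp_add \<sigma>_R)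
  also have "pexp (1/2) (edges_in R) (\<lambda>\<tau>. of_bool (Y \<tau>))
    \<le> pexp (1/2) (edges_in R) (\<lambda>\<tau>. of_bool (bridge n S R {v. fst v = m} ((\<omega> \<inter> J) \<union> (\<tau> - J))))"
    using Y_bridge by (intro pexp_half_mono) auto
  finally show ?thesis by simp
qed

end

text \<open>The conditional bound holds for every outcome with a vertical crossing; averaging with
  \<open>pexp_stopping_set\<close> multiplies it by the probability of that crossing.\<close>

lemma bridge_bound:
  assumes n: "1 \<le> n" "n \<le> m"
  shows "hprob n n * hprob m (2 * n) / 2 \<le>
    pexp (1/2) (edges_in (rect 0 m 0 (2 * n))) (\<lambda>\<omega>. of_bool (bridge n (rect 0 n 0 n) (rect 0 m 0 (2 * n)) {v. fst v = m} \<omega>))"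
proof -
  let ?S = "rect 0 n 0 n" and ?R = "rect 0 m 0 (2 * n)"
  let ?E = "edges_in ?R"
  let ?J = "left_explored n ?E"
  let ?X = "\<lambda>\<omega>. of_bool (bridge n ?S ?R {v. fst v = m} \<omega>) :: real"
  have SR: "?S \<subseteq> ?R" using n by (auto simp: mem_rect)
  have "hprob n n = pexp (1/2) ?E (\<lambda>\<omega>. of_bool (vcross 0 n 0 n \<omega>))"
    using pexp_vcross[of 0 n 0 n] pexp_crossing_restrict[OF _ edges_in_mono[OF SR]] by simp
  then have "hprob n n * hprob m (2 * n) / 2 = pexp (1/2) ?E (\<lambda>\<omega>. of_bool (vcross 0 n 0 n \<omega>) * (hprob m (2 * n) / 2))"
    unfolding pexp_cmult_right by simp
  also have "\<dots> \<le> pexp (1/2) ?E (\<lambda>\<omega>. pexp (1/2) ?E (\<lambda>\<tau>. ?X ((\<omega> \<inter> ?J \<omega>) \<union> (\<tau> - ?J \<omega>))))"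
  proof (rule pexp_half_mono)
    fix \<omega> assume \<omega>: "\<omega> \<subseteq> ?E"
    show "of_bool (vcross 0 n 0 n \<omega>) * (hprob m (2 * n) / 2) \<le> pexp (1/2) ?E (\<lambda>\<tau>. ?X ((\<omega> \<inter> ?J \<omega>) \<union> (\<tau> - ?J \<omega>)))"
    proof (cases "vcross 0 n 0 n \<omega>")
      case True
      from vcross_left_explored[OF n(1) \<omega> True]
      obtain a b where "a \<in> ?S" "b \<in> ?S" "snd a = 0" "snd b = n" "(a, b) \<in> reach (\<omega> \<inter> ?J \<omega> \<inter> edges_in ?S)"
        unfolding crossing_def by blast
      then interpret rsw_step n m \<omega> a b using n \<omega> by unfold_locales
      show ?thesis using bridge_conditional True by simp
    next
      case False
      then show ?thesis by (auto intro!: pexp_half_nonneg)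
    qed
  qed
  also have "\<dots> = pexp (1/2) ?E ?X"
    by (rule pexp_stopping_set[OF _ stopping_set_left_explored]) simp
  finally show ?thesis .
qed

text \<open>A horizontal crossing of the square meets both vertical crossings contained in the
  bridges, which connects the two far sides.\<close>

lemma bridges_glue:
  assumes n: "1 \<le> n" "n \<le> m"
    and X: "bridge n (rect 0 n 0 n) (rect 0 m 0 (2 * n)) {v. fst v = m} \<omega>"
    and X': "bridge n (rect 0 n 0 n) (rect (n - m) n 0 (2 * n)) {v. fst v = n - m} \<omega>"
    and H: "hcross 0 n 0 n \<omega>"
  shows "hcross (n - m) m 0 (2 * n) \<omega>"
proof -
  let ?S = "rect 0 n 0 n" and ?Q = "rect (n - m) m 0 (2 * n)"
  let ?rQ = "reach (\<omega> \<inter> edges_in ?Q)"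
  obtain a b where ab: "a \<in> ?S" "fst a = 0" "fst b = n" "(a, b) \<in> reach (\<omega> \<inter> edges_in ?S)"
    using H unfolding crossing_def by blast
  have toQ: "(x, y) \<in> ?rQ" if "(x, y) \<in> reach (\<omega> \<inter> edges_in \<Lambda>)" "\<Lambda> \<subseteq> ?Q" for x y \<Lambda>
  proof -
    have "\<omega> \<inter> edges_in \<Lambda> \<subseteq> \<omega> \<inter> edges_in ?Q" using edges_in_mono[OF that(2)] by blast
    from subsetD[OF reach_mono[OF this] that(1)] show ?thesis .
  qed
  have SQ: "?S \<subseteq> ?Q" using n by (auto simp: mem_rect)
  have meet: "(a, s) \<in> ?rQ" if s: "s \<in> ?S" "snd s = 0" "snd t = n" "(s, t) \<in> reach (\<omega> \<inter> edges_in ?S)" for s t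
  proof -
    obtain P where P: "walk (\<omega> \<inter> edges_in ?S) P" "hd P = s" "last P = t" "\<And>z. z \<in> set P \<Longrightarrow> (s, z) \<in> reach (\<omega> \<inter> edges_in ?S)"
      using s(4) by (rule reach_walk) blast
    have wP: "walk lattice_edges P"
      using P(1) unfolding walk_def by (auto intro: successively_mono simp: edges_in_def)
    have PS: "z \<in> ?S" if "z \<in> set P" for z using reach_edges_in_closed[OF P(4)[OF that] s(1)] .
    have sub: "\<omega> \<inter> edges_in ?S \<subseteq> edges_in {z. 0 \<le> snd z \<and> snd z \<le> n}"
      by (rule le_infI2[OF edges_in_mono]) (auto simp: mem_rect)
    obtain z where z: "z \<in> set P" "(a, z) \<in> reach (\<omega> \<inter> edges_in ?S)"
    proof (rule reach_meets_walk[OF wP _ _ ab(4) sub])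
      show "snd (hd P) \<le> 0" "n \<le> snd (last P)" using s(2,3) by (simp_all add: P(2,3))
      show "0 \<le> snd a" "snd a \<le> n" using ab(1) by (simp_all add: mem_rect)
      show "\<forall>z\<in>set P. fst a \<le> fst z" "\<forall>z\<in>set P. fst z \<le> fst b" using PS ab(2,3) by (simp_all add: mem_rect)
    qed blast
    have "(a, s) \<in> reach (\<omega> \<inter> edges_in ?S)" by (rule reach_trans[OF z(2) reach_sym[OF P(4)[OF z(1)]]])
    then show ?thesis by (rule toQ[OF _ SQ])
  qed
  obtain s t u where 1: "s \<in> ?S" "snd s = 0" "snd t = n" "(s, t) \<in> reach (\<omega> \<inter> edges_in ?S)"
    "u \<in> rect 0 m 0 (2 * n)" "fst u = m" "(s, u) \<in> reach (\<omega> \<inter> edges_in (rect 0 m 0 (2 * n)))"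
    using X unfolding bridge_def by blast
  obtain s' t' u' where 2: "s' \<in> ?S" "snd s' = 0" "snd t' = n" "(s', t') \<in> reach (\<omega> \<inter> edges_in ?S)"
    "u' \<in> rect (n - m) n 0 (2 * n)" "fst u' = n - m" "(s', u') \<in> reach (\<omega> \<inter> edges_in (rect (n - m) n 0 (2 * n)))"
    using X' unfolding bridge_def by blast
  have sub: "rect 0 m 0 (2 * n) \<subseteq> ?Q" "rect (n - m) n 0 (2 * n) \<subseteq> ?Q" using n by (auto simp: mem_rect)
  have "(a, u) \<in> ?rQ" by (rule reach_trans[OF meet[OF 1(1-4)] toQ[OF 1(7) sub(1)]])
  moreover have "(a, u') \<in> ?rQ" by (rule reach_trans[OF meet[OF 2(1-4)] toQ[OF 2(7) sub(2)]])
  ultimately have "(u', u) \<in> ?rQ" using reach_sym reach_trans by metis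
  moreover have "u \<in> ?Q" "u' \<in> ?Q" using 1(5) 2(5) sub by auto
  ultimately show ?thesis using 1(6) 2(6) unfolding crossing_def by blast
qed

text \<open>Harris for three increasing events: each bridge has probability at least (1/2) c / 2 = c
  / 4 and the square crossing at least 1/2, with product c^2 / 32. The glued rectangle extends from
  n - m to m.\<close>

lemma hprob_extend:
  assumes n: "1 \<le> n" "n \<le> m" and c: "0 \<le> c" "c \<le> hprob m (2 * n)"
  shows "c\<^sup>2 / 32 \<le> hprob (2 * m - n) (2 * n)"
proof -
  let ?S = "rect 0 n 0 n" and ?R = "rect 0 m 0 (2 * n)" and ?R' = "rect (n - m) n 0 (2 * n)"
    and ?Q = "rect (n - m) m 0 (2 * n)"
  let ?E = "edges_in ?Q"
  let ?X = "\<lambda>\<omega>. of_bool (bridge n ?S ?R {v. fst v = m} \<omega>) :: real"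
  let ?X' = "\<lambda>\<omega>. of_bool (bridge n ?S ?R' {v. fst v = n - m} \<omega>) :: real"
  let ?H = "\<lambda>\<omega>. of_bool (hcross 0 n 0 n \<omega>) :: real"
  \<comment> \<open>The reflection in the vertical axis of the square fixes the square and exchanges
    the two long rectangles.\<close>
  let ?T = "\<lambda>v :: vertex. (n - fst v, snd v)"
  have T: "lattice_aut ?T" by (rule lattice_aut_reflect_fst)
  have Tim: "?T ` A = {v. ?T v \<in> A}" for A
  proof (intro set_eqI iffI)
    fix v assume "v \<in> {v. ?T v \<in> A}"
    then show "v \<in> ?T ` A" by (intro image_eqI[of _ _ "?T v"]) auto
  qed auto
  have TS: "?T ` ?S = ?S" and TR: "?T ` ?R = ?R'" and TB: "?T ` {v. fst v = m} = {v. fst v = n - m}"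
    unfolding Tim by (auto simp: mem_rect)
  have sub: "?S \<subseteq> ?R" "?S \<subseteq> ?R'" "?R \<subseteq> ?Q" "?R' \<subseteq> ?Q" "?S \<subseteq> ?Q" using n by (auto simp: mem_rect)
  have b: "hprob n n * hprob m (2 * n) / 2 \<le> pexp (1/2) (edges_in ?R) ?X" by (rule bridge_bound[OF n])
  have sq: "1/2 \<le> hprob n n" using n by (intro hprob_square) simp
  have "c / 4 = (1/2) * c / 2" by simp
  also have "\<dots> \<le> hprob n n * hprob m (2 * n) / 2" using sq c by (intro divide_right_mono mult_mono) auto
  finally have X0: "c / 4 \<le> pexp (1/2) (edges_in ?R) ?X" using b by linarith
  have X: "c / 4 \<le> pexp (1/2) ?E ?X"
  proof -
    have "pexp (1/2) ?E ?X = pexp (1/2) (edges_in ?R) ?X"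
      by (rule pexp_restrict[OF _ edges_in_mono[OF sub(3)]]) (simp, subst bridge_restrict[OF sub(1)], rule refl)
    then show ?thesis using X0 by simp
  qed
  have X': "c / 4 \<le> pexp (1/2) ?E ?X'"
  proof -
    have "pexp (1/2) ?E ?X' = pexp (1/2) (edges_in ?R') ?X'"
      by (rule pexp_restrict[OF _ edges_in_mono[OF sub(4)]]) (simp, subst bridge_restrict[OF sub(2)], rule refl)
    also have "\<dots> = pexp (1/2) (edges_in ?R) (\<lambda>\<omega>. ?X' ((`) ?T ` \<omega>))"
      using pexp_lattice_aut[OF T, of "1/2" ?R ?X'] unfolding TR .
    also have "\<dots> = pexp (1/2) (edges_in ?R) ?X"
      using bridge_image[OF T, of n ?S ?R "{v. fst v = m}"] unfolding TS TR TB by simp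
    finally show ?thesis using X0 by simp
  qed
  have H: "1/2 \<le> pexp (1/2) ?E ?H"
    using sq pexp_crossing_restrict[OF _ edges_in_mono[OF sub(5)], of "1/2"] unfolding hprob_def by simp
  have mono: "?X \<omega> \<le> ?X \<omega>'" "?X' \<omega> \<le> ?X' \<omega>'" "?H \<omega> \<le> ?H \<omega>'" if "\<omega> \<subseteq> \<omega>'" for \<omega> \<omega>'
    using bridge_mono[OF that] crossing_mono[OF that] by auto
  have fin: "finite ?E" by simp
  have "c\<^sup>2 / 32 = (c / 4) * (c / 4) * (1/2)" by (simp add: power2_eq_square)
  also have "\<dots> \<le> pexp (1/2) ?E ?X * pexp (1/2) ?E ?X' * pexp (1/2) ?E ?H"
    using X X' H c by (intro mult_mono) auto
  also have "\<dots> \<le> pexp (1/2) ?E (\<lambda>\<omega>. ?X \<omega> * ?X' \<omega>) * pexp (1/2) ?E ?H"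
    using H by (intro mult_right_mono Harris[OF fin]) (use mono in auto)
  also have "\<dots> \<le> pexp (1/2) ?E (\<lambda>\<omega>. ?X \<omega> * ?X' \<omega> * ?H \<omega>)"
    by (intro Harris[OF fin]) (use mono in \<open>auto intro!: mult_mono\<close>)
  also have "\<dots> \<le> pexp (1/2) ?E (\<lambda>\<omega>. of_bool (hcross (n - m) m 0 (2 * n) \<omega>))"
    using bridges_glue[OF n] by (intro pexp_half_mono) auto
  also have "\<dots> = hprob (2 * m - n) (2 * n)" using pexp_hcross[of "n - m" m 0 "2 * n"] by simp
  finally show ?thesis .
qed

theorem RSW: obtains c :: real where "0 < c" "\<And>n. 1 \<le> n \<Longrightarrow> c \<le> hprob (9 * n) (2 * n)"
proof -
  define f where "f = (\<lambda>c :: real. c\<^sup>2 / 32)"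
  have pos: "0 < f c" if "0 < c" for c using that by (simp add: f_def)
  \<comment> \<open>Each extension replaces the width m by 2m - n, so the widths are 2n, 3n, 5n, 9n.
    The ratio 9 : 2 is what the annuli will require.\<close>
  have "f (f (f (1/2))) \<le> hprob (9 * n) (2 * n)" if n: "1 \<le> n" for n
  proof -
    have "1/2 \<le> hprob (2 * n) (2 * n)" using n by (intro hprob_square) simp
    then have "f (1/2) \<le> hprob (3 * n) (2 * n)"
      using hprob_extend[OF n, of "2 * n" "1/2"] n by (simp add: f_def)
    then have "f (f (1/2)) \<le> hprob (5 * n) (2 * n)"
      using hprob_extend[OF n, of "3 * n" "f (1/2)"] n by (simp add: f_def)
    then show ?thesis
      using hprob_extend[OF n, of "5 * n" "f (f (1/2))"] n by (simp add: f_def)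
  qed
  moreover have "0 < f (f (f (1/2)))" by (intro pos) simp
  ultimately show ?thesis using that by blast
qed

section \<open>Annuli and arm events\<close>

definition sup_norm :: "vertex \<Rightarrow> int" where "sup_norm v = max \<bar>fst v\<bar> \<bar>snd v\<bar>"

definition annulus :: "nat \<Rightarrow> vertex set" where
  "annulus j = {v. 3 ^ j \<le> sup_norm v \<and> sup_norm v < 3 ^ Suc j}"

definition annulus_crossing :: "nat \<Rightarrow> edge set \<Rightarrow> bool" where
  "annulus_crossing j = crossing (annulus j) {v. sup_norm v = 3 ^ j} {v. sup_norm v = 3 ^ Suc j - 1}"

lemma lipschitz1_sup_norm: "lipschitz1 sup_norm"
  unfolding lipschitz1_def lattice_edges_iff sup_norm_def by (auto simp: max_def abs_if)

lemma finite_annulus [simp]: "finite (annulus j)"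
proof (rule finite_subset)
  show "annulus j \<subseteq> rect (- (3 ^ Suc j)) (3 ^ Suc j) (- (3 ^ Suc j)) (3 ^ Suc j)"
    by (auto simp: annulus_def sup_norm_def mem_rect)
qed simp

text \<open>An annulus crossing must cross one of four rectangles the short way. By duality with RSW
  each such crossing fails with probability at least c, and by Harris for decreasing events all four
  fail with probability at least c^4.\<close>

lemma annulus_blocked:
  obtains c :: real where "0 < c" "c \<le> 1"
    "\<And>j. 1 \<le> j \<Longrightarrow> pexp (1/2) (edges_in (annulus j)) (\<lambda>\<omega>. of_bool (annulus_crossing j \<omega>)) \<le> 1 - c"
proof -
  obtain c where c: "0 < c" "\<And>n. 1 \<le> n \<Longrightarrow> c \<le> hprob (9 * n) (2 * n)" by (rule RSW) blast
  have hp1: "hprob w h \<le> 1" for w h unfolding hprob_def by (rule pexp_le_const) auto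
  have c1: "c \<le> 1" using c(2)[of 1] hp1[of 9 2] by simp
  have "pexp (1/2) (edges_in (annulus j)) (\<lambda>\<omega>. of_bool (annulus_crossing j \<omega>)) \<le> 1 - c ^ 4" if j: "1 \<le> j" for j
  proof -
    let ?E = "edges_in (annulus j)"
    \<comment> \<open>With a = n + 1 and b = 3n + 2 the rectangles have width 2n + 1 and length 6n +
      4, which is at most 9n - 1 for n \<ge> 2. The dual of the 2n + 1 by 9n - 1 crossing is the RSW
      crossing of a 9n by 2n rectangle.\<close>
    define a b n where "a = (3 ^ j :: int)" and "b = (3 ^ Suc j - 1 :: int)" and "n = (3 ^ j - 1 :: int)"
    have "(3 :: int) ^ 1 \<le> 3 ^ j" using j by (intro power_increasing) auto
    then have n: "2 \<le> n" "b - a = 2 * n + 1" "2 * b = 6 * n + 4" "0 < a" "a \<le> b" by (auto simp: a_def b_def n_def)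
    let ?B = "rect a b (- b) b"
    have B: "hprob (b - a) (b - (- b)) \<le> 1 - c"
    proof -
      have "hprob (b - a) (b - (- b)) \<le> hprob (2 * n + 1) (9 * n - 1)"
        using n by (simp add: hprob_mono_height)
      moreover have "hprob (9 * n) (2 * n) + hprob (2 * n + 1) (9 * n - 1) = 1" using n by (intro hprob_dual) auto
      ultimately show ?thesis using c(2)[of n] n by simp
    qed
    have ann: "v \<in> annulus j \<longleftrightarrow> a \<le> sup_norm v \<and> sup_norm v \<le> b" for v
      by (auto simp: annulus_def a_def b_def)
    define K where "K = (\<lambda>T :: vertex \<Rightarrow> vertex. crossing (T ` ?B) (T ` {v. fst v = a}) (T ` {v. fst v = b}))"
    define good where "good = (\<lambda>T :: vertex \<Rightarrow> vertex. lattice_aut T \<and> (\<forall>v. T (T v) = v) \<and> (\<forall>v. sup_norm (T v) = sup_norm v))"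
    have sub: "T ` ?B \<subseteq> annulus j" if "good T" for T
    proof
      fix z assume "z \<in> T ` ?B"
      then obtain v where v: "z = T v" "v \<in> ?B" by blast
      then have "sup_norm z = sup_norm v" using that by (simp add: good_def)
      then show "z \<in> annulus j" using v(2) n(4) unfolding ann by (auto simp: mem_rect sup_norm_def)
    qed
    have K: "c \<le> pexp (1/2) ?E (\<lambda>\<omega>. 1 - of_bool (K T \<omega>))" if "good T" for T
    proof -
      have "pexp (1/2) ?E (\<lambda>\<omega>. of_bool (K T \<omega>)) = pexp (1/2) (edges_in (T ` ?B)) (\<lambda>\<omega>. of_bool (K T \<omega>))"
        unfolding K_def by (rule pexp_crossing_restrict[OF _ edges_in_mono[OF sub[OF that]]]) simp
      also have "\<dots> = hprob (b - a) (b - (- b))"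
        using that pexp_crossing_image[of T "1/2" ?B] pexp_hcross[of a b "- b" b] unfolding K_def good_def by simp
      finally show ?thesis using B by (simp add: pexp_diff)
    qed
    \<comment> \<open>If the connection ends on the side of the outer square selected by
      \<open>T\<close>, the coordinate \<open>fst\<close> after \<open>T\<close> rises from at most
      a to b. The piece between these levels lies in the rectangle, because all coordinates are
      bounded by b inside the annulus.\<close>
    have cover: "K T \<omega>" if T: "good T" and u: "(u, v) \<in> reach (\<omega> \<inter> ?E)" "u \<in> annulus j" "sup_norm u = a" "fst (T v) = b"
      for T \<omega> u v
    proof -
      have l: "lipschitz1 (\<lambda>v. fst (T v))"
        using lipschitz1_fst T unfolding lipschitz1_def good_def lattice_aut_def by blast
      have "sup_norm (T u) = a" using T u(3) by (simp add: good_def)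
      then have ua: "fst (T u) \<le> a" by (auto simp: sup_norm_def)
      obtain x y where xy: "x \<in> annulus j" "y \<in> annulus j" "fst (T x) = a" "fst (T y) = b"
        "(x, y) \<in> reach (\<omega> \<inter> edges_in (annulus j \<inter> {z. a \<le> fst (T z) \<and> fst (T z) \<le> b}))"
        by (rule reach_band[OF l u(1,2) ua n(5)]) (use u(4) in auto)
      have S: "annulus j \<inter> {z. a \<le> fst (T z) \<and> fst (T z) \<le> b} \<subseteq> T ` ?B"
      proof
        fix z assume z: "z \<in> annulus j \<inter> {z. a \<le> fst (T z) \<and> fst (T z) \<le> b}"
        then have "sup_norm (T z) \<le> b" using T unfolding good_def Int_iff ann by simp
        then have "T z \<in> ?B" using z by (auto simp: mem_rect sup_norm_def)
        moreover have "z = T (T z)" using T by (simp add: good_def)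
        ultimately show "z \<in> T ` ?B" by blast
      qed
      have "x \<in> T ` ?B" "y \<in> T ` ?B" using S xy n(5) by auto
      moreover have "x \<in> T ` {v. fst v = a}" "y \<in> T ` {v. fst v = b}"
        using xy(3,4) T by (auto simp: good_def intro!: image_eqI[of _ T "T _"])
      moreover have "(x, y) \<in> reach (\<omega> \<inter> edges_in (T ` ?B))"
      proof -
        have "\<omega> \<inter> edges_in (annulus j \<inter> {z. a \<le> fst (T z) \<and> fst (T z) \<le> b}) \<subseteq> \<omega> \<inter> edges_in (T ` ?B)"
          using edges_in_mono[OF S] by blast
        from subsetD[OF reach_mono[OF this] xy(5)] show ?thesis .
      qed
      ultimately show ?thesis unfolding K_def crossing_def by blast
    qed
    let ?T1 = "\<lambda>v :: vertex. (0 + fst v, 0 + snd v)" and ?T2 = "\<lambda>v :: vertex. (0 - fst v, snd v)"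
      and ?T3 = "\<lambda>v :: vertex. (snd v, fst v)" and ?T4 = "\<lambda>v :: vertex. (- snd v, - fst v)"
    have aut4: "lattice_aut ?T4" by (rule lattice_autI[of ?T4]) (auto simp: abs_minus_commute)
    have good: "good ?T1" "good ?T2" "good ?T3" "good ?T4"
      using lattice_aut_translate[of 0 0] lattice_aut_reflect_fst[of 0] lattice_aut_transpose aut4
      unfolding good_def by (auto simp: sup_norm_def max.commute)
    have four: "K ?T1 \<omega> \<or> K ?T2 \<omega> \<or> K ?T3 \<omega> \<or> K ?T4 \<omega>" if cr: "annulus_crossing j \<omega>" for \<omega>
    proof -
      obtain u v where uv: "u \<in> annulus j" "sup_norm u = a" "sup_norm v = b" "(u, v) \<in> reach (\<omega> \<inter> ?E)"
        using cr unfolding annulus_crossing_def crossing_def a_def b_def by blast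
      have "fst (?T1 v) = b \<or> fst (?T2 v) = b \<or> fst (?T3 v) = b \<or> fst (?T4 v) = b"
        using uv(3) by (auto simp: sup_norm_def max_def abs_if split: if_splits)
      then show ?thesis using good cover uv by blast
    qed
    define D where "D = (\<lambda>T \<omega>. 1 - of_bool (K T \<omega>) :: real)"
    have anti: "D T \<omega>' \<le> D T \<omega>" if "\<omega> \<subseteq> \<omega>'" for T \<omega> \<omega>'
      using crossing_mono[OF that] unfolding D_def K_def by auto
    have D0: "0 \<le> D T \<omega>" for T \<omega> by (simp add: D_def)
    have fin: "finite ?E" by simp
    have DK: "c \<le> pexp (1/2) ?E (D T)" if "good T" for T
      using K[OF that] by (simp add: D_def)
    have "c ^ 4 = c * c * c * c" by (simp add: power4_eq_xxxx)
    also have "\<dots> \<le> pexp (1/2) ?E (D ?T1) * pexp (1/2) ?E (D ?T2) * pexp (1/2) ?E (D ?T3) * pexp (1/2) ?E (D ?T4)"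
      using DK[OF good(1)] DK[OF good(2)] DK[OF good(3)] DK[OF good(4)] c(1) by (intro mult_mono mult_nonneg_nonneg) auto
    also have "\<dots> \<le> pexp (1/2) ?E (\<lambda>\<omega>. D ?T1 \<omega> * D ?T2 \<omega>) * pexp (1/2) ?E (D ?T3) * pexp (1/2) ?E (D ?T4)"
      by (intro mult_right_mono Harris_antimono[OF fin]) (auto intro: anti pexp_half_nonneg D0)
    also have "\<dots> \<le> pexp (1/2) ?E (\<lambda>\<omega>. D ?T1 \<omega> * D ?T2 \<omega> * D ?T3 \<omega>) * pexp (1/2) ?E (D ?T4)"
      by (intro mult_right_mono Harris_antimono[OF fin]) (auto intro: anti pexp_half_nonneg D0 mult_mono)
    also have "\<dots> \<le> pexp (1/2) ?E (\<lambda>\<omega>. D ?T1 \<omega> * D ?T2 \<omega> * D ?T3 \<omega> * D ?T4 \<omega>)"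
      by (intro Harris_antimono[OF fin]) (auto intro!: anti D0 mult_mono mult_nonneg_nonneg)
    also have "\<dots> \<le> pexp (1/2) ?E (\<lambda>\<omega>. 1 - of_bool (annulus_crossing j \<omega>))"
    proof (rule pexp_half_mono)
      fix \<omega>
      show "D ?T1 \<omega> * D ?T2 \<omega> * D ?T3 \<omega> * D ?T4 \<omega> \<le> 1 - of_bool (annulus_crossing j \<omega>)"
      proof (cases "annulus_crossing j \<omega>")
        case True
        then show ?thesis using four[OF True] unfolding D_def by auto
      next
        case False
        have "D T \<omega> \<le> 1" for T by (simp add: D_def)
        then have "D ?T1 \<omega> * D ?T2 \<omega> * D ?T3 \<omega> * D ?T4 \<omega> \<le> 1 * 1 * 1 * 1"
          using D0 by (intro mult_mono mult_nonneg_nonneg) auto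
        then show ?thesis using False by simp
      qed
    qed
    finally show ?thesis using fin by (simp add: pexp_diff)
  qed
  moreover have "0 < c ^ 4" "c ^ 4 \<le> 1" using c(1) c1 by (auto intro: power_le_one)
  ultimately show ?thesis using that by blast
qed

section \<open>Translated annuli and quenched bounds on arms\<close>

definition annulus_at :: "vertex \<Rightarrow> nat \<Rightarrow> vertex set" where
  "annulus_at v j = {z. 3 ^ j \<le> sup_norm (z - v) \<and> sup_norm (z - v) < 3 ^ Suc j}"

definition annulus_crossing_at :: "vertex \<Rightarrow> nat \<Rightarrow> edge set \<Rightarrow> bool" where
  "annulus_crossing_at v j = crossing (annulus_at v j)
     {z. sup_norm (z - v) = 3 ^ j} {z. sup_norm (z - v) = 3 ^ Suc j - 1}"

definition shift :: "vertex \<Rightarrow> vertex \<Rightarrow> vertex" where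
  "shift v z = (fst z + fst v, snd z + snd v)"

lemma shift_aut: "lattice_aut (shift v)"
  using lattice_aut_translate[of "fst v" "snd v"] by (simp add: shift_def[abs_def])

lemma shift_image: "shift v ` {z. P z} = {z. P (z - v)}"
proof (intro set_eqI iffI)
  fix z assume "z \<in> {z. P (z - v)}"
  then show "z \<in> shift v ` {z. P z}"
    by (intro image_eqI[of _ _ "z - v"]) (auto simp: shift_def prod_eq_iff)
next
  fix z assume "z \<in> shift v ` {z. P z}"
  then obtain w where "z = shift v w" "P w" by blast
  moreover have "shift v w - v = w" by (simp add: shift_def prod_eq_iff)
  ultimately show "z \<in> {z. P (z - v)}" by simp
qed

lemma annulus_at_shift: "annulus_at v j = shift v ` annulus j"
  unfolding annulus_at_def annulus_def shift_image ..

lemma finite_annulus_at [simp]: "finite (annulus_at v j)"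
  by (simp add: annulus_at_shift)

lemma annulus_crossing_at_shift: "annulus_crossing_at v j ((`) (shift v) ` \<omega>) = annulus_crossing j \<omega>"
  unfolding annulus_crossing_at_def annulus_crossing_def annulus_at_shift
    shift_image[of v "\<lambda>z. sup_norm z = _", symmetric]
  by (rule crossing_image[OF shift_aut])

lemma annulus_crossing_at_restrict:
  "annulus_crossing_at v j \<omega> = annulus_crossing_at v j (\<omega> \<inter> edges_in (annulus_at v j))"
  unfolding annulus_crossing_at_def by (rule crossing_restrict)

lemma annulus_at_disjoint: "i \<noteq> j \<Longrightarrow> annulus_at v i \<inter> annulus_at v j = {}"
proof -
  have "annulus_at v i \<inter> annulus_at v j = {}" if "i < j" for i j
  proof -
    have "(3 :: int) ^ Suc i \<le> 3 ^ j" using that by (intro power_increasing) auto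
    then show ?thesis by (force simp: annulus_at_def)
  qed
  then show "i \<noteq> j \<Longrightarrow> annulus_at v i \<inter> annulus_at v j = {}" by (metis Int_commute linorder_neqE_nat)
qed

lemma lipschitz1_dist: "lipschitz1 (\<lambda>z. sup_norm (z - v))"
  unfolding lipschitz1_def lattice_edges_iff sup_norm_def by (auto simp: max_def abs_if)

lemma arm_annulus_crossing:
  assumes "(v, w) \<in> reach (\<omega> \<inter> edges_in \<Lambda>)" "v \<in> \<Lambda>" "3 ^ L \<le> sup_norm (w - v)" "j < L"
  shows "annulus_crossing_at v j \<omega>"
proof -
  have "(3 :: int) ^ Suc j \<le> 3 ^ L" using assms(4) by (intro power_increasing) auto
  then have hi: "3 ^ Suc j - 1 \<le> sup_norm (w - v)" using assms(3) by linarith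
  have lo: "sup_norm (v - v) \<le> 3 ^ j" by (simp add: sup_norm_def)
  have lohi: "(3 :: int) ^ j \<le> 3 ^ Suc j - 1" using one_le_power[of "3 :: int" j] by simp
  obtain a b where ab: "a \<in> \<Lambda>" "b \<in> \<Lambda>" "sup_norm (a - v) = 3 ^ j" "sup_norm (b - v) = 3 ^ Suc j - 1"
    "(a, b) \<in> reach (\<omega> \<inter> edges_in (\<Lambda> \<inter> {z. 3 ^ j \<le> sup_norm (z - v) \<and> sup_norm (z - v) \<le> 3 ^ Suc j - 1}))"
    by (rule reach_band[OF lipschitz1_dist assms(1,2) lo lohi hi]) blast
  have "\<Lambda> \<inter> {z. 3 ^ j \<le> sup_norm (z - v) \<and> sup_norm (z - v) \<le> 3 ^ Suc j - 1} \<subseteq> annulus_at v j"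
    by (auto simp: annulus_at_def)
  from edges_in_mono[OF this] have "\<omega> \<inter> edges_in (\<Lambda> \<inter> {z. 3 ^ j \<le> sup_norm (z - v) \<and> sup_norm (z - v) \<le> 3 ^ Suc j - 1})
      \<subseteq> \<omega> \<inter> edges_in (annulus_at v j)" by blast
  from subsetD[OF reach_mono[OF this] ab(5)] have "(a, b) \<in> reach (\<omega> \<inter> edges_in (annulus_at v j))" .
  moreover have "a \<in> annulus_at v j" "b \<in> annulus_at v j" using ab(3,4) lohi by (simp_all add: annulus_at_def)
  ultimately show ?thesis using ab(3,4) unfolding annulus_crossing_at_def crossing_def by blast
qed

definition annulus_prob :: "real \<Rightarrow> vertex \<Rightarrow> nat \<Rightarrow> edge set \<Rightarrow> real" where
  "annulus_prob p v j \<psi> = pexp p (edges_in (annulus_at v j)) (\<lambda>\<xi>. of_bool (annulus_crossing_at v j (\<psi> \<inter> \<xi>)))"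

text \<open>A product because disjoint annuli are independent under the law of \<xi>. It starts at 1
  as the RSW bound for annuli is stated from there on.\<close>

definition arm_bound :: "real \<Rightarrow> vertex \<Rightarrow> nat \<Rightarrow> edge set \<Rightarrow> real" where
  "arm_bound p v L \<psi> = (\<Prod>j\<in>{1..<L}. annulus_prob p v j \<psi>)"

lemma annulus_prob_bounds:
  assumes "0 \<le> p" "p \<le> 1"
  shows "0 \<le> annulus_prob p v j \<psi>" "annulus_prob p v j \<psi> \<le> 1"
  unfolding annulus_prob_def using assms by (auto intro: pexp_nonneg pexp_le_const)

lemma arm_bound_nonneg: "0 \<le> p \<Longrightarrow> p \<le> 1 \<Longrightarrow> 0 \<le> arm_bound p v L \<psi>"
  unfolding arm_bound_def by (intro prod_nonneg annulus_prob_bounds) auto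

lemma annulus_prob_restrict: "annulus_prob p v j \<psi> = annulus_prob p v j (\<psi> \<inter> edges_in (annulus_at v j))"
  unfolding annulus_prob_def
proof (intro pexp_cong refl arg_cong[of _ _ of_bool])
  fix \<xi>
  show "annulus_crossing_at v j (\<psi> \<inter> \<xi>) = annulus_crossing_at v j (\<psi> \<inter> edges_in (annulus_at v j) \<inter> \<xi>)"
    by (subst (1 2) annulus_crossing_at_restrict) (simp add: Int_ac)
qed

lemma annulus_prob_shift: "annulus_prob p v j ((`) (shift v) ` \<psi>) = annulus_prob p 0 j \<psi>"
proof -
  have inj: "inj (shift v)" using shift_aut by (simp add: lattice_aut_def bij_def)
  have "annulus_prob p v j ((`) (shift v) ` \<psi>)
    = pexp p (edges_in (annulus j)) (\<lambda>\<xi>. of_bool (annulus_crossing_at v j ((`) (shift v) ` \<psi> \<inter> (`) (shift v) ` \<xi>)))"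
    unfolding annulus_prob_def annulus_at_shift by (rule pexp_lattice_aut[OF shift_aut])
  also have "\<dots> = pexp p (edges_in (annulus j)) (\<lambda>\<xi>. of_bool (annulus_crossing j (\<psi> \<inter> \<xi>)))"
  proof (intro pexp_cong refl arg_cong[of _ _ of_bool])
    fix \<xi>
    have "(`) (shift v) ` \<psi> \<inter> (`) (shift v) ` \<xi> = (`) (shift v) ` (\<psi> \<inter> \<xi>)"
      by (rule image_Int[symmetric]) (simp add: inj_def inj_image_eq_iff[OF inj])
    then show "annulus_crossing_at v j ((`) (shift v) ` \<psi> \<inter> (`) (shift v) ` \<xi>) = annulus_crossing j (\<psi> \<inter> \<xi>)"
      by (simp add: annulus_crossing_at_shift)
  qed
  also have "\<dots> = annulus_prob p 0 j \<psi>"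
    by (simp add: annulus_prob_def annulus_crossing_at_def annulus_crossing_def annulus_at_def annulus_def)
  finally show ?thesis .
qed

text \<open>A connection to distance 3^L crosses every annulus of index below L, and for fixed
  \<psi> these crossings are independent.\<close>

lemma far_reaching_arm_bound:
  assumes p: "0 \<le> p" "p \<le> 1" and fin: "finite \<Lambda>" and v: "v \<in> \<Lambda>"
    and l: "\<And>z. \<bar>l v - l z\<bar> \<le> sup_norm (z - v)"
  shows "pexp p (edges_in \<Lambda>) (\<lambda>\<xi>. of_bool (far_reaching l \<Lambda> (3 ^ L) v (\<psi> \<inter> \<xi>))) \<le> arm_bound p v L \<psi>"
proof -
  define A where "A = (\<lambda>j. edges_in (annulus_at v j))"
  \<comment> \<open>Annuli around \<open>v\<close> may leave \<open>\<Lambda>\<close>, so their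
    edges are added before the events are compared.\<close>
  define E where "E = edges_in \<Lambda> \<union> (\<Union>j\<in>{1..<L}. A j)"
  have finE: "finite E" using fin by (simp add: E_def A_def)
  have "pexp p (edges_in \<Lambda>) (\<lambda>\<xi>. of_bool (far_reaching l \<Lambda> (3 ^ L) v (\<psi> \<inter> \<xi>)))
     = pexp p E (\<lambda>\<xi>. of_bool (far_reaching l \<Lambda> (3 ^ L) v (\<psi> \<inter> \<xi>)))"
    by (rule pexp_restrict[symmetric, OF finE]) (auto simp: E_def far_reaching_def Int_assoc)
  also have "\<dots> \<le> pexp p E (\<lambda>\<xi>. \<Prod>j\<in>{1..<L}. of_bool (annulus_crossing_at v j (\<psi> \<inter> \<xi>)))"
  proof (intro pexp_mono p)
    fix \<xi>
    show "of_bool (far_reaching l \<Lambda> (3 ^ L) v (\<psi> \<inter> \<xi>)) \<le> (\<Prod>j\<in>{1..<L}. of_bool (annulus_crossing_at v j (\<psi> \<inter> \<xi>)) :: real)"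
    proof (cases "far_reaching l \<Lambda> (3 ^ L) v (\<psi> \<inter> \<xi>)")
      case True
      then obtain w where w: "(v, w) \<in> reach (\<psi> \<inter> \<xi> \<inter> edges_in \<Lambda>)" "3 ^ L \<le> \<bar>l v - l w\<bar>"
        by (auto simp: far_reaching_def)
      have "3 ^ L \<le> sup_norm (w - v)" using w(2) l[of w] by linarith
      then have "annulus_crossing_at v j (\<psi> \<inter> \<xi>)" if "j < L" for j
        using arm_annulus_crossing[OF w(1) v] that by blast
      then show ?thesis by simp
    qed (simp add: prod_nonneg)
  qed
  also have "\<dots> = (\<Prod>j\<in>{1..<L}. pexp p E (\<lambda>\<xi>. of_bool (annulus_crossing_at v j (\<psi> \<inter> \<xi>))))"
  proof (rule pexp_indep_prod[OF finE, where A = A])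
    show "disjoint_family_on A {1..<L}"
      unfolding disjoint_family_on_def A_def using annulus_at_disjoint edges_in_disjoint by blast
    fix j \<xi>
    show "of_bool (annulus_crossing_at v j (\<psi> \<inter> \<xi>)) = (of_bool (annulus_crossing_at v j (\<psi> \<inter> (\<xi> \<inter> A j))) :: real)"
      unfolding A_def by (subst (1 2) annulus_crossing_at_restrict) (simp add: Int_ac)
  qed (auto simp: E_def)
  also have "\<dots> = arm_bound p v L \<psi>"
    unfolding arm_bound_def annulus_prob_def
  proof (intro prod.cong refl)
    fix j assume j: "j \<in> {1..<L}"
    show "pexp p E (\<lambda>\<xi>. of_bool (annulus_crossing_at v j (\<psi> \<inter> \<xi>))) =
      pexp p (edges_in (annulus_at v j)) (\<lambda>\<xi>. of_bool (annulus_crossing_at v j (\<psi> \<inter> \<xi>)))"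
    proof (rule pexp_restrict[OF finE])
      show "edges_in (annulus_at v j) \<subseteq> E" using j by (auto simp: E_def A_def)
      fix \<xi>
      show "of_bool (annulus_crossing_at v j (\<psi> \<inter> \<xi>)) = (of_bool (annulus_crossing_at v j (\<psi> \<inter> (\<xi> \<inter> edges_in (annulus_at v j)))) :: real)"
        by (subst (1 2) annulus_crossing_at_restrict) (simp add: Int_ac)
    qed
  qed
  finally show ?thesis .
qed

section \<open>Concentration of the quenched annulus crossing probabilities\<close>

lemma sup_norm_diff: "\<bar>sup_norm u - sup_norm v\<bar> \<le> sup_norm (v - u)"
  by (auto simp: sup_norm_def max_def abs_if)

lemma annulus_prob_UNIV: "annulus_prob p v j UNIV = pexp p (edges_in (annulus j)) (\<lambda>\<omega>. of_bool (annulus_crossing j \<omega>))"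
  unfolding annulus_prob_def annulus_at_shift pexp_lattice_aut[OF shift_aut] Int_UNIV_left annulus_crossing_at_shift ..

text \<open>The annealed case, obtained with \<psi> = \<open>UNIV\<close> and bias 1/2. The slices
  are the concentric squares of the annulus and the cut-off radius is 3^L; an arm of that length
  crosses the L - 1 annuli of index 1 to L - 1.\<close>

lemma annulus_level_weight:
  assumes c: "c \<le> 1" "\<And>j. 1 \<le> j \<Longrightarrow> pexp (1/2) (edges_in (annulus j)) (\<lambda>\<omega>. of_bool (annulus_crossing j \<omega>)) \<le> 1 - c"
    and k: "1 \<le> k"
  shows "level_weight (1/2) (edges_in (annulus j)) (\<lambda>\<omega>. of_bool (annulus_crossing j \<omega>)) k
    \<le> k * (2 * ((2 * 3 ^ L + 1) / 3 ^ j + (1 - c) ^ (L - 1)))"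
proof -
  have arm: "pexp (1/2) (edges_in (annulus j)) (\<lambda>\<xi>. of_bool (far_reaching sup_norm (annulus j) (3 ^ L) v (UNIV \<inter> \<xi>))) \<le> (1 - c) ^ (L - 1)"
    if v: "v \<in> annulus j" for v
  proof -
    have "pexp (1/2) (edges_in (annulus j)) (\<lambda>\<xi>. of_bool (far_reaching sup_norm (annulus j) (3 ^ L) v (UNIV \<inter> \<xi>))) \<le> arm_bound (1/2) v L UNIV"
      by (rule far_reaching_arm_bound[OF _ _ _ v sup_norm_diff]) auto
    also have "\<dots> \<le> (\<Prod>j\<in>{1..<L}. 1 - c)"
      unfolding arm_bound_def
    proof (intro prod_mono conjI)
      fix i assume i: "i \<in> {1..<L}"
      show "0 \<le> annulus_prob (1/2) v i UNIV" by (rule annulus_prob_bounds) auto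
      show "annulus_prob (1/2) v i UNIV \<le> 1 - c" unfolding annulus_prob_UNIV using i by (intro c(2)) auto
    qed
    finally show ?thesis by simp
  qed
  have lohi: "(3 :: int) ^ j \<le> 3 ^ Suc j - 1" using one_le_power[of "3 :: int" j] by simp
  have "level_weight (1/2) (edges_in (annulus j)) (\<lambda>\<xi>. of_bool (crossing (annulus j) {v. sup_norm v = 3 ^ j} {v. sup_norm v = 3 ^ Suc j - 1} (UNIV \<inter> \<xi>))) k
    \<le> k * (2 * ((2 * real (3 ^ L) + 1) / real_of_int (3 ^ Suc j - 1 - 3 ^ j + 1) + (1 - c) ^ (L - 1)))"
    using c(1) by (intro crossing_level_weight[OF _ _ _ lipschitz1_sup_norm lohi arm _ k]) auto
  also have "\<dots> \<le> k * (2 * ((2 * 3 ^ L + 1) / 3 ^ j + (1 - c) ^ (L - 1)))"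
  proof (intro mult_left_mono add_mono order_refl)
    have "real_of_int (3 ^ Suc j - 1 - 3 ^ j + 1) = 2 * 3 ^ j" by simp
    then show "(2 * real (3 ^ L) + 1) / real_of_int (3 ^ Suc j - 1 - 3 ^ j + 1) \<le> (2 * 3 ^ L + 1) / 3 ^ j"
      by (simp add: frac_le)
  qed auto
  finally show ?thesis by (simp add: annulus_crossing_def)
qed

text \<open>The replica identity expresses the variance of the quenched crossing probability by the
  Fourier weights at bias 1/2, which are small on all positive levels. The mean is at most 1 - c, so
  values close to 1 are rare.\<close>

lemma annulus_moment:
  fixes r p \<eta> :: real
  assumes rp: "r * p = 1/2" and r: "0 \<le> r" "r \<le> 1" and p: "1/2 \<le> p" "p < 1" and \<eta>: "0 < \<eta>"
  obtains k j0 :: nat where "1 \<le> j0"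
    "\<And>j v. j0 \<le> j \<Longrightarrow> pexp r (edges_in (annulus_at v j)) (\<lambda>\<psi>. annulus_prob p v j \<psi> ^ k) \<le> \<eta>"
proof -
  obtain c where c: "0 < c" "c \<le> 1" "\<And>j. 1 \<le> j \<Longrightarrow> pexp (1/2) (edges_in (annulus j)) (\<lambda>\<omega>. of_bool (annulus_crossing j \<omega>)) \<le> 1 - c"
    by (rule annulus_blocked) blast
  define K where "K = (\<Sum>k. real k * (2 * p - 1) ^ k)"
  \<comment> \<open>Both summands of the revealment bound will be at most \<open>t\<close>, giving
    variance at most 4 t (K + 1), which this choice makes equal to (\<eta>/2) (c/2)^2.\<close>
  define t where "t = \<eta> / 2 * (c / 2)\<^sup>2 / (4 * (K + 1))"
  have \<rho>: "0 \<le> 2 * p - 1" "2 * p - 1 < 1" using p by auto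
  have K: "0 \<le> K" unfolding K_def using summable_k_powers[OF \<rho>] \<rho> by (intro suminf_nonneg) auto
  have t: "0 < t" unfolding t_def using \<eta> c K by simp
  obtain k where k: "(1 - c / 2) ^ k < \<eta> / 2" using real_arch_pow_inv[of "\<eta> / 2" "1 - c / 2"] \<eta> c by auto
  obtain L' where L': "(1 - c) ^ L' < t" using real_arch_pow_inv[OF t, of "1 - c"] c by auto
  define L where "L = Suc L'"
  \<comment> \<open>The arm length is fixed before the annulus: \<open>L\<close> makes the arms
    unlikely, and then \<open>j\<close> is taken so large that 3^L is negligible against the 3^j
    scale of the annulus.\<close>
  obtain j1 where j1: "(1/3 :: real) ^ j1 < t / (2 * 3 ^ L + 1)"
    using real_arch_pow_inv[of "t / (2 * 3 ^ L + 1)" "1/3"] t by (auto simp: add_pos_pos)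
  define j0 where "j0 = max 1 j1"
  have main: "pexp r (edges_in (annulus j)) (\<lambda>\<psi>. annulus_prob p 0 j \<psi> ^ k) \<le> \<eta>" if j: "j0 \<le> j" for j
  proof -
    let ?E = "edges_in (annulus j)"
    let ?F = "\<lambda>\<omega>. of_bool (annulus_crossing j \<omega>) :: real"
    define X where "X = (\<lambda>\<psi>. annulus_prob p 0 j \<psi>)"
    have X: "X \<psi> = pexp p ?E (\<lambda>\<xi>. ?F (\<psi> \<inter> \<xi>))" for \<psi>
      by (simp add: X_def annulus_prob_def annulus_crossing_at_def annulus_crossing_def annulus_at_def annulus_def)
    have X01: "0 \<le> X \<psi>" "X \<psi> \<le> 1" for \<psi> unfolding X_def using annulus_prob_bounds p by auto
    define m where "m = pexp (1/2) ?E ?F"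
    have m: "m \<le> 1 - c" unfolding m_def using c(3)[of j] j by (simp add: j0_def)
    define \<delta> where "\<delta> = 2 * ((2 * 3 ^ L + 1) / 3 ^ j + (1 - c) ^ (L - 1))"
    have EX: "pexp r ?E X = m" unfolding X m_def using pexp_thin[of ?E r p ?F] rp by simp
    \<comment> \<open>Squaring a quenched probability amounts to drawing two independent copies of
      \<xi> for the same \<psi>.\<close>
    have "pexp r ?E (\<lambda>\<psi>. (X \<psi>)\<^sup>2) = replica_pair r p ?E (\<lambda>\<omega> \<omega>'. ?F \<omega> * ?F \<omega>')"
      unfolding replica_pair_def X power2_eq_square pexp_cmult pexp_cmult_right ..
    also have "\<dots> = (\<Sum>S\<in>Pow ?E. (2 * p - 1) ^ card S * (fourier (1/2) ?E ?F S)\<^sup>2)"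
      by (rule replica_pair_fourier[OF rp]) simp
    finally have EX2: "pexp r ?E (\<lambda>\<psi>. (X \<psi>)\<^sup>2) = \<dots>" .
    have "pexp r ?E (\<lambda>\<psi>. (X \<psi> - m)\<^sup>2) = pexp r ?E (\<lambda>\<psi>. (X \<psi>)\<^sup>2 + m\<^sup>2 - 2 * m * X \<psi>)"
      by (simp add: power2_diff mult_ac)
    also have "\<dots> = pexp r ?E (\<lambda>\<psi>. (X \<psi>)\<^sup>2) - m\<^sup>2"
      unfolding pexp_diff pexp_add pexp_cmult EX by (simp add: power2_eq_square)
    also have "\<dots> \<le> \<delta> * K"
    proof -
      have "0 \<le> \<delta>" using c by (simp add: \<delta>_def)
      have "(\<Sum>S\<in>Pow ?E. (2 * p - 1) ^ card S * (fourier (1/2) ?E ?F S)\<^sup>2) - (pexp (1/2) ?E ?F)\<^sup>2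
        \<in> {0..\<delta> * (\<Sum>k. real k * (2 * p - 1) ^ k)}"
      proof (rule fourier_tail_bound[OF _ \<rho> \<open>0 \<le> \<delta>\<close>])
        show "level_weight (1/2) ?E ?F k \<le> real k * \<delta>" if "1 \<le> k" for k
          unfolding \<delta>_def using annulus_level_weight[OF c(2,3) that, of j L] by simp
      qed simp
      then show ?thesis unfolding EX2 K_def m_def by simp
    qed
    also have "\<dots> \<le> 4 * t * (K + 1)"
    proof -
      have "(2 * 3 ^ L + 1) / 3 ^ j \<le> t"
      proof -
        have "(1/3 :: real) ^ j \<le> (1/3) ^ j1" using j by (intro power_decreasing) (auto simp: j0_def)
        then have "(1/3 :: real) ^ j \<le> t / (2 * 3 ^ L + 1)" using j1 by linarith
        then have "(2 * 3 ^ L + 1) * (1/3) ^ j \<le> t" by (simp add: field_simps add_pos_pos)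
        then show ?thesis by (simp add: power_divide)
      qed
      moreover have "(1 - c) ^ (L - 1) \<le> t" using L' by (simp add: L_def)
      ultimately have "(2 * 3 ^ L + 1) / 3 ^ j + (1 - c) ^ (L - 1) \<le> t + t" by (rule add_mono)
      then have "\<delta> \<le> 2 * (t + t)" unfolding \<delta>_def by (rule mult_left_mono) simp
      then have "\<delta> \<le> 4 * t" by simp
      then show ?thesis using K t by (intro mult_mono) auto
    qed
    also have "\<dots> = \<eta> / 2 * (c / 2)\<^sup>2"
    proof -
      have "4 * (A / (4 * x)) * x = A" if "0 < x" for A x :: real using that by simp
      then show ?thesis unfolding t_def by this (use K in simp)
    qed
    finally have var: "pexp r ?E (\<lambda>\<psi>. (X \<psi> - m)\<^sup>2) \<le> \<eta> / 2 * (c / 2)\<^sup>2" .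
    have "pexp r ?E (\<lambda>\<psi>. X \<psi> ^ k) \<le> pexp r ?E (\<lambda>\<psi>. (1 - c / 2) ^ k + (1 / (c / 2)\<^sup>2) * (X \<psi> - m)\<^sup>2)"
    proof (intro pexp_mono r)
      fix \<psi>
      show "X \<psi> ^ k \<le> (1 - c / 2) ^ k + (1 / (c / 2)\<^sup>2) * (X \<psi> - m)\<^sup>2"
      proof (cases "X \<psi> \<le> 1 - c / 2")
        case True
        then have "X \<psi> ^ k \<le> (1 - c / 2) ^ k" using X01 by (intro power_mono) auto
        then show ?thesis by (simp add: add_increasing2)
      next
        case False
        \<comment> \<open>Chebyshev in pointwise form: X is above 1 - c/2 while its mean m is at
          most 1 - c.\<close>
        then have "(c / 2)\<^sup>2 \<le> (X \<psi> - m)\<^sup>2" using m c by (intro power_mono) auto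
        then have "1 \<le> (1 / (c / 2)\<^sup>2) * (X \<psi> - m)\<^sup>2" using c by (simp add: divide_simps)
        moreover have "X \<psi> ^ k \<le> 1" using X01 by (intro power_le_one) auto
        moreover have "0 \<le> (1 - c / 2) ^ k" using c by simp
        ultimately show ?thesis by linarith
      qed
    qed
    also have "\<dots> = (1 - c / 2) ^ k + (1 / (c / 2)\<^sup>2) * pexp r ?E (\<lambda>\<psi>. (X \<psi> - m)\<^sup>2)"
      unfolding pexp_add pexp_cmult by simp
    also have "\<dots> \<le> \<eta> / 2 + (1 / (c / 2)\<^sup>2) * (\<eta> / 2 * (c / 2)\<^sup>2)"
      using k var by (intro add_mono mult_left_mono) auto
    also have "\<dots> = \<eta>" using c by simp
    finally show ?thesis by (simp add: X_def)
  qed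
  have "pexp r (edges_in (annulus_at v j)) (\<lambda>\<psi>. annulus_prob p v j \<psi> ^ k) \<le> \<eta>" if "j0 \<le> j" for j v
    unfolding annulus_at_shift pexp_lattice_aut[OF shift_aut] annulus_prob_shift by (rule main[OF that])
  then show ?thesis using that[of j0 k] by (simp add: j0_def)
qed

text \<open>The factors depend on \<psi> in disjoint annuli. Those below scale \<open>j0\<close> are
  bounded by 1, each of the remaining L - j0 has k-th moment at most \<eta>.\<close>

lemma arm_bound_moment:
  assumes r: "0 \<le> r" "r \<le> 1" and p: "0 \<le> p" "p \<le> 1" and \<eta>: "0 \<le> \<eta>" and j0: "1 \<le> j0"
    and mom: "\<And>j v. j0 \<le> j \<Longrightarrow> pexp r (edges_in (annulus_at v j)) (\<lambda>\<psi>. annulus_prob p v j \<psi> ^ k) \<le> \<eta>"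
    and E: "finite E" "\<And>j. j \<in> {1..<L} \<Longrightarrow> edges_in (annulus_at v j) \<subseteq> E"
  shows "pexp r E (\<lambda>\<psi>. arm_bound p v L \<psi> ^ k) \<le> \<eta> ^ (L - j0)"
proof -
  let ?M = "\<lambda>j. pexp r (edges_in (annulus_at v j)) (\<lambda>\<psi>. annulus_prob p v j \<psi> ^ k)"
  have "pexp r E (\<lambda>\<psi>. arm_bound p v L \<psi> ^ k) = pexp r E (\<lambda>\<psi>. \<Prod>j\<in>{1..<L}. annulus_prob p v j \<psi> ^ k)"
    by (simp add: arm_bound_def prod_power_distrib)
  also have "\<dots> = (\<Prod>j\<in>{1..<L}. pexp r E (\<lambda>\<psi>. annulus_prob p v j \<psi> ^ k))"
  proof (rule pexp_indep_prod[OF E(1), where A = "\<lambda>j. edges_in (annulus_at v j)"])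
    show "disjoint_family_on (\<lambda>j. edges_in (annulus_at v j)) {1..<L}"
      unfolding disjoint_family_on_def using annulus_at_disjoint edges_in_disjoint by blast
    show "annulus_prob p v j \<psi> ^ k = annulus_prob p v j (\<psi> \<inter> edges_in (annulus_at v j)) ^ k" for j \<psi>
      using annulus_prob_restrict[of p v j \<psi>] by simp
  qed (use E in auto)
  also have "\<dots> = (\<Prod>j\<in>{1..<L}. ?M j)"
  proof (intro prod.cong refl pexp_restrict E)
    show "annulus_prob p v j \<psi> ^ k = annulus_prob p v j (\<psi> \<inter> edges_in (annulus_at v j)) ^ k" for j \<psi>
      using annulus_prob_restrict[of p v j \<psi>] by simp
  qed
  also have "\<dots> \<le> (\<Prod>j\<in>{1..<L}. if j0 \<le> j then \<eta> else 1)"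
  proof (intro prod_mono conjI)
    fix j
    show "0 \<le> ?M j" using annulus_prob_bounds[OF p] by (intro pexp_nonneg r) auto
    show "?M j \<le> (if j0 \<le> j then \<eta> else 1)"
    proof (cases "j0 \<le> j")
      case True
      then show ?thesis using mom[OF True, of v] by simp
    next
      case False
      have "?M j \<le> 1"
      proof (rule pexp_le_const[OF _ r])
        show "annulus_prob p v j \<psi> ^ k \<le> 1" for \<psi> by (rule power_le_one[OF annulus_prob_bounds[OF p]])
      qed simp
      then show ?thesis using False by simp
    qed
  qed
  also have "\<dots> = \<eta> ^ card ({1..<L} \<inter> {j. j0 \<le> j})" by (simp add: prod.If_cases)
  also have "{1..<L} \<inter> {j. j0 \<le> j} = {j0..<L}" using j0 by auto
  finally show ?thesis by simp
qed

text \<open>Since the annulus crossing probabilities have arbitrarily small high moments, the quenched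
  one-arm probabilities are uniformly small on boxes of size polynomial in the length of the arm.\<close>

definition bad_support :: "nat \<Rightarrow> nat \<Rightarrow> edge set" where
  "bad_support M L = (\<Union>v\<in>rect 0 (9 ^ Suc L) 0 (int M * 9 ^ Suc L). \<Union>j\<in>{1..<L}. edges_in (annulus_at v j))"

text \<open>The box contains [0, n] \<times> [0, m(n)] for all n < 9^(L+1) when m(n) \<le> M n. A
  single scale thus serves all n between 9^L and 9^(L+1), and the arm length 3^L is of order sqrt
  n.\<close>

definition bad_arms :: "real \<Rightarrow> nat \<Rightarrow> real \<Rightarrow> nat \<Rightarrow> edge set \<Rightarrow> bool" where
  "bad_arms p M \<theta> L \<psi> \<longleftrightarrow> (\<exists>v\<in>rect 0 (9 ^ Suc L) 0 (int M * 9 ^ Suc L). \<theta> < arm_bound p v L \<psi>)"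

lemma finite_bad_support [simp]: "finite (bad_support M L)"
  by (simp add: bad_support_def)

lemma bad_arms_bound:
  assumes rp: "r * p = 1/2" and r: "0 \<le> r" "r \<le> 1" and p: "1/2 \<le> p" "p < 1" and \<theta>: "0 < \<theta>" and M: "1 \<le> M"
  obtains C where "\<And>L. pexp r (bad_support M L) (\<lambda>\<psi>. of_bool (bad_arms p M \<theta> L \<psi>)) \<le> C * (1/2) ^ L"
proof -
  \<comment> \<open>The box has of order 81^L vertices; 162 = 2 * 81 leaves a factor (1/2)^L, which
    is summable.\<close>
  obtain k j0 where j0: "1 \<le> j0" and mom: "\<And>j v. j0 \<le> j \<Longrightarrow>
      pexp r (edges_in (annulus_at v j)) (\<lambda>\<psi>. annulus_prob p v j \<psi> ^ k) \<le> 1 / 162"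
    by (rule annulus_moment[OF rp r p, of "1/162"]) auto
  have p': "0 \<le> p" "p \<le> 1" using p by auto
  \<comment> \<open>The factor 4 M * 81 comes from counting vertices, 162^j0 from the scales without
    a moment bound, and \<theta>^k from Markov's inequality.\<close>
  define C where "C = 4 * real M * 81 * 162 ^ j0 / \<theta> ^ k"
  have "pexp r (bad_support M L) (\<lambda>\<psi>. of_bool (bad_arms p M \<theta> L \<psi>)) \<le> C * (1/2) ^ L" for L
  proof -
    let ?V = "rect 0 (9 ^ Suc L) 0 (int M * 9 ^ Suc L)"
    have "pexp r (bad_support M L) (\<lambda>\<psi>. of_bool (bad_arms p M \<theta> L \<psi>))
      \<le> pexp r (bad_support M L) (\<lambda>\<psi>. \<Sum>v\<in>?V. (1 / \<theta> ^ k) * arm_bound p v L \<psi> ^ k)"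
    proof (intro pexp_mono r)
      fix \<psi>
      have nn: "0 \<le> (1 / \<theta> ^ k) * arm_bound p v L \<psi> ^ k" for v
        using arm_bound_nonneg[OF p'] \<theta> by simp
      show "of_bool (bad_arms p M \<theta> L \<psi>) \<le> (\<Sum>v\<in>?V. (1 / \<theta> ^ k) * arm_bound p v L \<psi> ^ k)"
      proof (cases "bad_arms p M \<theta> L \<psi>")
        case True
        then obtain v where v: "v \<in> ?V" "\<theta> < arm_bound p v L \<psi>" by (auto simp: bad_arms_def)
        have "\<theta> ^ k \<le> arm_bound p v L \<psi> ^ k" using v \<theta> by (intro power_mono) auto
        then have "1 \<le> (1 / \<theta> ^ k) * arm_bound p v L \<psi> ^ k" using \<theta> by simp
        also have "\<dots> \<le> (\<Sum>v\<in>?V. (1 / \<theta> ^ k) * arm_bound p v L \<psi> ^ k)"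
          using v(1) nn by (intro member_le_sum) auto
        finally show ?thesis using True by simp
      qed (use nn in \<open>auto intro!: sum_nonneg\<close>)
    qed
    also have "\<dots> = (\<Sum>v\<in>?V. (1 / \<theta> ^ k) * pexp r (bad_support M L) (\<lambda>\<psi>. arm_bound p v L \<psi> ^ k))"
      by (simp only: pexp_sum pexp_cmult)
    also have "\<dots> \<le> (\<Sum>v\<in>?V. (1 / \<theta> ^ k) * (1 / 162) ^ (L - j0))"
    proof (intro sum_mono mult_left_mono)
      fix v assume v: "v \<in> ?V"
      have "edges_in (annulus_at v j) \<subseteq> bad_support M L" if "j \<in> {1..<L}" for j
        unfolding bad_support_def by (intro subsetI UN_I[OF v] UN_I[OF that])
      then show "pexp r (bad_support M L) (\<lambda>\<psi>. arm_bound p v L \<psi> ^ k) \<le> (1 / 162) ^ (L - j0)"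
        by (intro arm_bound_moment[OF r p' _ j0 mom]) simp_all
    qed (use \<theta> in auto)
    also have "\<dots> = real (card ?V) * (1 / \<theta> ^ k) * (1 / 162) ^ (L - j0)" by simp
    also have "\<dots> \<le> (4 * real M * 81 * 81 ^ L) * (1 / \<theta> ^ k) * (162 ^ j0 * (1 / 162) ^ L)"
    proof (intro mult_mono)
      have "card ?V = (9 ^ Suc L + 1) * (M * 9 ^ Suc L + 1)"
        by (simp add: rect_def nat_add_distrib nat_mult_distrib nat_power_eq)
      also have "\<dots> \<le> (2 * 9 ^ Suc L) * (2 * (M * 9 ^ Suc L))"
        using M by (intro mult_mono) (auto simp: Suc_le_eq)
      also have "\<dots> = 4 * M * 81 * 81 ^ L" by (simp add: power_mult_distrib[symmetric] mult_ac)
      finally have "real (card ?V) \<le> real (4 * M * 81 * 81 ^ L)" by (rule of_nat_mono)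
      then show "real (card ?V) \<le> 4 * real M * 81 * 81 ^ L" by simp
      \<comment> \<open>For L < j0 the truncated subtraction gives exponent 0, and then the
        right-hand side is at least 1.\<close>
      show "(1 / 162 :: real) ^ (L - j0) \<le> 162 ^ j0 * (1 / 162) ^ L"
      proof (cases "j0 \<le> L")
        case True
        then have "(1 / 162 :: real) ^ L = (1 / 162) ^ (L - j0) * (1 / 162) ^ j0" by (simp flip: power_add)
        then show ?thesis by (simp add: power_divide)
      next
        case False
        have "(162 :: real) ^ j0 * (1 / 162) ^ L = 162 ^ (j0 - L)" using False
          by (simp add: power_divide power_diff)
        then show ?thesis using False by simp
      qed
    qed (use \<theta> in auto)
    also have "\<dots> = C * (81 ^ L * (1 / 162) ^ L)" by (simp add: C_def)
    also have "(81 :: real) ^ L * (1 / 162) ^ L = (1/2) ^ L" unfolding power_mult_distrib[symmetric] by simp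
    finally show ?thesis .
  qed
  then show ?thesis by (rule that)
qed

section \<open>The infinite product measure\<close>

definition present :: "edge set \<Rightarrow> configuration \<Rightarrow> edge set" where
  "present J \<omega> = {e \<in> J. \<omega> e}"

lemma present_subset: "present J \<omega> \<subseteq> J"
  by (auto simp: present_def)

lemma prob_space_percolation: "prob_space (percolation q)"
  unfolding percolation_def by (intro prob_space_PiM measure_pmf.prob_space_axioms)

lemma present_cylinder:
  assumes q: "0 \<le> q" "q \<le> 1" and J: "finite J" "J \<subseteq> lattice_edges" and a: "a \<subseteq> J"
  shows "{\<omega> \<in> space (percolation q). present J \<omega> = a} \<in> sets (percolation q)"
    and "measure (percolation q) {\<omega> \<in> space (percolation q). present J \<omega> = a} = subset_weight q J a"
proof -
  let ?M = "\<lambda>_ :: edge. measure_pmf (bernoulli_pmf q)"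
  interpret product_prob_space ?M lattice_edges
    by unfold_locales
  have eq: "{\<omega> \<in> space (percolation q). present J \<omega> = a} = {\<omega> \<in> space (PiM lattice_edges ?M). \<forall>e\<in>J. \<omega> e \<in> {e \<in> a}}"
    using a unfolding percolation_def present_def by blast
  show "{\<omega> \<in> space (percolation q). present J \<omega> = a} \<in> sets (percolation q)"
    unfolding eq unfolding percolation_def using J
    by (intro sets.sets_Collect_finite_All sets_Collect_single') auto
  have pm: "emeasure (?M e) {e \<in> a} = ennreal (if e \<in> a then q else 1 - q)" for e
    using q by (simp add: emeasure_pmf_single)
  have "emeasure (percolation q) {\<omega> \<in> space (percolation q). present J \<omega> = a} = (\<Prod>e\<in>J. emeasure (?M e) {e \<in> a})"
    unfolding eq unfolding percolation_def by (rule emeasure_PiM_Collect) (use J in auto)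
  also have "\<dots> = (\<Prod>e\<in>J. ennreal (if e \<in> a then q else 1 - q))" unfolding pm ..
  also have "\<dots> = ennreal (subset_weight q J a)"
    unfolding subset_weight_def using q by (intro prod_ennreal) auto
  finally show "measure (percolation q) {\<omega> \<in> space (percolation q). present J \<omega> = a} = subset_weight q J a"
    using subset_weight_nonneg[OF q, of J a] by (simp add: measure_def)
qed

lemma measurable_present:
  assumes "0 \<le> q" "q \<le> 1" "finite J" "J \<subseteq> lattice_edges"
  shows "present J \<in> measurable (percolation q) (count_space (Pow J))"
proof -
  have "present J -` {a} \<inter> space (percolation q) \<in> sets (percolation q)" if "a \<in> Pow J" for a
    using present_cylinder(1)[OF assms, of a] that by (simp add: vimage_def Int_def conj_commute)
  then show ?thesis
    using assms(3) by (auto simp: measurable_count_space_eq2 present_def)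
qed

lemma integral_present:
  assumes q: "0 \<le> q" "q \<le> 1" and J: "finite J" "J \<subseteq> lattice_edges"
  shows "(\<integral>\<omega>. F (present J \<omega>) \<partial>percolation q) = pexp q J F"
proof -
  interpret prob_space "percolation q" by (rule prob_space_percolation)
  let ?C = "\<lambda>a. {\<omega> \<in> space (percolation q). present J \<omega> = a}"
  have "(\<integral>\<omega>. F (present J \<omega>) \<partial>percolation q) = (\<integral>\<omega>. (\<Sum>a\<in>Pow J. F a * indicator (?C a) \<omega>) \<partial>percolation q)"
  proof (rule Bochner_Integration.integral_cong[OF refl])
    fix \<omega> assume w: "\<omega> \<in> space (percolation q)"
    have "(\<Sum>a\<in>Pow J. F a * indicator (?C a) \<omega>) = (\<Sum>a\<in>Pow J. if a = present J \<omega> then F a else 0)"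
      using w by (intro sum.cong) (auto simp: indicator_def)
    also have "\<dots> = F (present J \<omega>)" using J present_subset by simp
    finally show "F (present J \<omega>) = (\<Sum>a\<in>Pow J. F a * indicator (?C a) \<omega>)" ..
  qed
  also have "\<dots> = (\<Sum>a\<in>Pow J. \<integral>\<omega>. F a * indicator (?C a) \<omega> \<partial>percolation q)"
    using present_cylinder(1)[OF q J] by (intro Bochner_Integration.integral_sum) (auto simp: emeasure_eq_measure)
  also have "\<dots> = (\<Sum>a\<in>Pow J. F a * subset_weight q J a)"
    using present_cylinder[OF q J] by (intro sum.cong) auto
  finally show ?thesis by (simp add: pexp_def mult.commute)
qed

text \<open>Fubini for arbitrary \<open>H\<close>: finitely many values of \<open>f\<close> and
  \<open>g\<close> make the integrand measurable and bounded.\<close>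

lemma integral_pair_finite_valued:
  fixes H :: "'c \<Rightarrow> 'd \<Rightarrow> real"
  assumes M: "prob_space M" "prob_space N"
    and f: "f \<in> measurable M (count_space A)" "finite A" and g: "g \<in> measurable N (count_space B)" "finite B"
  shows "(\<integral>z. H (f (fst z)) (g (snd z)) \<partial>(M \<Otimes>\<^sub>M N)) = (\<integral>x. \<integral>y. H (f x) (g y) \<partial>N \<partial>M)"
proof -
  interpret M: prob_space M by fact
  interpret N: prob_space N by fact
  interpret pair_prob_space M N ..
  have m: "(\<lambda>z. H (f (fst z)) (g (snd z))) \<in> borel_measurable (M \<Otimes>\<^sub>M N)"
  proof (rule measurable_compose_countable'[where f = "\<lambda>a z. H a (g (snd z))" and g = "\<lambda>z. f (fst z)"])
    show "(\<lambda>z. H a (g (snd z))) \<in> borel_measurable (M \<Otimes>\<^sub>M N)" for a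
      using measurable_compose[OF measurable_snd g(1)] by (rule measurable_compose) simp
    show "(\<lambda>z. f (fst z)) \<in> measurable (M \<Otimes>\<^sub>M N) (count_space A)"
      by (rule measurable_compose[OF measurable_fst f(1)])
  qed (use f in \<open>simp add: countable_finite\<close>)
  define K where "K = Max ((\<lambda>(a, b). \<bar>H a b\<bar>) ` (A \<times> B))"
  have K: "\<bar>H a b\<bar> \<le> K" if "a \<in> A" "b \<in> B" for a b
    unfolding K_def using f(2) g(2) that by (intro Max_ge) auto
  have "integrable (M \<Otimes>\<^sub>M N) (\<lambda>z. H (f (fst z)) (g (snd z)))"
  proof (rule P.integrable_const_bound[OF _ m])
    have "f (fst z) \<in> A" "g (snd z) \<in> B" if "z \<in> space (M \<Otimes>\<^sub>M N)" for z
      using measurable_space[OF f(1)] measurable_space[OF g(1)] that by (auto simp: space_pair_measure)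
    then show "AE z in M \<Otimes>\<^sub>M N. norm (H (f (fst z)) (g (snd z))) \<le> K"
      using K by (intro AE_I2) auto
  qed
  from integral_fst'[OF this] show ?thesis by simp
qed

lemma integral_noise_space:
  assumes p: "0 \<le> p" "p \<le> 1" and \<epsilon>: "0 \<le> \<epsilon>" "\<epsilon> \<le> 1" and J: "finite J" "J \<subseteq> lattice_edges"
  shows "(\<integral>(\<xi>, \<eta>, \<xi>'). F (present J \<xi>) (present J \<eta>) (present J \<xi>') \<partial>noise_space p \<epsilon>)
    = pexp p J (\<lambda>a. pexp \<epsilon> J (\<lambda>b. pexp p J (\<lambda>c. F a b c)))"
proof -
  let ?N = "percolation \<epsilon> \<Otimes>\<^sub>M percolation p"
  let ?g = "\<lambda>y. (present J (fst y), present J (snd y))"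
  have N: "prob_space ?N"
  proof -
    interpret a: prob_space "percolation \<epsilon>" by (rule prob_space_percolation)
    interpret b: prob_space "percolation p" by (rule prob_space_percolation)
    interpret pair_prob_space "percolation \<epsilon>" "percolation p" ..
    show ?thesis by (rule P.prob_space_axioms)
  qed
  note mp = measurable_present[OF p J] and me = measurable_present[OF \<epsilon> J]
  have g: "?g \<in> measurable ?N (count_space (Pow J \<times> Pow J))"
  proof -
    have "?g \<in> measurable ?N (count_space (Pow J) \<Otimes>\<^sub>M count_space (Pow J))"
      using measurable_compose[OF measurable_fst me] measurable_compose[OF measurable_snd mp] by (rule measurable_Pair)
    then show ?thesis using J by (simp add: pair_measure_countable countable_finite)
  qed
  have fin: "finite (Pow J)" "finite (Pow J \<times> Pow J)" using J by auto
  have "(\<integral>(\<xi>, \<eta>, \<xi>'). F (present J \<xi>) (present J \<eta>) (present J \<xi>') \<partial>noise_space p \<epsilon>)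
    = (\<integral>z. (\<lambda>a (b, c). F a b c) (present J (fst z)) (?g (snd z)) \<partial>(percolation p \<Otimes>\<^sub>M ?N))"
    unfolding noise_space_def by (intro Bochner_Integration.integral_cong refl) (simp add: split_beta)
  also have "\<dots> = (\<integral>\<xi>. \<integral>y. (\<lambda>a (b, c). F a b c) (present J \<xi>) (?g y) \<partial>?N \<partial>percolation p)"
    by (rule integral_pair_finite_valued[OF prob_space_percolation N mp fin(1) g fin(2)])
  also have "\<dots> = (\<integral>\<xi>. \<integral>y. F (present J \<xi>) (present J (fst y)) (present J (snd y)) \<partial>?N \<partial>percolation p)"
    by simp
  also have "\<dots> = (\<integral>\<xi>. pexp \<epsilon> J (\<lambda>b. pexp p J (\<lambda>c. F (present J \<xi>) b c)) \<partial>percolation p)"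
  proof (rule Bochner_Integration.integral_cong[OF refl])
    fix \<xi>
    have "(\<integral>y. F (present J \<xi>) (present J (fst y)) (present J (snd y)) \<partial>?N)
      = (\<integral>\<eta>. \<integral>\<xi>'. F (present J \<xi>) (present J \<eta>) (present J \<xi>') \<partial>percolation p \<partial>percolation \<epsilon>)"
      by (rule integral_pair_finite_valued[OF prob_space_percolation prob_space_percolation me fin(1) mp fin(1)])
    then show "(\<integral>y. F (present J \<xi>) (present J (fst y)) (present J (snd y)) \<partial>?N)
      = pexp \<epsilon> J (\<lambda>b. pexp p J (\<lambda>c. F (present J \<xi>) b c))"
      unfolding integral_present[OF p J, of "F _ _"]
      unfolding integral_present[OF \<epsilon> J, of "\<lambda>b. pexp p J (F (present J \<xi>) b)"] .
  qed
  also have "\<dots> = pexp p J (\<lambda>a. pexp \<epsilon> J (\<lambda>b. pexp p J (\<lambda>c. F a b c)))"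
    by (rule integral_present[OF p J])
  finally show ?thesis .
qed

section \<open>Self-avoiding open paths and the relation \<open>reach\<close>\<close>

lemma reach_distinct_walk:
  assumes "(u, v) \<in> reach (\<omega> \<inter> edges_in \<Lambda>)" "u \<in> \<Lambda>"
  obtains P where "walk (\<omega> \<inter> edges_in \<Lambda>) P" "distinct P" "hd P = u" "last P = v" "set P \<subseteq> \<Lambda>"
proof -
  have "\<exists>P. walk (\<omega> \<inter> edges_in \<Lambda>) P \<and> distinct P \<and> hd P = u \<and> last P = v \<and> set P \<subseteq> \<Lambda>"
    using assms(1)
  proof (induction rule: reach_induct)
    case base
    show ?case by (rule exI[of _ "[u]"]) (simp add: walk_def assms(2))
  next
    case (step x y)
    then obtain P where P: "walk (\<omega> \<inter> edges_in \<Lambda>) P" "distinct P" "hd P = u" "last P = x" "set P \<subseteq> \<Lambda>" by blast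
    show ?case
    proof (cases "y \<in> set P")
      case True
      \<comment> \<open>Loop erasure: when the new vertex was already visited, the walk is cut at
        that visit.\<close>
      then obtain as bs where "P = as @ y # bs" by (meson split_list)
      then have "P = (as @ [y]) @ bs" by simp
      then show ?thesis using P
        by (intro exI[of _ "as @ [y]"]) (auto simp: walk_def successively_append_iff hd_append)
    next
      case False
      have "y \<in> \<Lambda>" using step(2) by (simp add: edges_in_iff)
      then show ?thesis using P step(2) False
        by (intro exI[of _ "P @ [y]"]) (auto simp: walk_def successively_append_iff)
    qed
  qed
  then show ?thesis using that by blast
qed

lemma walk_reach: "walk \<omega> P \<Longrightarrow> (hd P, last P) \<in> reach \<omega>"
proof (induction P)
  case (Cons x P)
  show ?case
  proof (cases "P = []")
    case False
    then have "walk \<omega> P" "{x, hd P} \<in> \<omega>" using Cons.prems by (auto simp: walk_def successively_Cons)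
    from reach_trans[OF reach_step[OF this(2)] Cons.IH[OF this(1)]] show ?thesis using False by simp
  qed simp
qed (simp add: walk_def)

lemma walk_in_region:
  assumes "walk \<omega> P" "set P \<subseteq> \<Lambda>" "\<omega> \<subseteq> lattice_edges"
  shows "walk (\<omega> \<inter> edges_in \<Lambda>) P"
  using assms unfolding walk_def by (auto elim!: successively_mono simp: edges_in_iff)

lemma horizontal_crossing_iff:
  assumes "\<omega> \<in> configurations"
  shows "\<omega> \<in> horizontal_crossing n m \<longleftrightarrow> hcross 0 (int n) 0 (int m) (present lattice_edges \<omega>)"
proof -
  let ?\<Lambda> = "rect 0 (int n) 0 (int m)" and ?\<omega> = "present lattice_edges \<omega>"
  have op: "open_path \<omega> \<gamma> \<longleftrightarrow> walk ?\<omega> \<gamma> \<and> distinct \<gamma>" for \<gamma>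
    by (auto simp: open_path_def walk_def present_def)
  have sides: "{0} \<times> {0..int m} = {v. fst v = 0 \<and> 0 \<le> snd v \<and> snd v \<le> int m}"
    "{int n} \<times> {0..int m} = {v. fst v = int n \<and> 0 \<le> snd v \<and> snd v \<le> int m}" by auto
  have \<Lambda>: "{0..int n} \<times> {0..int m} = ?\<Lambda>" by (simp add: rect_def)
  show ?thesis
  proof
    assume "\<omega> \<in> horizontal_crossing n m"
    then obtain \<gamma> where \<gamma>: "open_path \<omega> \<gamma>" "set \<gamma> \<subseteq> ?\<Lambda>" "fst (hd \<gamma>) = 0" "fst (last \<gamma>) = int n"
      unfolding horizontal_crossing_def sides \<Lambda> by blast
    have w: "walk (?\<omega> \<inter> edges_in ?\<Lambda>) \<gamma>"
      using \<gamma> present_subset unfolding op by (intro walk_in_region) auto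
    then have "hd \<gamma> \<in> ?\<Lambda>" "last \<gamma> \<in> ?\<Lambda>" using \<gamma>(2) by (auto simp: walk_def)
    then show "hcross 0 (int n) 0 (int m) ?\<omega>" using walk_reach[OF w] \<gamma>(3,4) unfolding crossing_def by blast
  next
    assume "hcross 0 (int n) 0 (int m) ?\<omega>"
    then obtain u v where uv: "u \<in> ?\<Lambda>" "v \<in> ?\<Lambda>" "fst u = 0" "fst v = int n" "(u, v) \<in> reach (?\<omega> \<inter> edges_in ?\<Lambda>)"
      unfolding crossing_def by blast
    obtain P where P: "walk (?\<omega> \<inter> edges_in ?\<Lambda>) P" "distinct P" "hd P = u" "last P = v" "set P \<subseteq> ?\<Lambda>"
      by (rule reach_distinct_walk[OF uv(5,1)]) blast
    have "walk ?\<omega> P" using P(1) unfolding walk_def by (auto intro: successively_mono)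
    then have "open_path \<omega> P" using P(2) op by blast
    moreover have "hd P \<in> {0} \<times> {0..int m}" "last P \<in> {int n} \<times> {0..int m}"
      unfolding sides P(3,4) using uv by (auto simp: mem_rect)
    ultimately show "\<omega> \<in> horizontal_crossing n m"
      unfolding horizontal_crossing_def \<Lambda> using P(5) assms by (intro CollectI conjI exI[of _ P])
  qed
qed

text \<open>Only \<xi> is cut down to the rectangle. \<psi> is kept on the whole lattice, because
  the arm bounds look at annuli reaching beyond the rectangle.\<close>

lemma crossing_indicator_mult:
  fixes n m :: nat
  defines "E \<equiv> edges_in (rect 0 (int n) 0 (int m))"
  shows "crossing_indicator n m (\<psi> \<odot> \<xi>) = of_bool (hcross 0 (int n) 0 (int m) (present lattice_edges \<psi> \<inter> present E \<xi>))"
proof -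
  have conf: "\<psi> \<odot> \<xi> \<in> configurations" by (auto simp: config_mult_def configurations_def)
  have "present lattice_edges (\<psi> \<odot> \<xi>) \<inter> E = present lattice_edges \<psi> \<inter> present E \<xi> \<inter> E"
    using edges_in_lattice unfolding E_def by (auto simp: present_def config_mult_def)
  then have "hcross 0 (int n) 0 (int m) (present lattice_edges (\<psi> \<odot> \<xi>)) = hcross 0 (int n) 0 (int m) (present lattice_edges \<psi> \<inter> present E \<xi>)"
    unfolding E_def by (subst (1 2) crossing_restrict) simp
  then show ?thesis
    using horizontal_crossing_iff[OF conf] by (simp add: crossing_indicator_def indicator_def)
qed

lemma present_resample:
  assumes "J \<subseteq> lattice_edges"
  shows "present J (resample \<eta> \<xi>' \<xi>) = (present J \<xi> - present J \<eta>) \<union> (present J \<xi>' \<inter> present J \<eta>)"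
  using assms by (auto simp: present_def resample_def)

section \<open>Quenched noise sensitivity\<close>

definition noise_constant :: "real \<Rightarrow> real" where
  "noise_constant \<rho> = (\<Sum>k. real k * \<rho> ^ k)"

lemma noise_constant_nonneg: "0 \<le> \<rho> \<Longrightarrow> \<rho> < 1 \<Longrightarrow> 0 \<le> noise_constant \<rho>"
  unfolding noise_constant_def by (rule suminf_nonneg[OF summable_k_powers]) auto

text \<open>Schramm-Steif for fixed \<psi>, exploring from one of the n + 1 vertical lines with
  cut-off radius 3^L; \<theta> bounds the arms from all vertices of the rectangle.\<close>

lemma quenched_covariance:
  fixes n m L :: nat and p \<epsilon> \<theta> :: real and \<psi> :: configuration
  assumes p: "0 < p" "p < 1" and \<epsilon>: "0 < \<epsilon>" "\<epsilon> < 1"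
    and arm: "\<And>v. v \<in> rect 0 (int n) 0 (int m) \<Longrightarrow> arm_bound p v L (present lattice_edges \<psi>) \<le> \<theta>" and \<theta>: "0 \<le> \<theta>"
  shows "(\<integral>(\<xi>, \<eta>, \<xi>'). crossing_indicator n m (\<psi> \<odot> \<xi>) * crossing_indicator n m (\<psi> \<odot> resample \<eta> \<xi>' \<xi>) \<partial>noise_space p \<epsilon>)
      - (\<integral>\<xi>. crossing_indicator n m (\<psi> \<odot> \<xi>) \<partial>percolation p)\<^sup>2
    \<in> {0..2 * ((2 * 3 ^ L + 1) / (real n + 1) + \<theta>) * noise_constant (1 - \<epsilon>)}"
proof -
  let ?\<Lambda> = "rect 0 (int n) 0 (int m)"
  define E where "E = edges_in ?\<Lambda>"
  define \<Psi> where "\<Psi> = present lattice_edges \<psi>"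
  define f where "f = (\<lambda>\<xi>. of_bool (hcross 0 (int n) 0 (int m) (\<Psi> \<inter> \<xi>)) :: real)"
  have E: "finite E" "E \<subseteq> lattice_edges" using edges_in_lattice by (auto simp: E_def)
  have p': "0 \<le> p" "p \<le> 1" and \<epsilon>': "0 \<le> \<epsilon>" "\<epsilon> \<le> 1" using p \<epsilon> by auto
  have ci: "crossing_indicator n m (\<psi> \<odot> \<xi>) = f (present E \<xi>)" for \<xi>
    unfolding crossing_indicator_mult f_def E_def \<Psi>_def ..
  have 1: "(\<integral>\<xi>. crossing_indicator n m (\<psi> \<odot> \<xi>) \<partial>percolation p) = pexp p E f"
    unfolding ci by (rule integral_present[OF p' E])
  have 2: "(\<integral>(\<xi>, \<eta>, \<xi>'). crossing_indicator n m (\<psi> \<odot> \<xi>) * crossing_indicator n m (\<psi> \<odot> resample \<eta> \<xi>' \<xi>) \<partial>noise_space p \<epsilon>)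
     = noise_pair p \<epsilon> E (\<lambda>\<omega> \<omega>'. f \<omega> * f \<omega>')"
    unfolding ci present_resample[OF E(2)] noise_pair_def
    by (rule integral_noise_space[OF p' \<epsilon>' E, where F = "\<lambda>a b c. f a * f ((a - b) \<union> (c \<inter> b))"])
  define \<delta> where "\<delta> = 2 * ((2 * 3 ^ L + 1) / (real n + 1) + \<theta>)"
  have \<delta>: "0 \<le> \<delta>" using \<theta> by (simp add: \<delta>_def)
  have W: "level_weight p E f k \<le> real k * \<delta>" if k: "1 \<le> k" for k
  proof -
    have "level_weight p E f k \<le> k * (2 * ((2 * real (3 ^ L) + 1) / real_of_int (int n - 0 + 1) + \<theta>))"
      unfolding f_def E_def
    proof (rule crossing_level_weight[OF p _ lipschitz1_fst _ _ \<theta> k])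
      fix v assume v: "v \<in> ?\<Lambda>"
      have "\<bar>fst v - fst z\<bar> \<le> sup_norm (z - v)" for z by (simp add: sup_norm_def)
      then have "pexp p (edges_in ?\<Lambda>) (\<lambda>\<xi>. of_bool (far_reaching fst ?\<Lambda> (3 ^ L) v (\<Psi> \<inter> \<xi>))) \<le> arm_bound p v L \<Psi>"
        by (intro far_reaching_arm_bound[OF p' _ v]) auto
      also have "\<dots> \<le> \<theta>" unfolding \<Psi>_def by (rule arm[OF v])
      finally show "pexp p (edges_in ?\<Lambda>) (\<lambda>\<xi>. of_bool (far_reaching fst ?\<Lambda> (3 ^ L) v (\<Psi> \<inter> \<xi>))) \<le> \<theta>" .
    qed auto
    then show ?thesis by (simp add: \<delta>_def)
  qed
  have "(\<Sum>S\<in>Pow E. (1 - \<epsilon>) ^ card S * (fourier p E f S)\<^sup>2) - (pexp p E f)\<^sup>2 \<in> {0..\<delta> * noise_constant (1 - \<epsilon>)}"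
    unfolding noise_constant_def using \<epsilon> by (intro fourier_tail_bound[OF E(1) _ _ \<delta> W]) auto
  then show ?thesis unfolding 1 2 noise_pair_fourier[OF p E(1)] \<delta>_def .
qed

text \<open>Borel-Cantelli with the summable bounds on the bad events.\<close>

lemma AE_good_arms:
  assumes rp: "r * p = 1/2" and r: "0 \<le> r" "r \<le> 1" and p: "1/2 \<le> p" "p < 1" and \<theta>: "0 < \<theta>" and M: "1 \<le> M"
  shows "AE \<psi> in percolation r. eventually (\<lambda>L. \<not> bad_arms p M \<theta> L (present lattice_edges \<psi>)) sequentially"
proof -
  interpret prob_space "percolation r" by (rule prob_space_percolation)
  obtain C where C: "\<And>L. pexp r (bad_support M L) (\<lambda>\<psi>. of_bool (bad_arms p M \<theta> L \<psi>)) \<le> C * (1/2) ^ L"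
    using bad_arms_bound[OF rp r p \<theta> M] by blast
  \<comment> \<open>The events are formulated through the finite trace of \<psi> on
    \<open>bad_support\<close>, which makes them measurable and their probabilities finite
    sums.\<close>
  define A where "A = (\<lambda>L. {\<psi> \<in> space (percolation r). bad_arms p M \<theta> L (present (bad_support M L) \<psi>)})"
  have S: "finite (bad_support M L)" "bad_support M L \<subseteq> lattice_edges" for L
    using edges_in_lattice by (auto simp: bad_support_def)
  have Am: "A L \<in> sets (percolation r)" for L
  proof -
    have "A L = (present (bad_support M L)) -` {a \<in> Pow (bad_support M L). bad_arms p M \<theta> L a} \<inter> space (percolation r)"
      using present_subset unfolding A_def by auto
    also have "\<dots> \<in> sets (percolation r)"
      by (rule measurable_sets[OF measurable_present[OF r S]]) auto
    finally show ?thesis .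
  qed
  have Ae: "measure (percolation r) (A L) \<le> C * (1/2) ^ L" for L
  proof -
    have "measure (percolation r) (A L) = (\<integral>\<psi>. indicator (A L) \<psi> \<partial>percolation r)" using Am by simp
    also have "\<dots> = (\<integral>\<psi>. of_bool (bad_arms p M \<theta> L (present (bad_support M L) \<psi>)) \<partial>percolation r)"
      by (intro Bochner_Integration.integral_cong) (auto simp: A_def indicator_def)
    also have "\<dots> = pexp r (bad_support M L) (\<lambda>\<psi>. of_bool (bad_arms p M \<theta> L \<psi>))"
      by (rule integral_present[OF r S])
    finally show ?thesis using C by simp
  qed
  have ae: "AE \<psi> in percolation r. eventually (\<lambda>L. \<psi> \<in> space (percolation r) - A L) sequentially"
  proof (rule borel_cantelli_AE1[OF Am])
    show "summable (\<lambda>L. measure (percolation r) (A L))"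
      by (rule summable_comparison_test'[where N = 0 and g = "\<lambda>L. C * (1/2) ^ L"]) (auto intro: Ae summable_mult)
  qed (simp add: emeasure_eq_measure)
  \<comment> \<open>The annuli entering the bounds lie in \<open>bad_support\<close>, so the finite
    trace decides the event for the full \<psi>.\<close>
  have eq: "bad_arms p M \<theta> L (present lattice_edges \<psi>) \<longleftrightarrow> bad_arms p M \<theta> L (present (bad_support M L) \<psi>)" for L \<psi>
  proof -
    have "arm_bound p v L (present lattice_edges \<psi>) = arm_bound p v L (present (bad_support M L) \<psi>)"
      if v: "v \<in> rect 0 (9 ^ Suc L) 0 (int M * 9 ^ Suc L)" for v
      unfolding arm_bound_def
    proof (intro prod.cong refl)
      fix j assume j: "j \<in> {1..<L}"
      have "edges_in (annulus_at v j) \<subseteq> bad_support M L"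
        unfolding bad_support_def by (intro subsetI UN_I[OF v] UN_I[OF j])
      then have "present lattice_edges \<psi> \<inter> edges_in (annulus_at v j) = present (bad_support M L) \<psi> \<inter> edges_in (annulus_at v j)"
        using S(2)[of L] by (auto simp: present_def)
      then show "annulus_prob p v j (present lattice_edges \<psi>) = annulus_prob p v j (present (bad_support M L) \<psi>)"
        by (subst (1 2) annulus_prob_restrict) simp
    qed
    then show ?thesis by (auto simp: bad_arms_def)
  qed
  show ?thesis
  proof (rule AE_mp[OF ae], intro AE_I2 impI)
    fix \<psi> assume "eventually (\<lambda>L. \<psi> \<in> space (percolation r) - A L) sequentially"
    then show "eventually (\<lambda>L. \<not> bad_arms p M \<theta> L (present lattice_edges \<psi>)) sequentially"
      by (rule eventually_mono) (simp add: A_def eq)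
  qed
qed

theorem theorem3:
  fixes m :: "nat \<Rightarrow> nat" and r :: real
  assumes "\<forall>n\<ge>1. m n \<ge> 1"
    and "\<exists>c>0. \<forall>n\<ge>1. c \<le> real (m n) / real n"
    and "\<exists>C. \<forall>n\<ge>1. real (m n) / real n \<le> C"
    and "1 / 2 < r" and "r \<le> 1"
  shows "AE \<psi> in percolation r. \<forall>\<epsilon>\<in>{0<..<1}.
    (\<lambda>n. (\<integral>(\<xi>, \<eta>, \<xi>'). crossing_indicator n (m n) (\<psi> \<odot> \<xi>) *
                      crossing_indicator n (m n) (\<psi> \<odot> resample \<eta> \<xi>' \<xi>)
            \<partial>noise_space (1 / (2 * r)) \<epsilon>)
       - (\<integral>\<xi>. crossing_indicator n (m n) (\<psi> \<odot> \<xi>) \<partial>percolation (1 / (2 * r)))\<^sup>2)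
    \<longlonglongrightarrow> 0"
proof -
  define p where "p = 1 / (2 * r)"
  have rp: "r * p = 1/2" and p: "1/2 \<le> p" "p < 1" and r: "0 \<le> r" "r \<le> 1"
    using assms(4,5) by (auto simp: p_def field_simps)
  have p0: "0 < p" using p by simp
  obtain C where C: "\<forall>n\<ge>1. real (m n) / real n \<le> C" using assms(3) by blast
  \<comment> \<open>An integer at least C, so that every rectangle has height at most M n.\<close>
  define M where "M = max 1 (nat \<lceil>C\<rceil>)"
  have M: "1 \<le> M" by (simp add: M_def)
  have mM: "m n \<le> M * n" if n: "1 \<le> n" for n
  proof -
    have "real (m n) \<le> C * real n" using C n by (auto simp: divide_le_eq)
    also have "C \<le> real M" unfolding M_def by linarith
    then have "C * real n \<le> real M * real n" by (rule mult_right_mono) simp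
    finally have "real (m n) \<le> real (M * n)" by simp
    then show ?thesis by (simp only: of_nat_le_iff)
  qed
  \<comment> \<open>Countably many thresholds suffice, and \<epsilon> does not occur in the arm
    events; one null set therefore serves all \<epsilon> at once.\<close>
  have "AE \<psi> in percolation r. \<forall>t :: nat. eventually (\<lambda>L. \<not> bad_arms p M (1 / (real t + 1)) L (present lattice_edges \<psi>)) sequentially"
    unfolding AE_all_countable by (intro allI AE_good_arms[OF rp r p _ M]) simp
  then show ?thesis
  proof (rule AE_mp, intro AE_I2 impI ballI)
    fix \<psi> and \<epsilon> :: real
    assume good: "\<forall>t :: nat. eventually (\<lambda>L. \<not> bad_arms p M (1 / (real t + 1)) L (present lattice_edges \<psi>)) sequentially"
      and \<epsilon>: "\<epsilon> \<in> {0<..<1}"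
    define cov where "cov = (\<lambda>n. (\<integral>(\<xi>, \<eta>, \<xi>'). crossing_indicator n (m n) (\<psi> \<odot> \<xi>) *
                      crossing_indicator n (m n) (\<psi> \<odot> resample \<eta> \<xi>' \<xi>) \<partial>noise_space p \<epsilon>)
       - (\<integral>\<xi>. crossing_indicator n (m n) (\<psi> \<odot> \<xi>) \<partial>percolation p)\<^sup>2)"
    define K where "K = noise_constant (1 - \<epsilon>)"
    have K: "0 \<le> K" unfolding K_def using \<epsilon> by (intro noise_constant_nonneg) auto
    have "cov \<longlonglongrightarrow> 0"
    proof (rule LIMSEQ_I)
      fix d :: real assume d: "0 < d"
      \<comment> \<open>Both terms of the covariance bound will be at most \<open>s\<close>, which
        gives 2 (s + s) (K + 1) = d / 2.\<close>
      define s where "s = d / (8 * (K + 1))"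
      have s: "0 < s" using d K by (simp add: s_def)
      obtain t :: nat where "inverse (real (Suc t)) < s" using reals_Archimedean[OF s] by blast
      then have t: "1 / (real t + 1) \<le> s" by (simp add: inverse_eq_divide add.commute)
      obtain L1 where L1: "\<And>L. L1 \<le> L \<Longrightarrow> \<not> bad_arms p M (1 / (real t + 1)) L (present lattice_edges \<psi>)"
        using good[rule_format, of t] unfolding eventually_sequentially by blast
      obtain L2 where L2: "(1/3 :: real) ^ L2 < s / 3" using real_arch_pow_inv[of "s / 3" "1/3"] s by auto
      define L0 where "L0 = max L1 L2"
      show "\<exists>n0. \<forall>n\<ge>n0. norm (cov n - 0) < d"
      proof (intro exI[of _ "9 ^ L0"] allI impI)
        fix n :: nat assume n: "9 ^ L0 \<le> n"
        have n1: "1 \<le> n" using n one_le_power[of "9 :: nat" L0] by linarith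
        \<comment> \<open>Arms of length 3^L \<le> sqrt n are long enough to be unlikely and short
          compared with n; n \<ge> 9^L0 ensures L \<ge> L0.\<close>
        obtain L where L: "9 ^ L \<le> n" "n < 9 ^ Suc L" using ex_power_ivl1[of 9 n] n1 by auto
        have "(9 :: nat) ^ L0 < 9 ^ Suc L" using n L(2) by (rule le_less_trans)
        then have "L0 < Suc L" by (rule power_less_imp_less_exp[rotated]) simp
        then have LL0: "L0 \<le> L" by simp
        have arm: "arm_bound p v L (present lattice_edges \<psi>) \<le> s" if v: "v \<in> rect 0 (int n) 0 (int (m n))" for v
        proof -
          have "m n \<le> M * 9 ^ Suc L" using mM[OF n1] L(2) by (meson le_trans less_imp_le mult_le_mono2)
          then have "int (m n) \<le> int M * 9 ^ Suc L" by (metis of_nat_le_iff of_nat_mult of_nat_numeral of_nat_power)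
          moreover have "int n \<le> 9 ^ Suc L" using L(2) by (metis less_imp_le of_nat_le_iff of_nat_numeral of_nat_power)
          ultimately have "v \<in> rect 0 (9 ^ Suc L) 0 (int M * 9 ^ Suc L)" using v unfolding mem_rect by linarith
          then have "arm_bound p v L (present lattice_edges \<psi>) \<le> 1 / (real t + 1)"
            using L1[of L] LL0 unfolding bad_arms_def L0_def by (auto simp: not_less)
          then show ?thesis using t by linarith
        qed
        have cov: "cov n \<in> {0..2 * ((2 * 3 ^ L + 1) / (real n + 1) + s) * K}"
          unfolding cov_def K_def using \<epsilon> s by (intro quenched_covariance[OF p0 p(2) _ _ arm]) auto
        have "(2 * 3 ^ L + 1) / (real n + 1) \<le> s"
        proof -
          have "real (9 ^ L) \<le> real n" using L(1) by (rule of_nat_mono)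
          then have "(9 :: real) ^ L \<le> real n + 1" unfolding of_nat_power of_nat_numeral by linarith
          \<comment> \<open>The proportion of lines within the cut-off radius is at most 3 * 3^L /
            9^L = 3 * 3^(-L), which explains the choice of \<open>L2\<close> with
            \<open>s / 3\<close>.\<close>
          then have "(2 * 3 ^ L + 1) / (real n + 1) \<le> (3 * 3 ^ L) / 9 ^ L"
            by (intro frac_le) (auto intro: one_le_power)
          also have "\<dots> = 3 * (1/3) ^ L"
          proof -
            have "(9 :: real) ^ L = 3 ^ L * 3 ^ L" unfolding power_mult_distrib[symmetric] by simp
            then show ?thesis by (simp add: power_divide)
          qed
          also have "\<dots> \<le> 3 * (1/3) ^ L2"
            using LL0 by (intro mult_left_mono power_decreasing) (auto simp: L0_def)
          also have "\<dots> \<le> s" using L2 by simp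
          finally show ?thesis .
        qed
        then have "2 * ((2 * 3 ^ L + 1) / (real n + 1) + s) * K \<le> 2 * (s + s) * (K + 1)"
          using s K by (intro mult_mono) auto
        also have "\<dots> = d / 2"
        proof -
          have "2 * (d / (8 * x) + d / (8 * x)) * x = d / 2" if "0 < x" for x :: real using that by (simp add: field_simps)
          then show ?thesis unfolding s_def by this (use K in simp)
        qed
        finally show "norm (cov n - 0) < d" using cov d by auto
      qed
    qed
    then show "(\<lambda>n. (\<integral>(\<xi>, \<eta>, \<xi>'). crossing_indicator n (m n) (\<psi> \<odot> \<xi>) *
                      crossing_indicator n (m n) (\<psi> \<odot> resample \<eta> \<xi>' \<xi>)
            \<partial>noise_space (1 / (2 * r)) \<epsilon>)
       - (\<integral>\<xi>. crossing_indicator n (m n) (\<psi> \<odot> \<xi>) \<partial>percolation (1 / (2 * r)))\<^sup>2)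
    \<longlonglongrightarrow> 0" unfolding cov_def p_def .
  qed
qed

end
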